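(* Let $d\ge 1$ and let $\tau:\mathbb R\to\mathbb R\cup\{-\infty\}$ be a function satisfying: (a) $\tau$ is concave and non-decreasing, $\tau(1)=0$ and $-d\le \tau(0)\le 0$; (b) $\mathrm{dom}(\tau)$ equals either $\mathbb R$ or $\mathbb R_+$, and $\tau^*$ is non-negative on its domain. Let $D\in[\tau'(1^+),\tau'(1^-)]$. Then there exists a homogeneously multifractal measure $\mu\in\mathcal M^+_c(\mathbb R^d)$, exact dimensional with dimension $D$, such that $\tau_\mu=\tau$ and $\mu$ strongly satisfies the multifractal formalism, i.e. $f^H_\mu(\alpha)=\tau_\mu^*(\alpha)$ for every $\alpha\in\mathbb R\cup\{\infty\}$.
   Context: $\mathcal M^+_c(\mathbb R^d)$ is the set of positive, finite, compactly supported Borel measures on $\mathbb R^d$; $\mathrm{supp}(\mu)$ is the topological support; $B(x,r)$ is the closed ball. Lower and upper local dimensions: $\underline d(\mu,x)=\liminf_{r\to0^+}\frac{\log\mu(B(x,r))}{\log r}$, $\overline d(\mu,x)=\limsup_{r\to0^+}\frac{\log\mu(B(x,r))}{\log r}$. For $\alpha\in\mathbb R\cup\{\infty\}$: $\underline E(\mu,\alpha)=\{x\in\mathrm{supp}(\mu):\underline d(\mu,x)=\alpha\}$, $E(\mu,\alpha)=\{x\in\mathrm{supp}(\mu):\underline d(\mu,x)=\overline d(\mu,x)=\alpha\}$, and $f^H_\mu(\alpha)=\dim_H E(\mu,\alpha)$, $\underline f^H_\mu(\alpha)=\dim_H\underline E(\mu,\alpha)$ (lower Hausdorff spectrum), with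 $\dim_H\emptyset=-\infty$. The $L^q$-spectrum is $\tau_\mu(q)=\liminf_{r\to0^+}\frac{\log\sup\{\sum_i\mu(B(x_i,r))^q\}}{\log r}$, the supremum over all centered packings of $\mathrm{supp}(\mu)$ by closed balls of radius $r$ (families of pairwise disjoint closed balls $B(x_i,r)$ with $x_i\in\mathrm{supp}(\mu)$). $\mathrm{dom}(h)=\{x:h(x)>-\infty\}$. For $\tau:\mathbb R\to\mathbb R\cup\{-\infty\}$ with $0\in\mathrm{dom}(\tau)$, the extended concave Legendre–Fenchel transform is $\tau^*(\alpha)=\inf\{\alpha q-\tau(q):q\in\mathrm{dom}(\tau)\}$ for $\alpha\in\mathbb R$ and $\tau^*(\infty)=\inf\{\infty\cdot q-\tau(q):q\in\mathrm{dom}(\tau)\cap\mathbb R_-\}$, with conventions $\infty\cdot q=-\infty$ for $q<0$ and $\infty\cdot0=0$. $\tau'(1^\pm)$ denote one-sided derivatives at $1$. $\mu$ is exact dimensional with dimension $D$ if $\lim_{r\to0^+}\frac{\log\mu(B(x,r))}{\log r}=D$ for $\mu$-a.e. $x$. $\mu$ is homogeneously multifractal (HM) if the lower Hausdorff spectrum of the restriction of $\mu$ to any closed ball whose interior intersects $\mathrm{supp}(\mu)$ equals $\underline f^H_\mu$. *)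

theory Defs
  imports "HOL-Analysis.Analysis" "HOL-Probability.Probability"
begin

definition supp_meas :: "'a::metric_space measure \<Rightarrow> 'a set" where
  "supp_meas M = {x. \<forall>e>0. 0 < emeasure M (ball x e)}"

definition Mc :: "'a::euclidean_space measure \<Rightarrow> bool" where
  "Mc M \<longleftrightarrow> sets M = sets borel \<and> emeasure M (space M) \<noteq> \<infinity> \<and> compact (supp_meas M)"

definition lower_ldim :: "'a::metric_space measure \<Rightarrow> 'a \<Rightarrow> ereal" where
  "lower_ldim M x = Liminf (at_right (0::real))
     (\<lambda>r. ereal (ln (measure M (cball x r)) / ln r))"

definition upper_ldim :: "'a::metric_space measure \<Rightarrow> 'a \<Rightarrow> ereal" where
  "upper_ldim M x = Limsup (at_right (0::real))
     (\<lambda>r. ereal (ln (measure M (cball x r)) / ln r))"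

definition lowerE :: "'a::metric_space measure \<Rightarrow> ereal \<Rightarrow> 'a set" where
  "lowerE M \<alpha> = {x \<in> supp_meas M. lower_ldim M x = \<alpha>}"

definition levelE :: "'a::metric_space measure \<Rightarrow> ereal \<Rightarrow> 'a set" where
  "levelE M \<alpha> = {x \<in> supp_meas M. lower_ldim M x = \<alpha> \<and> upper_ldim M x = \<alpha>}"

definition hcontent :: "real \<Rightarrow> real \<Rightarrow> 'a::metric_space set \<Rightarrow> ennreal" where
  "hcontent s \<delta> A = (INF U \<in> {U :: nat \<Rightarrow> 'a set. A \<subseteq> (\<Union>i. U i) \<and>
        (\<forall>i. bounded (U i) \<and> diameter (U i) \<le> \<delta>)}.
      (\<Sum>i. ennreal (diameter (U i) powr s)))"

definition hmeasure :: "real \<Rightarrow> 'a::metric_space set \<Rightarrow> ennreal" where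
  "hmeasure s A = (SUP \<delta> \<in> {0<..}. hcontent s \<delta> A)"

definition hdim :: "'a::metric_space set \<Rightarrow> ereal" where
  "hdim A = (if A = {} then -\<infinity> else Inf {ereal s | s. 0 < s \<and> hmeasure s A = 0})"

definition fH :: "'a::metric_space measure \<Rightarrow> ereal \<Rightarrow> ereal" where
  "fH M \<alpha> = hdim (levelE M \<alpha>)"

definition lower_fH :: "'a::metric_space measure \<Rightarrow> ereal \<Rightarrow> ereal" where
  "lower_fH M \<alpha> = hdim (lowerE M \<alpha>)"

text \<open>Centered packings of the support by closed balls of radius r (for a compactly
  supported measure such packings are necessarily finite).\<close>
definition packing_sums :: "'a::metric_space measure \<Rightarrow> real \<Rightarrow> real \<Rightarrow> real set" where
  "packing_sums M q r = {(\<Sum>x\<in>P. measure M (cball x r) powr q) | P.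
      finite P \<and> P \<subseteq> supp_meas M \<and> disjoint_family_on (\<lambda>x. cball x r) P}"

definition Lq_spectrum :: "'a::metric_space measure \<Rightarrow> real \<Rightarrow> ereal" where
  "Lq_spectrum M q = Liminf (at_right (0::real))
      (\<lambda>r. ereal (ln (Sup (packing_sums M q r)) / ln r))"

definition tdom :: "(real \<Rightarrow> ereal) \<Rightarrow> real set" where
  "tdom h = {x. h x > -\<infinity>}"

text \<open>For real alpha: inf over dom; for alpha = infinity: inf over dom intersected with
  the non-positive reals, using infinity * q = -infinity (q<0) and infinity * 0 = 0
  (which is exactly ereal multiplication).\<close>
definition legendre :: "(real \<Rightarrow> ereal) \<Rightarrow> ereal \<Rightarrow> ereal" where
  "legendre \<tau> \<alpha> = (INF q \<in> (if \<alpha> = \<infinity> then tdom \<tau> \<inter> {..0} else tdom \<tau>).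
       \<alpha> * ereal q - \<tau> q)"

definition concave_ext :: "(real \<Rightarrow> ereal) \<Rightarrow> bool" where
  "concave_ext \<tau> \<longleftrightarrow> (\<forall>x y t. 0 < t \<and> t < 1 \<longrightarrow>
      ereal t * \<tau> x + ereal (1 - t) * \<tau> y \<le> \<tau> (t * x + (1 - t) * y))"

definition right_deriv :: "(real \<Rightarrow> ereal) \<Rightarrow> real \<Rightarrow> real" where
  "right_deriv \<tau> x = Lim (at_right (0::real))
     (\<lambda>h. (real_of_ereal (\<tau> (x + h)) - real_of_ereal (\<tau> x)) / h)"

definition left_deriv :: "(real \<Rightarrow> ereal) \<Rightarrow> real \<Rightarrow> real" where
  "left_deriv \<tau> x = Lim (at_left (0::real))
     (\<lambda>h. (real_of_ereal (\<tau> (x + h)) - real_of_ereal (\<tau> x)) / h)"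

definition exact_dimensional :: "'a::metric_space measure \<Rightarrow> real \<Rightarrow> bool" where
  "exact_dimensional M D \<longleftrightarrow>
     (AE x in M. ((\<lambda>r. ln (measure M (cball x r)) / ln r) \<longlongrightarrow> D) (at_right 0))"

definition homog_multifractal :: "'a::euclidean_space measure \<Rightarrow> bool" where
  "homog_multifractal M \<longleftrightarrow>
     (\<forall>c r. 0 < r \<and> ball c r \<inter> supp_meas M \<noteq> {} \<longrightarrow>
        (\<forall>\<alpha>. \<alpha> \<noteq> -\<infinity> \<longrightarrow>
           lower_fH (density M (indicator (cball c r))) \<alpha> = lower_fH M \<alpha>))"

end

theory Submission
  imports Defs
begin

text \<open>The measure is the image of a product measure under a coding of a Cantor set of product form
  \<open>K \<times> \<dots> \<times> K\<close>. A digit of generation \<open>k\<close> is of one of finitely many types, a type being a point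
  \<open>(\<alpha>, f)\<close> of the graph of the Legendre transform of \<open>\<tau>\<close>: in a block of length \<open>l\<close> there are about
  \<open>exp (l * f)\<close> digits of this type, each of probability about \<open>exp (- l * \<alpha>)\<close>. The type
  \<open>(D, D)\<close> receives all the mass up to a summable error, so by Borel and Cantelli almost every point
  eventually uses only this type, whence the exact dimension. The moment sums of generation \<open>k\<close> are
  governed by the maximum of \<open>f - q * \<alpha>\<close>, which is \<open>- \<tau> q\<close> by duality as the types become
  dense in the graph; this gives the \<open>L\<^sup>q\<close> spectrum and the upper bounds for the level sets. Using
  only types close to \<open>(\<alpha>, f)\<close> from some generation on yields a Cantor set of dimension \<open>f\<close> inside
  the level set of \<open>\<alpha>\<close> and inside any given cell, which gives the lower bounds and homogeneity.\<close>

subsection \<open>Hausdorff dimension\<close>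

text \<open>The obstacle is homogeneity at the boundary of a ball. For negative \<open>q\<close> the
  upper bounds on dimensions need small cells near every point, and a point on the sphere may see
  far less of the restricted measure than of the full one. This is why the digits of a generation
  form a full cube \<open>Basis \<rightarrow>\<^sub>E {..<n k}\<close>: in such a support single
  coordinates of two points can be exchanged, which produces points of the support inside the ball
  or else shows that the boundary point is an atom. The price is that the number of digits is an
  exact power and that every digit carries mass. The surplus goes to one extra type of dimension
  \<open>T = - \<tau> 0\<close>, the box dimension of the support, with an exponent for which
  \<open>T - q * \<alpha>\<close> eventually stays below \<open>- \<tau> q\<close>. If \<tau> is
  \<open>-\<infinity>\<close> on the negative axis, the exponent of this type tends to infinity; it
  then yields both the infinite moments and the level set of \<alpha> = \<infinity>. The mass can be
  concentrated on type \<open>(D, D)\<close> because \<open>D\<close> is a supporting slope at 1,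
  where \<tau> vanishes, hence a fixed point of the transform.\<close>

lemma hcontent_mono: "A \<subseteq> B \<Longrightarrow> hcontent s \<delta> A \<le> hcontent s \<delta> B"
  unfolding hcontent_def by (rule INF_superset_mono) auto

lemma hmeasure_mono: "A \<subseteq> B \<Longrightarrow> hmeasure s A \<le> hmeasure s B"
  unfolding hmeasure_def by (rule SUP_mono) (use hcontent_mono in blast)

lemma hdim_mono:
  assumes "A \<subseteq> B"
  shows "hdim A \<le> hdim B"
proof (cases "A = {}")
  case False
  then have "B \<noteq> {}" using assms by auto
  have "hmeasure s A = 0" if "hmeasure s B = 0" for s
    using hmeasure_mono[OF assms, of s] that by simp
  then have "Inf {ereal s | s. 0 < s \<and> hmeasure s A = 0} \<le> Inf {ereal s | s. 0 < s \<and> hmeasure s B = 0}"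
    by (intro Inf_superset_mono) blast
  then show ?thesis using False \<open>B \<noteq> {}\<close> by (simp add: hdim_def)
qed (simp add: hdim_def)

lemma hdim_le:
  assumes "0 < s" "hmeasure s A = 0"
  shows "hdim A \<le> ereal s"
  unfolding hdim_def using assms by (auto intro: Inf_lower)

lemma hdim_nonneg: "A \<noteq> {} \<Longrightarrow> 0 \<le> hdim A"
  unfolding hdim_def by (auto intro!: Inf_greatest)

lemma le_hdim:
  assumes "A \<noteq> {}" and "\<And>s. 0 < s \<Longrightarrow> ereal s < c \<Longrightarrow> hmeasure s A \<noteq> 0"
  shows "c \<le> hdim A"
proof -
  have "c \<le> x" if "x \<in> {ereal s | s. 0 < s \<and> hmeasure s A = 0}" for x
    using that assms(2) by (force simp: not_less[symmetric])
  then have "c \<le> Inf {ereal s | s. 0 < s \<and> hmeasure s A = 0}" by (rule Inf_greatest)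
  then show ?thesis using assms(1) by (simp add: hdim_def)
qed

text \<open>An argument of Borel-Cantelli type: \<open>Y\<close> lies in the limsup of the families
  of balls, so the balls of all generations beyond any \<open>j0\<close> cover it, and the tail of
  the convergent series bounds the content at every mesh.\<close>

lemma hmeasure_limsup_zero:
  fixes Y :: "'a::euclidean_space set" and W :: "nat \<Rightarrow> 'a set" and \<rho> :: "nat \<Rightarrow> real"
  assumes s: "0 < s" and fin: "\<And>j. finite (W j)" and \<rho>0: "\<And>j. 0 < \<rho> j"
    and lim: "\<rho> \<longlonglongrightarrow> 0"
    and summ: "summable (\<lambda>j. real (card (W j)) * (2 * \<rho> j) powr s)"
    and Y: "\<And>x. x \<in> Y \<Longrightarrow> \<exists>\<^sub>F j in sequentially. \<exists>w\<in>W j. dist x w \<le> \<rho> j"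
  shows "hmeasure s Y = 0"
proof -
  define a where "a j = real (card (W j)) * (2 * \<rho> j) powr s" for j
  have a0: "0 \<le> a j" for j by (simp add: a_def)
  have sa: "summable a" using summ by (simp add: a_def[abs_def])
  have "hcontent s \<delta> Y = 0" if \<delta>: "\<delta> > 0" for \<delta>
  proof -
    have le_e: "hcontent s \<delta> Y \<le> 0 + ennreal e" if e: "0 < e" for e
    proof -
      from lim \<delta> have "\<forall>\<^sub>F j in sequentially. \<rho> j < \<delta> / 2"
        by (intro order_tendstoD(2)) auto
      then obtain j1 where j1: "\<And>j. j \<ge> j1 \<Longrightarrow> \<rho> j < \<delta> / 2" by (auto simp: eventually_sequentially)
      from suminf_exist_split[OF e sa] obtain j2 where
        j2: "\<And>m. m \<ge> j2 \<Longrightarrow> norm (\<Sum>i. a (i + m)) < e" by blast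
      define j0 where "j0 = max j1 j2"
      define enum where "enum j = (SOME h. bij_betw h {0..<card (W j)} (W j))" for j
      have enum: "bij_betw (enum j) {0..<card (W j)} (W j)" for j
        unfolding enum_def using ex_bij_betw_nat_finite[OF fin] by (rule someI_ex)
      define V where "V = (\<lambda>(j,k). if j \<ge> j0 \<and> k < card (W j) then cball (enum j k) (\<rho> j) else {})"
      define U where "U i = V (prod_decode i)" for i
      have cov: "Y \<subseteq> (\<Union>i. U i)"
      proof
        fix x assume "x \<in> Y"
        from Y[OF this] have "\<forall>N. \<exists>j\<ge>N. \<exists>w\<in>W j. dist x w \<le> \<rho> j"
          by (simp add: frequently_sequentially)
        then obtain j w where j: "j \<ge> j0" "w \<in> W j" "dist x w \<le> \<rho> j" by blast
        then obtain k where k: "k < card (W j)" "enum j k = w"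
          using enum[of j] unfolding bij_betw_def by (metis atLeastLessThan_iff imageE)
        have "x \<in> V (j,k)" using j k by (simp add: V_def dist_commute)
        then have "x \<in> U (prod_encode (j,k))" by (simp add: U_def)
        then show "x \<in> (\<Union>i. U i)" by blast
      qed
      have V: "bounded (V p) \<and> diameter (V p) \<le> \<delta>" for p
      proof (cases p)
        case (Pair j k)
        show ?thesis using j1[of j] \<rho>0[of j] \<delta> by (auto simp: Pair V_def j0_def)
      qed
      then have U: "bounded (U i) \<and> diameter (U i) \<le> \<delta>" for i
        by (simp add: U_def)
      define g where "g j = (if j \<ge> j0 then ennreal (a j) else 0)" for j
      have g: "g j = (\<Sum>k. ennreal (diameter (V (j,k)) powr s))" for j
      proof -
        have "(\<Sum>k. ennreal (diameter (V (j,k)) powr s)) = (\<Sum>k<card (W j). ennreal (diameter (V (j,k)) powr s))"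
          using s by (intro suminf_finite) (auto simp: V_def)
        also have "\<dots> = g j"
          using \<rho>0[of j] s by (auto simp: V_def g_def a_def sum_nonneg ennreal_mult ennreal_of_nat_eq_real_of_nat)
        finally show ?thesis by simp
      qed
      have sg: "(\<Sum>j. ennreal (a (j + j0))) = ennreal (\<Sum>j. a (j + j0))"
        using a0 sa by (intro suminf_ennreal2) (auto simp: summable_iff_shift)
      have "(\<Sum>i. ennreal (diameter (U i) powr s)) = suminf g"
        unfolding U_def by (rule suminf_ennreal_2dimen[where f = "\<lambda>p. ennreal (diameter (V p) powr s)", OF g])
      also have "suminf g = (\<Sum>j. g (j + j0))"
        using suminf_offset[of g j0] by (simp add: g_def)
      also have "\<dots> = ennreal (\<Sum>j. a (j + j0))" using sg by (simp add: g_def)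
      also have "\<dots> \<le> ennreal e" using j2[of j0] by (intro ennreal_leI) (auto simp: j0_def)
      finally have "(\<Sum>i. ennreal (diameter (U i) powr s)) \<le> ennreal e" .
      moreover have "hcontent s \<delta> Y \<le> (\<Sum>i. ennreal (diameter (U i) powr s))"
        unfolding hcontent_def using cov U by (intro INF_lower) auto
      ultimately show ?thesis by simp
    qed
    have "hcontent s \<delta> Y \<le> 0" by (rule ennreal_le_epsilon) (rule le_e)
    then show ?thesis by simp
  qed
  then show ?thesis unfolding hmeasure_def by (simp add: SUP_constant)
qed

text \<open>Mass distribution principle: the masses of the pieces of a cover add up to at least the
  mass of \<open>F\<close>. Covering sets are arbitrary and possibly not measurable, hence the
  measurable superset \<open>V\<close> of \<open>U \<inter> F\<close>.\<close>

lemma hmeasure_mass_distribution: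
  fixes M :: "'a::metric_space measure"
  assumes pos: "0 < emeasure M F" and C: "0 < C" and \<delta>: "0 < \<delta>"
    and F: "F \<in> sets M"
    and U: "\<And>U. bounded U \<Longrightarrow> diameter U \<le> \<delta> \<Longrightarrow>
       \<exists>V\<in>sets M. U \<inter> F \<subseteq> V \<and> emeasure M V \<le> ennreal (C * diameter U powr s)"
  shows "hmeasure s F \<noteq> 0"
proof -
  have "emeasure M F / ennreal C \<le> hcontent s \<delta> F"
    unfolding hcontent_def
  proof (rule INF_greatest)
    fix W :: "nat \<Rightarrow> 'a set"
    assume "W \<in> {U. F \<subseteq> (\<Union>i. U i) \<and> (\<forall>i. bounded (U i) \<and> diameter (U i) \<le> \<delta>)}"
    then have W: "F \<subseteq> (\<Union>i. W i)" "\<And>i. bounded (W i)" "\<And>i. diameter (W i) \<le> \<delta>" by auto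
    have "\<exists>V. \<forall>i. V i \<in> sets M \<and> W i \<inter> F \<subseteq> V i \<and> emeasure M (V i) \<le> ennreal (C * diameter (W i) powr s)"
      by (intro choice allI) (metis U W(2,3))
    then obtain V where V: "\<And>i. V i \<in> sets M" "\<And>i. W i \<inter> F \<subseteq> V i"
      "\<And>i. emeasure M (V i) \<le> ennreal (C * diameter (W i) powr s)" by blast
    have "emeasure M F \<le> emeasure M (\<Union>i. V i)"
    proof (rule emeasure_mono)
      show "F \<subseteq> (\<Union>i. V i)"
      proof
        fix x assume "x \<in> F"
        then obtain i where "x \<in> W i" using W(1) by blast
        then show "x \<in> (\<Union>i. V i)" using V(2)[of i] \<open>x \<in> F\<close> by blast
      qed
    qed (use V(1) in auto)
    also have "\<dots> \<le> (\<Sum>i. emeasure M (V i))" using V by (intro emeasure_subadditive_countably) auto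
    also have "\<dots> \<le> (\<Sum>i. ennreal (C * diameter (W i) powr s))" using V by (intro suminf_le) auto
    also have "\<dots> = ennreal C * (\<Sum>i. ennreal (diameter (W i) powr s))"
      using C by (simp add: ennreal_mult)
    finally show "emeasure M F / ennreal C \<le> (\<Sum>i. ennreal (diameter (W i) powr s))"
      using C by (intro divide_le_posI_ennreal) (auto simp: mult.commute)
  qed
  also have "\<dots> \<le> hmeasure s F" unfolding hmeasure_def using \<delta> by (intro SUP_upper) auto
  finally have "emeasure M F / ennreal C \<le> hmeasure s F" .
  moreover have "0 < emeasure M F / ennreal C" using pos C by (simp add: ennreal_zero_less_divide)
  ultimately show ?thesis by auto
qed

subsection \<open>Product Cantor sets\<close>

text \<open>Generation \<open>k\<close> replaces a cell by \<open>n k ^ d\<close> cells whose size is smaller by the factor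
  \<open>exp (- len k)\<close>. The bound on \<open>4 * n k\<close> makes distinct cells separated at their own scale, and
  the last assumption makes consecutive scales comparable on the logarithmic scale.\<close>

locale grid_code =
  fixes n :: "nat \<Rightarrow> nat" and len :: "nat \<Rightarrow> real"
  assumes n_pos: "0 < n k"
    and n_le: "4 * real (n k) \<le> exp (len k)"
    and len_small: "(\<lambda>j. len j / (\<Sum>k<j. len k)) \<longlonglongrightarrow> 0"
begin

definition depth :: "nat \<Rightarrow> real" where
  "depth j = (\<Sum>k<j. len k)"

definition scale :: "nat \<Rightarrow> real" where
  "scale j = exp (- depth j)"

definition digits :: "nat \<Rightarrow> ('a::euclidean_space \<Rightarrow> nat) set" where
  "digits k = (Basis \<rightarrow>\<^sub>E {..<n k})"

text \<open>An expansion in variable bases, used with digits below \<open>n k\<close> only. By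
  \<open>n_le\<close> these fill at most a quarter of the side of the parent cell, and the gaps keep
  the coding injective.\<close>

definition coord :: "(nat \<Rightarrow> 'a::euclidean_space \<Rightarrow> nat) \<Rightarrow> 'a \<Rightarrow> real" where
  "coord w b = (\<Sum>k. scale (Suc k) * real (w k b))"

definition point :: "(nat \<Rightarrow> 'a::euclidean_space \<Rightarrow> nat) \<Rightarrow> 'a" where
  "point w = (\<Sum>b\<in>Basis. coord w b *\<^sub>R b)"

definition seqs :: "(nat \<Rightarrow> 'b set) \<Rightarrow> (nat \<Rightarrow> 'b) set" where
  "seqs A = {w. \<forall>k. w k \<in> A k}"

definition agree :: "nat \<Rightarrow> (nat \<Rightarrow> 'b) \<Rightarrow> (nat \<Rightarrow> 'b) \<Rightarrow> bool" where
  "agree j w w' \<longleftrightarrow> (\<forall>k<j. w k = w' k)"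

text \<open>\<open>exp (len k)\<close> is at least 4 because \<open>n k\<close> is positive, and 4
  exceeds e. The resulting linear growth of \<open>depth\<close> later turns exponentials of the
  depth into geometric series.\<close>

lemma len_ge_1: "1 \<le> len k"
proof (rule ccontr)
  assume "\<not> 1 \<le> len k"
  then have "exp (len k) < exp 1" by simp
  also have "exp 1 \<le> (3::real)" by (rule exp_le)
  finally have "4 * real (n k) < 3" using n_le[of k] by linarith
  moreover have "real (n k) \<ge> 1" using n_pos[of k] by linarith
  ultimately show False by linarith
qed

lemma depth_0 [simp]: "depth 0 = 0" by (simp add: depth_def)

lemma depth_Suc: "depth (Suc j) = depth j + len j" by (simp add: depth_def)

lemma depth_ge: "real j \<le> depth j"
proof (induction j)
  case (Suc j)
  then show ?case using len_ge_1[of j] by (simp add: depth_Suc)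
qed simp

lemma depth_nonneg: "0 \<le> depth j" using depth_ge[of j] by linarith

lemma depth_pos: "0 < j \<Longrightarrow> 0 < depth j" using depth_ge[of j] by linarith

lemma depth_mono: "i \<le> j \<Longrightarrow> depth i \<le> depth j"
proof (rule lift_Suc_mono_le[of depth])
  show "depth k \<le> depth (Suc k)" for k using len_ge_1[of k] by (simp add: depth_Suc)
qed

lemma depth_at_top: "filterlim depth at_top sequentially"
  by (rule filterlim_at_top_mono[OF filterlim_real_sequentially]) (simp add: depth_ge)

text \<open>A single step changes the depth by the factor \<open>1 + len j / depth j\<close>, which
  tends to 1 by \<open>len_small\<close>. Geometric constants cost a bounded number of generations
  below, and this limit is why they disappear from all dimensions.\<close>

lemma depth_ratio: "(\<lambda>j. depth (j + i) / depth j) \<longlonglongrightarrow> 1"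
proof (induction i)
  case 0
  have "\<forall>\<^sub>F j in sequentially. 1 = depth (j + 0) / depth j"
    using eventually_gt_at_top[of "0::nat"]
  proof eventually_elim
    case (elim j)
    then show ?case using depth_pos[of j] by simp
  qed
  then show ?case by (rule Lim_transform_eventually[OF tendsto_const])
next
  case (Suc i)
  have "(\<lambda>j. 1 + len j / depth j) \<longlonglongrightarrow> 1 + 0"
    using len_small by (intro tendsto_intros) (simp add: depth_def)
  moreover have "\<forall>\<^sub>F j in sequentially. 1 + len j / depth j = depth (Suc j) / depth j"
    using eventually_gt_at_top[of "0::nat"]
  proof eventually_elim
    case (elim j)
    then show ?case using depth_pos[of j] by (simp add: depth_Suc add_divide_distrib)
  qed
  ultimately have 1: "(\<lambda>j. depth (Suc j) / depth j) \<longlonglongrightarrow> 1"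
    by (simp add: Lim_transform_eventually)
  have "(\<lambda>j. (depth (Suc (j + i)) / depth (j + i)) * (depth (j + i) / depth j)) \<longlonglongrightarrow> 1 * 1"
    by (intro tendsto_mult Suc.IH LIMSEQ_ignore_initial_segment[OF 1])
  moreover have "\<forall>\<^sub>F j in sequentially. (depth (Suc (j + i)) / depth (j + i)) * (depth (j + i) / depth j)
      = depth (j + Suc i) / depth j"
    using eventually_gt_at_top[of 0]
  proof eventually_elim
    case (elim j)
    then have "depth (j + i) > 0" using depth_pos by simp
    then show ?case by simp
  qed
  ultimately show ?case by (simp add: Lim_transform_eventually)
qed

lemma scale_pos: "0 < scale j" by (simp add: scale_def)

lemma scale_0 [simp]: "scale 0 = 1" by (simp add: scale_def)

lemma scale_n: "scale (Suc k) * real (n k) \<le> scale k / 4"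
proof -
  have "scale (Suc k) * (4 * real (n k)) \<le> scale (Suc k) * exp (len k)"
    using n_le[of k] scale_pos[of "Suc k"] by (intro mult_left_mono) auto
  also have "\<dots> = scale k" by (simp add: scale_def depth_Suc exp_add[symmetric])
  finally show ?thesis by simp
qed

lemma scale_Suc: "scale (Suc k) \<le> scale k / 4"
proof -
  have "scale (Suc k) * 1 \<le> scale (Suc k) * real (n k)"
    using n_pos[of k] scale_pos[of "Suc k"] by (intro mult_left_mono) auto
  then show ?thesis using scale_n[of k] by simp
qed

lemma scale_add: "scale (j + i) \<le> scale j * (1/4) ^ i"
proof (induction i)
  case (Suc i)
  then show ?case using scale_Suc[of "j + i"] by simp
qed simp

lemma scale_antimono: "i \<le> j \<Longrightarrow> scale j \<le> scale i"
  by (simp add: scale_def depth_mono)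

lemma scale_tendsto_0: "scale \<longlonglongrightarrow> 0"
proof (rule tendsto_sandwich[of "\<lambda>_. 0" _ _ "\<lambda>i. (1/4) ^ i"])
  show "(\<lambda>i. (1/4) ^ i :: real) \<longlonglongrightarrow> 0" by (rule LIMSEQ_power_zero) simp
qed (use scale_pos scale_add[of 0] in \<open>auto simp: less_imp_le\<close>)

lemma agree_sym: "agree j w w' \<longleftrightarrow> agree j w' w" by (auto simp: agree_def)

lemma agree_refl [simp]: "agree j w w" by (simp add: agree_def)

lemma agree_trans: "agree j w w' \<Longrightarrow> agree j w' w'' \<Longrightarrow> agree j w w''" by (auto simp: agree_def)

lemma agree_mono: "agree j w w' \<Longrightarrow> i \<le> j \<Longrightarrow> agree i w w'" by (auto simp: agree_def)

lemma seqs_mono: "(\<And>k. A k \<subseteq> B k) \<Longrightarrow> seqs A \<subseteq> seqs B" by (auto simp: seqs_def)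

lemma digits_finite [simp]: "finite (digits k)" by (auto simp: digits_def intro!: finite_PiE)

lemma card_digits: "card (digits k :: ('a::euclidean_space \<Rightarrow> nat) set) = n k ^ DIM('a)"
  by (simp add: digits_def card_PiE)

lemma digits_nonempty: "digits k \<noteq> {}"
  using n_pos by (auto simp: digits_def PiE_eq_empty_iff)

section \<open>Geometry of the coding: diameter and separation of cells\<close>

lemma term_bounds:
  assumes "w \<in> seqs digits" "b \<in> Basis"
  shows "0 \<le> scale (Suc k) * real (w k b)" "scale (Suc (i + j)) * real (w (i + j) b) \<le> scale j / 4 * (1/4) ^ i"
proof -
  show "0 \<le> scale (Suc k) * real (w k b)" using scale_pos[of "Suc k"] by simp
  have "w (i + j) b < n (i + j)" using assms by (auto simp: seqs_def digits_def PiE_def Pi_def)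
  then have "scale (Suc (i + j)) * real (w (i + j) b) \<le> scale (Suc (i + j)) * real (n (i + j))"
    using scale_pos[of "Suc (i+j)"] by (intro mult_left_mono) auto
  also have "\<dots> \<le> scale (i + j) / 4" by (rule scale_n)
  also have "\<dots> \<le> scale j / 4 * (1/4) ^ i" using scale_add[of j i] by (simp add: add.commute)
  finally show "scale (Suc (i + j)) * real (w (i + j) b) \<le> scale j / 4 * (1/4) ^ i" .
qed

text \<open>The tail is dominated by the geometric series with first term \<open>scale j / 4\<close>
  and ratio 1/4, whose sum is \<open>scale j / 3\<close>.\<close>

lemma coord_tail:
  assumes "w \<in> seqs digits" "b \<in> Basis"
  obtains t where "0 \<le> t" "t \<le> scale j / 3"
    "coord w b = (\<Sum>k<j. scale (Suc k) * real (w k b)) + t"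
proof -
  define g where "g = (\<lambda>i. scale j / 4 * (1/4::real) ^ i)"
  have g: "g sums (scale j / 4 * (1 / (1 - 1/4)))"
    unfolding g_def by (intro sums_mult geometric_sums) simp
  define f where "f = (\<lambda>k. scale (Suc k) * real (w k b))"
  have f: "summable (\<lambda>i. f (i + j))"
    by (rule summable_comparison_test[OF _ sums_summable[OF g]])
      (use term_bounds[OF assms] in \<open>auto simp: f_def g_def\<close>)
  then have sf: "summable f" by simp
  have "coord w b = (\<Sum>i. f (i + j)) + (\<Sum>k<j. f k)"
    unfolding coord_def f_def[symmetric] by (rule suminf_split_initial_segment[OF sf])
  moreover have "0 \<le> (\<Sum>i. f (i + j))"
    using f term_bounds(1)[OF assms] by (intro suminf_nonneg) (auto simp: f_def)
  moreover have "(\<Sum>i. f (i + j)) \<le> suminf g"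
    using f sums_summable[OF g] term_bounds[OF assms] by (intro suminf_le) (auto simp: f_def g_def)
  moreover have "suminf g = scale j / 3" using sums_unique[OF g] by simp
  ultimately show ?thesis by (intro that[of "\<Sum>i. f (i + j)"]) (auto simp: f_def)
qed

lemma coord_agree:
  assumes "w \<in> seqs digits" "w' \<in> seqs digits" "b \<in> Basis" "agree j w w'"
  shows "\<bar>coord w b - coord w' b\<bar> \<le> scale j / 3"
proof -
  have "(\<Sum>k<j. scale (Suc k) * real (w k b)) = (\<Sum>k<j. scale (Suc k) * real (w' k b))"
    using assms(4) by (intro sum.cong) (auto simp: agree_def)
  then show ?thesis
    using coord_tail[OF assms(1,3), of j] coord_tail[OF assms(2,3), of j] by (smt (verit))
qed

text \<open>Different digits at position \<open>k\<close> displace some coordinate by at least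
  \<open>scale (Suc k)\<close>, while the tails differ by at most a third of it; two thirds remain,
  more than the half claimed.\<close>

lemma coord_disagree:
  assumes "w \<in> seqs digits" "w' \<in> seqs digits" "agree k w w'" "w k \<noteq> w' k"
  shows "\<exists>b\<in>Basis. scale (Suc k) / 2 \<le> \<bar>coord w b - coord w' b\<bar>"
proof -
  have "w k \<in> digits k" "w' k \<in> digits k" using assms by (auto simp: seqs_def)
  then obtain b where b: "b \<in> Basis" "w k b \<noteq> w' k b"
    using assms(4) unfolding digits_def by (metis PiE_ext)
  obtain t where t: "0 \<le> t" "t \<le> scale (Suc k) / 3"
    "coord w b = (\<Sum>i<Suc k. scale (Suc i) * real (w i b)) + t" using coord_tail[OF assms(1) b(1)] .
  obtain t' where t': "0 \<le> t'" "t' \<le> scale (Suc k) / 3"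
    "coord w' b = (\<Sum>i<Suc k. scale (Suc i) * real (w' i b)) + t'" using coord_tail[OF assms(2) b(1)] .
  have "(\<Sum>i<k. scale (Suc i) * real (w i b)) = (\<Sum>i<k. scale (Suc i) * real (w' i b))"
    using assms(3) by (intro sum.cong) (auto simp: agree_def)
  then have eq: "coord w b - coord w' b = scale (Suc k) * (real (w k b) - real (w' k b)) + (t - t')"
    using t t' by (simp add: algebra_simps)
  have "1 \<le> \<bar>real (w k b) - real (w' k b)\<bar>" using b(2) by linarith
  then have "scale (Suc k) * 1 \<le> scale (Suc k) * \<bar>real (w k b) - real (w' k b)\<bar>"
    using scale_pos[of "Suc k"] by (intro mult_left_mono) auto
  also have "\<dots> = \<bar>scale (Suc k) * (real (w k b) - real (w' k b))\<bar>"
    using scale_pos[of "Suc k"] by (simp add: abs_mult)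
  finally have "scale (Suc k) / 2 \<le> \<bar>coord w b - coord w' b\<bar>"
    using eq t t' scale_pos[of "Suc k"] by linarith
  then show ?thesis using b by blast
qed

lemma point_inner [simp]: "b \<in> Basis \<Longrightarrow> point w \<bullet> b = coord w b"
  by (simp add: point_def inner_sum_left inner_Basis if_distrib cong: if_cong)

lemma dist_point_agree:
  fixes w w' :: "nat \<Rightarrow> 'a::euclidean_space \<Rightarrow> nat"
  assumes "w \<in> seqs digits" "w' \<in> seqs digits" "agree j w w'"
  shows "dist (point w) (point w') \<le> DIM('a) * scale j"
proof -
  have "dist (point w) (point w') \<le> (\<Sum>b\<in>Basis. \<bar>(point w - point w') \<bullet> b\<bar>)"
    unfolding dist_norm by (rule norm_le_l1)
  also have "\<dots> \<le> (\<Sum>b\<in>(Basis::'a set). scale j)"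
  proof (rule sum_mono)
    fix b :: 'a assume "b \<in> Basis"
    then show "\<bar>(point w - point w') \<bullet> b\<bar> \<le> scale j"
      using coord_agree[OF assms(1,2) _ assms(3)] scale_pos[of j] by (force simp: inner_diff_left)
  qed
  finally show ?thesis by simp
qed

lemma dist_point_disagree:
  assumes "w \<in> seqs digits" "w' \<in> seqs digits" "\<not> agree j w w'"
  shows "scale j / 2 \<le> dist (point w) (point w')"
proof -
  define k where "k = (LEAST k. k < j \<and> w k \<noteq> w' k)"
  have k: "k < j" "w k \<noteq> w' k"
    using LeastI_ex[of "\<lambda>k. k < j \<and> w k \<noteq> w' k"] assms(3) by (auto simp: k_def agree_def)
  have "agree k w w'"
    using not_less_Least[of _ "\<lambda>k. k < j \<and> w k \<noteq> w' k"] k unfolding agree_def k_def[symmetric]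
    by (meson less_trans)
  from coord_disagree[OF assms(1,2) this k(2)] obtain b
    where b: "b \<in> Basis" "scale (Suc k) / 2 \<le> \<bar>coord w b - coord w' b\<bar>" by blast
  have "scale j \<le> scale (Suc k)" using k by (intro scale_antimono) auto
  also have "scale (Suc k) / 2 \<le> \<bar>(point w - point w') \<bullet> b\<bar>" using b by (simp add: inner_diff_left)
  also have "\<dots> \<le> dist (point w) (point w')" unfolding dist_norm by (rule Basis_le_norm[OF b(1)])
  finally show ?thesis by simp
qed

lemma point_inj:
  assumes "w \<in> seqs digits" "w' \<in> seqs digits" "point w = point w'"
  shows "w = w'"
proof (rule ccontr)
  assume "w \<noteq> w'"
  then obtain k where "w k \<noteq> w' k" by blast
  then have "\<not> agree (Suc k) w w'" by (auto simp: agree_def)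
  from dist_point_disagree[OF assms(1,2) this] show False
    using assms(3) scale_pos[of "Suc k"] by simp
qed

text \<open>The digits of a generation range over a full product, so the digit sequence of one
  coordinate can be replaced by that of another point. \<open>accessible_ball\<close> rests on
  this.\<close>

lemma swap_coordinate:
  assumes "w \<in> seqs digits" "w' \<in> seqs digits" "b \<in> Basis"
  obtains w'' where "w'' \<in> seqs digits" "point w'' = point w + ((point w' - point w) \<bullet> b) *\<^sub>R b"
proof
  let ?w = "\<lambda>k. (w k)(b := w' k b)"
  show "?w \<in> seqs digits"
    using assms by (auto simp: seqs_def digits_def PiE_def Pi_def extensional_def)
  have cw: "coord ?w c = (if c = b then coord w' b else coord w c)" for c
    by (auto simp: coord_def)
  show "point ?w = point w + ((point w' - point w) \<bullet> b) *\<^sub>R b"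
  proof (rule euclidean_eqI)
    fix c :: 'a assume "c \<in> Basis"
    then show "point ?w \<bullet> c = (point w + ((point w' - point w) \<bullet> b) *\<^sub>R b) \<bullet> c"
      using assms(3) cw[of c]
      by (cases "c = b") (simp_all add: inner_add_left inner_diff_left inner_Basis)
  qed
qed

text \<open>Codes \<open>w j\<close> approximating a limit point within \<open>scale j / 4\<close>
  must share initial segments, since codes that disagree before position \<open>i\<close> are at
  least \<open>scale i / 2\<close> apart; the diagonal sequence then codes the limit.\<close>

lemma closed_point_seqs:
  fixes A :: "nat \<Rightarrow> ('a::euclidean_space \<Rightarrow> nat) set"
  assumes A: "\<And>k. A k \<subseteq> digits k"
  shows "closed (point ` seqs A)"
  unfolding closed_sequential_limits
proof (intro allI impI)
  have sub: "seqs A \<subseteq> seqs digits" using A by (rule seqs_mono)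
  fix y and x :: 'a
  assume "(\<forall>i. y i \<in> point ` seqs A) \<and> y \<longlonglongrightarrow> x"
  then have y: "\<And>i. y i \<in> point ` seqs A" and lim: "y \<longlonglongrightarrow> x" by auto
  have "\<exists>w. w \<in> seqs A \<and> dist (point w) x < scale j / 4" for j
  proof -
    have "\<forall>\<^sub>F i in sequentially. dist (y i) x < scale j / 4"
      using lim scale_pos[of j] by (intro tendstoD) auto
    then obtain i where "dist (y i) x < scale j / 4" by (auto simp: eventually_sequentially)
    then show ?thesis using y[of i] by auto
  qed
  then obtain w where w: "\<And>j. w j \<in> seqs A" "\<And>j. dist (point (w j)) x < scale j / 4" by metis
  have ag: "agree i (w i) (w j)" if "i \<le> j" for i j
  proof (rule ccontr)
    assume "\<not> agree i (w i) (w j)"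
    with w(1) sub have "scale i / 2 \<le> dist (point (w i)) (point (w j))"
      by (intro dist_point_disagree) auto
    also have "\<dots> \<le> dist (point (w i)) x + dist (point (w j)) x" by (rule dist_triangle2)
    also have "\<dots> < scale i / 4 + scale i / 4" using w(2)[of i] w(2)[of j] scale_antimono[OF that] by linarith
    finally show False by simp
  qed
  \<comment> \<open>The first \<open>Suc k\<close> digits of \<open>w (Suc k)\<close> are final, so
    this is the earliest approximant whose digit at \<open>k\<close> can be trusted.\<close>
  define v where "v k = w (Suc k) k" for k
  have v: "v \<in> seqs A" using w(1) by (auto simp: v_def seqs_def)
  have av: "agree j v (w j)" for j
    unfolding agree_def v_def using ag[of "Suc _" j] by (auto simp: agree_def)
  have "dist (point v) x \<le> real DIM('a) * scale j + scale j / 4" for j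
  proof -
    have "dist (point v) x \<le> dist (point v) (point (w j)) + dist (point (w j)) x" by (rule dist_triangle)
    also have "\<dots> \<le> DIM('a) * scale j + scale j / 4"
      using dist_point_agree[OF _ _ av[of j]] v w(1)[of j] w(2)[of j] sub by (intro add_mono) (auto intro: less_imp_le)
    finally show ?thesis .
  qed
  moreover have "(\<lambda>j. real DIM('a) * scale j + scale j / 4) \<longlonglongrightarrow> real DIM('a) * 0 + 0 / 4"
    by (intro tendsto_intros scale_tendsto_0) simp
  ultimately have "dist (point v) x \<le> 0"
    by (intro LIMSEQ_le_const[where X = "\<lambda>j. real DIM('a) * scale j + scale j / 4"]) auto
  then show "x \<in> point ` seqs A" using v by auto
qed

text \<open>The factor 8 makes balls of radius \<open>r\<close> around points of different cells of generation
  \<open>level r\<close> disjoint.\<close>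

definition level :: "real \<Rightarrow> nat" where
  "level r = (GREATEST j. 8 * r \<le> scale j)"

text \<open>The bound that makes \<open>GREATEST\<close> in \<open>level\<close> meaningful: scales
  tend to 0, so only finitely many of them reach \<open>8 * r\<close>.\<close>

lemma level_bounded:
  assumes "0 < r"
  obtains N where "\<And>j. 8 * r \<le> scale j \<Longrightarrow> j \<le> N"
proof -
  have "\<forall>\<^sub>F j in sequentially. scale j < 8 * r"
    using assms by (intro order_tendstoD(2)[OF scale_tendsto_0]) auto
  then obtain N where N: "\<And>j. j \<ge> N \<Longrightarrow> scale j < 8 * r" by (auto simp: eventually_sequentially)
  show ?thesis by (rule that[of N]) (metis N linorder_le_cases not_le)
qed

lemma scale_level:
  assumes "0 < r" "r \<le> 1/8"
  shows "8 * r \<le> scale (level r)" "scale (Suc (level r)) < 8 * r"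
proof -
  obtain N where N: "\<And>j. 8 * r \<le> scale j \<Longrightarrow> j \<le> N" using level_bounded[OF assms(1)] by blast
  show "8 * r \<le> scale (level r)"
    unfolding level_def by (rule GreatestI_nat[where k = 0 and b = N]) (use assms N in auto)
  show "scale (Suc (level r)) < 8 * r"
  proof (rule ccontr)
    assume "\<not> scale (Suc (level r)) < 8 * r"
    then have "Suc (level r) \<le> level r"
      by (subst (2) level_def) (rule Greatest_le_nat[where b = N], use N in auto)
    then show False by simp
  qed
qed

lemma level_ge:
  assumes "0 < r" "8 * r \<le> scale N"
  shows "N \<le> level r"
proof -
  obtain M where M: "\<And>j. 8 * r \<le> scale j \<Longrightarrow> j \<le> M" using level_bounded[OF assms(1)] by blast
  show ?thesis unfolding level_def by (rule Greatest_le_nat[where b = M]) (use M assms in auto)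
qed

lemma filterlim_level: "filterlim level at_top (at_right 0)"
  unfolding filterlim_at_top
proof
  fix N
  show "\<forall>\<^sub>F r in at_right 0. N \<le> level r"
    unfolding eventually_at_right_field using scale_pos[of N] level_ge[of _ N]
    by (intro exI[of _ "scale N / 8"]) auto
qed

lemma filterlim_level_add: "filterlim (\<lambda>r. level r + i) at_top (at_right 0)"
  by (rule filterlim_at_top_mono[OF filterlim_level]) simp

text \<open>Generation \<open>Suc (level r)\<close> is already below \<open>8 * r\<close>. Two more
  generations gain a factor 16, and \<open>DIM('a)\<close> further ones gain
  \<open>4 ^ DIM('a)\<close>, which beats the factor \<open>DIM('a)\<close> lost in
  \<open>dist_point_agree\<close>. This is the origin of the offset
  \<open>DIM('a) + 3\<close>.\<close>

lemma scale_level_add: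
  assumes "0 < r" "r \<le> 1/8"
  shows "DIM('a::euclidean_space) * scale (level r + (DIM('a) + 3)) \<le> r"
proof -
  let ?d = "DIM('a)"
  have "scale (Suc (level r) + (?d + 2)) \<le> scale (Suc (level r)) * (1/4) ^ (?d + 2)" by (rule scale_add)
  also have "\<dots> \<le> 8 * r * (1/4) ^ (?d + 2)"
    using scale_level(2)[OF assms] by (intro mult_right_mono) auto
  also have "\<dots> = r / 2 * (1/4) ^ ?d" by (simp add: power_add power2_eq_square)
  finally have "scale (level r + (?d + 3)) \<le> r / 2 * (1/4) ^ ?d" by (simp add: eval_nat_numeral)
  then have "?d * scale (level r + (?d + 3)) \<le> ?d * (r / 2 * (1/4) ^ ?d)" by (intro mult_left_mono) auto
  also have "\<dots> = (r / 2) * (?d * (1/4) ^ ?d)" by simp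
  also have "\<dots> \<le> (r / 2) * 1"
  proof (intro mult_left_mono)
    have "real ?d \<le> 4 ^ ?d"
    proof -
      have "real ?d < 2 ^ ?d" by (rule of_nat_less_two_power)
      also have "2 ^ ?d \<le> (4::real) ^ ?d" by (rule power_mono) auto
      finally show ?thesis by simp
    qed
    then show "?d * (1/4) ^ ?d \<le> (1::real)" by (simp add: power_divide field_simps)
  qed (use assms in auto)
  also have "\<dots> \<le> r" using assms by simp
  finally show ?thesis .
qed

text \<open>\<open>8 * r\<close> lies between two consecutive scales, so \<open>- ln r\<close> is
  squeezed between two consecutive depths up to the constant \<open>ln 8\<close>;
  \<open>depth_ratio\<close> then handles the shift by \<open>i\<close>.\<close>

lemma depth_level_ratio: "((\<lambda>r. depth (level r + i) / - ln r) \<longlongrightarrow> 1) (at_right 0)"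
proof -
  have small: "\<forall>\<^sub>F r in at_right (0::real). 0 < r \<and> r \<le> 1/8"
    unfolding eventually_at_right_field by (intro exI[of _ "1/8"]) auto
  have lev: "\<forall>\<^sub>F r in at_right 0. 1 \<le> level r"
    using filterlim_level unfolding filterlim_at_top by blast
  have up: "((\<lambda>r. depth (level r + 1) / depth (level r) + ln 8 / depth (level r)) \<longlongrightarrow> 1 + 0) (at_right 0)"
  proof (intro tendsto_add)
    show "((\<lambda>r. depth (level r + 1) / depth (level r)) \<longlongrightarrow> 1) (at_right 0)"
      by (rule filterlim_compose[OF depth_ratio filterlim_level])
    show "((\<lambda>r. ln 8 / depth (level r)) \<longlongrightarrow> 0) (at_right 0)"
      by (intro real_tendsto_divide_at_top[OF tendsto_const] filterlim_compose[OF depth_at_top filterlim_level])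
  qed
  have lim: "((\<lambda>r. - ln r / depth (level r)) \<longlongrightarrow> 1) (at_right 0)"
  proof (rule tendsto_sandwich[OF _ _ tendsto_const[of 1]])
    show "((\<lambda>r. depth (level r + 1) / depth (level r) + ln 8 / depth (level r)) \<longlongrightarrow> 1) (at_right 0)"
      using up by simp
    show "\<forall>\<^sub>F r in at_right 0. 1 \<le> - ln r / depth (level r)"
      using small lev
    proof eventually_elim
      case (elim r)
      have "8 * r \<le> scale (level r)" using elim scale_level by blast
      then have "ln (8 * r) \<le> - depth (level r)"
        using elim ln_le_cancel_iff[of "8 * r" "exp (- depth (level r))"] by (simp add: scale_def)
      moreover have "ln (8 * r) = ln 8 + ln r" "0 \<le> ln (8::real)" using elim by (simp_all add: ln_mult)
      ultimately have "depth (level r) \<le> - ln r" by linarith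
      then show ?case using elim depth_pos[of "level r"] by (simp add: field_simps)
    qed
    show "\<forall>\<^sub>F r in at_right 0. - ln r / depth (level r) \<le> depth (level r + 1) / depth (level r) + ln 8 / depth (level r)"
      using small lev
    proof eventually_elim
      case (elim r)
      have "scale (Suc (level r)) < 8 * r" using elim scale_level by blast
      then have "- depth (Suc (level r)) < ln (8 * r)"
        using elim ln_less_cancel_iff[of "exp (- depth (Suc (level r)))" "8 * r"] by (simp add: scale_def)
      then have "- ln r \<le> depth (level r + 1) + ln 8" using elim by (simp add: ln_mult)
      then show ?case using elim depth_pos[of "level r"] by (simp add: field_simps)
    qed
  qed
  have "((\<lambda>r. (depth (level r + i) / depth (level r)) / (- ln r / depth (level r))) \<longlongrightarrow> 1 / 1) (at_right 0)"
    by (intro tendsto_divide lim filterlim_compose[OF depth_ratio filterlim_level]) simp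
  moreover have "\<forall>\<^sub>F r in at_right 0. (depth (level r + i) / depth (level r)) / (- ln r / depth (level r))
      = depth (level r + i) / - ln r"
    using small lev
  proof eventually_elim
    case (elim r)
    then show ?case using depth_pos[of "level r"] by (simp add: field_simps)
  qed
  ultimately show ?thesis by (simp add: Lim_transform_eventually)
qed

subsection \<open>Product measures\<close>

text \<open>The finitely many exceptional generations go into the constant \<open>B\<close>, which
  does not depend on \<open>j\<close> and is therefore negligible against
  \<open>depth j\<close>.\<close>

lemma sum_ge_depth:
  assumes "\<forall>\<^sub>F k in sequentially. t * len k \<le> a k"
  obtains B where "\<And>j. t * depth j - B \<le> (\<Sum>k<j. a k)"
proof -
  obtain K where K: "\<And>k. k \<ge> K \<Longrightarrow> t * len k \<le> a k" using assms by (auto simp: eventually_sequentially)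
  define B where "B = (\<Sum>k<K. \<bar>a k - t * len k\<bar>)"
  have "- B \<le> (\<Sum>k<j. a k - t * len k)" for j
  proof -
    have "(\<Sum>k<j. a k - t * len k) \<ge> (\<Sum>k<j. if k < K then - \<bar>a k - t * len k\<bar> else 0)"
      using K by (intro sum_mono) (auto simp: not_less)
    also have "(\<Sum>k<j. if k < K then - \<bar>a k - t * len k\<bar> else 0) = (\<Sum>k\<in>{..<j} \<inter> {..<K}. - \<bar>a k - t * len k\<bar>)"
      by (subst sum.inter_restrict) auto
    also have "\<dots> \<ge> (\<Sum>k<K. - \<bar>a k - t * len k\<bar>)"
      by (subst sum_negf, subst sum_negf) (auto intro!: sum_mono2)
    finally show ?thesis by (simp add: B_def sum_negf)
  qed
  then show ?thesis
    by (intro that[of B]) (simp add: sum_subtractf sum_distrib_left[symmetric] depth_def algebra_simps)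
qed

lemma sum_le_depth:
  assumes "\<forall>\<^sub>F k in sequentially. a k \<le> t * len k"
  obtains B where "\<And>j. (\<Sum>k<j. a k) \<le> t * depth j + B"
proof -
  have "\<forall>\<^sub>F k in sequentially. (- t) * len k \<le> - a k"
    using assms by eventually_elim simp
  from sum_ge_depth[OF this] obtain B where "\<And>j. (- t) * depth j - B \<le> (\<Sum>k<j. - a k)" by blast
  then have "(\<Sum>k<j. a k) \<le> t * depth j + B" for j by (simp add: sum_negf algebra_simps)
  then show ?thesis by (rule that)
qed

definition seq_measure :: "(nat \<Rightarrow> 'b pmf) \<Rightarrow> (nat \<Rightarrow> 'b) measure" where
  "seq_measure p = PiM UNIV (\<lambda>k. measure_pmf (p k))"

definition code_measure :: "(nat \<Rightarrow> ('a::euclidean_space \<Rightarrow> nat) pmf) \<Rightarrow> 'a measure" where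
  "code_measure p = distr (seq_measure p) borel point"

definition weight :: "(nat \<Rightarrow> 'b pmf) \<Rightarrow> nat \<Rightarrow> (nat \<Rightarrow> 'b) \<Rightarrow> real" where
  "weight p j w = (\<Prod>k<j. pmf (p k) (w k))"

lemma space_seq_measure [simp]: "space (seq_measure p) = UNIV"
  by (simp add: seq_measure_def space_PiM)

lemma product_prob_space_pmf: "product_prob_space (\<lambda>k::nat. measure_pmf (p k))"
  by unfold_locales

lemma prob_space_seq_measure: "prob_space (seq_measure p)"
  unfolding seq_measure_def by (intro prob_space_PiM) (rule prob_space_measure_pmf)

lemma sets_coordinate [measurable]: "{w. w k \<in> A} \<in> sets (seq_measure p)"
  using sets_Collect_single'[of k UNIV "\<lambda>k. measure_pmf (p k)" "\<lambda>x. x \<in> A"]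
  by (simp add: seq_measure_def space_PiM)

lemma sets_seqs [measurable]: "seqs A \<in> sets (seq_measure p)"
proof -
  have "seqs A = (\<Inter>k. {w. w k \<in> A k})" by (auto simp: seqs_def)
  then show ?thesis by (auto intro!: sets.countable_INT)
qed

lemma agree_eq: "{w'. agree j w w'} = seqs (\<lambda>k. if k < j then {w k} else UNIV)"
  by (auto simp: agree_def seqs_def)

lemma sets_agree [measurable]: "{w'. agree j w w'} \<in> sets (seq_measure p)"
  unfolding agree_eq by (rule sets_seqs)

lemma measure_coordinate: "measure (seq_measure p) {w. w k \<in> A} = measure (measure_pmf (p k)) A"
proof -
  interpret P: product_prob_space "\<lambda>k. measure_pmf (p k)" UNIV by (rule product_prob_space_pmf)
  have "emeasure (seq_measure p) {w. w k \<in> A} = emeasure (measure_pmf (p k)) A"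
    using P.emeasure_PiM_Collect_single[of k A] by (simp add: seq_measure_def space_PiM)
  then show ?thesis by (simp add: measure_def)
qed

lemma measure_agree: "measure (seq_measure p) {w'. agree j w w'} = weight p j w"
proof -
  interpret P: product_prob_space "\<lambda>k. measure_pmf (p k)" UNIV by (rule product_prob_space_pmf)
  have "{w'. agree j w w'} = {x \<in> space (PiM UNIV (\<lambda>k. measure_pmf (p k))). \<forall>i\<in>{..<j}. x i \<in> {w i}}"
    by (auto simp: agree_def space_PiM)
  then have "emeasure (seq_measure p) {w'. agree j w w'} = (\<Prod>k<j. emeasure (measure_pmf (p k)) {w k})"
    unfolding seq_measure_def using P.emeasure_PiM_Collect[of "{..<j}" "\<lambda>i. {w i}"] by simp
  also have "\<dots> = ennreal (weight p j w)"
    by (simp add: weight_def emeasure_pmf_single prod_ennreal)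
  finally show ?thesis by (simp add: measure_def weight_def prod_nonneg)
qed

lemma AE_seqs: "AE w in seq_measure p. w \<in> seqs (\<lambda>k. set_pmf (p k))"
proof -
  interpret P: product_prob_space "\<lambda>k. measure_pmf (p k)" UNIV by (rule product_prob_space_pmf)
  have "AE w in seq_measure p. w k \<in> set_pmf (p k)" for k
    unfolding seq_measure_def by (rule P.AE_component) (auto intro: AE_measure_pmf)
  then have "AE w in seq_measure p. \<forall>k. w k \<in> set_pmf (p k)" by (simp add: AE_all_countable)
  then show ?thesis by (simp add: seqs_def)
qed

lemma measurable_point [measurable]:
  "(point :: _ \<Rightarrow> 'a::euclidean_space) \<in> borel_measurable (seq_measure p)"
proof -
  have "(\<lambda>w. real (w k b)) \<in> borel_measurable (seq_measure p)" for k and b :: 'a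
    unfolding seq_measure_def
    by (rule measurable_compose[OF measurable_component_singleton[of k], where g = "\<lambda>x. real (x b)"]) auto
  then show ?thesis unfolding point_def[abs_def] coord_def[abs_def]
    by (intro borel_measurable_sum borel_measurable_scaleR borel_measurable_suminf borel_measurable_times) auto
qed

lemma prob_space_code_measure: "prob_space (code_measure p)"
  unfolding code_measure_def
  by (rule prob_space.prob_space_distr[OF prob_space_seq_measure measurable_point])

lemma sets_code_measure [simp, measurable_cong]: "sets (code_measure p) = sets borel"
  by (simp add: code_measure_def)

lemma space_code_measure [simp]: "space (code_measure p) = UNIV"
  by (simp add: code_measure_def)

lemma measure_code:
  "V \<in> sets borel \<Longrightarrow> measure (code_measure p) V = measure (seq_measure p) (point -` V)"
  unfolding code_measure_def by (subst measure_distr) auto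

lemma weight_nonneg: "0 \<le> weight p j w" by (simp add: weight_def prod_nonneg)

lemma weight_pos: "(\<And>k. w k \<in> set_pmf (p k)) \<Longrightarrow> 0 < weight p j w"
  by (auto simp: weight_def pmf_positive intro!: prod_pos)

lemma weight_le_1: "weight p j w \<le> 1"
  unfolding weight_def by (rule prod_le_1) (auto simp: pmf_le_1)

lemma weight_agree: "agree j w w' \<Longrightarrow> weight p j w = weight p j w'"
  unfolding weight_def agree_def by (intro prod.cong) auto

text \<open>Almost every sequence has all its digits in the supports of the \<open>p k\<close>, so
  membership in the cylinder of \<open>w\<close> is checked for such sequences only.\<close>

lemma measure_code_le_weight:
  fixes p :: "nat \<Rightarrow> ('a::euclidean_space \<Rightarrow> nat) pmf"
  assumes V: "V \<in> sets borel"
    and ag: "\<And>w'. (\<And>k. w' k \<in> set_pmf (p k)) \<Longrightarrow> point w' \<in> V \<Longrightarrow> agree j w w'"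
  shows "measure (code_measure p) V \<le> weight p j w"
proof -
  interpret prob_space "seq_measure p" by (rule prob_space_seq_measure)
  have V': "point -` V \<in> sets (seq_measure p)"
    using measurable_sets[OF measurable_point V, of p] by simp
  have "measure (seq_measure p) (point -` V) \<le> measure (seq_measure p) {w'. agree j w w'}"
  proof (rule finite_measure_mono_AE)
    show "AE w' in seq_measure p. w' \<in> point -` V \<longrightarrow> w' \<in> {w'. agree j w w'}"
      using AE_seqs[of p] by eventually_elim (use ag in \<open>auto simp: seqs_def\<close>)
  qed (rule sets_agree)
  then show ?thesis by (simp add: measure_code[OF V] measure_agree)
qed

lemma weight_le_measure_code:
  fixes p :: "nat \<Rightarrow> ('a::euclidean_space \<Rightarrow> nat) pmf"
  assumes V: "V \<in> sets borel"
    and ag: "\<And>w'. (\<And>k. w' k \<in> set_pmf (p k)) \<Longrightarrow> agree j w w' \<Longrightarrow> point w' \<in> V"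
  shows "weight p j w \<le> measure (code_measure p) V"
proof -
  interpret prob_space "seq_measure p" by (rule prob_space_seq_measure)
  have V': "point -` V \<in> sets (seq_measure p)"
    using measurable_sets[OF measurable_point V, of p] by simp
  have "measure (seq_measure p) {w'. agree j w w'} \<le> measure (seq_measure p) (point -` V)"
  proof (rule finite_measure_mono_AE[OF _ V'])
    show "AE w' in seq_measure p. w' \<in> {w'. agree j w w'} \<longrightarrow> w' \<in> point -` V"
      using AE_seqs[of p] by eventually_elim (use ag in \<open>auto simp: seqs_def\<close>)
  qed
  then show ?thesis by (simp add: measure_code[OF V] measure_agree)
qed

lemma measure_point_seqs:
  fixes p :: "nat \<Rightarrow> ('a::euclidean_space \<Rightarrow> nat) pmf"
  assumes "\<And>k. set_pmf (p k) \<subseteq> digits k"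
  shows "measure (code_measure p) (point ` seqs (\<lambda>k. set_pmf (p k))) = 1"
proof -
  interpret prob_space "seq_measure p" by (rule prob_space_seq_measure)
  have V: "point ` seqs (\<lambda>k. set_pmf (p k)) \<in> sets borel"
    using closed_point_seqs[OF assms] by (rule borel_closed)
  have "prob (point -` (point ` seqs (\<lambda>k. set_pmf (p k)))) = 1"
  proof (rule prob_eq_1[THEN iffD2])
    show "point -` (point ` seqs (\<lambda>k. set_pmf (p k))) \<in> sets (seq_measure p)"
      using measurable_sets[OF measurable_point V, of p] by simp
    show "AE w in seq_measure p. w \<in> point -` (point ` seqs (\<lambda>k. set_pmf (p k)))"
      using AE_seqs[of p] by eventually_elim auto
  qed
  then show ?thesis by (simp add: measure_code[OF V])
qed

lemma agree_level:
  assumes "w \<in> seqs digits" "w' \<in> seqs digits" "0 < r" "r \<le> 1/8" "dist (point w) (point w') \<le> r"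
  shows "agree (level r) w w'"
proof (rule ccontr)
  assume "\<not> ?thesis"
  from dist_point_disagree[OF assms(1,2) this] scale_level(1)[OF assms(3,4)] assms show False by linarith
qed

lemma dist_level:
  fixes w w' :: "nat \<Rightarrow> 'a::euclidean_space \<Rightarrow> nat"
  assumes "w \<in> seqs digits" "w' \<in> seqs digits" "0 < r" "r \<le> 1/8" "agree (level r + (DIM('a) + 3)) w w'"
  shows "dist (point w) (point w') \<le> r"
  using dist_point_agree[OF assms(1,2,5)] scale_level_add[OF assms(3,4), where 'a = 'a] by linarith

text \<open>Under the uniform choice of a digit in each \<open>A k\<close>, a cell of generation
  \<open>j\<close> has as mass the inverse of the product of the cardinalities, and the mass
  distribution principle applies to this auxiliary measure.\<close>

lemma hdim_point_seqs_ge: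
  fixes A :: "nat \<Rightarrow> ('a::euclidean_space \<Rightarrow> nat) set"
  assumes A: "\<And>k. A k \<subseteq> digits k" and ne: "\<And>k. A k \<noteq> {}"
    and c: "\<And>t. 0 < t \<Longrightarrow> ereal t < c \<Longrightarrow> \<forall>\<^sub>F k in sequentially. t * len k \<le> ln (card (A k))"
  shows "c \<le> hdim (point ` seqs A)"
proof (rule le_hdim)
  have "(\<lambda>k. SOME x. x \<in> A k) \<in> seqs A" using ne by (auto simp: seqs_def some_in_eq)
  then show "point ` seqs A \<noteq> {}" by blast
next
  have fin: "finite (A k)" for k using A[of k] finite_subset digits_finite by blast
  have sub: "seqs A \<subseteq> seqs digits" using A by (rule seqs_mono)
  fix s :: real assume s: "0 < s" "ereal s < c"
  \<comment> \<open>The gap between \<open>s\<close> and \<open>t\<close> absorbs the ratio of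
    \<open>depth (level r)\<close> to \<open>- ln r\<close>, which is 1 only in the limit.\<close>
  obtain t' where "ereal s < t'" "t' < c" using dense[OF s(2)] by blast
  then obtain t where t: "s < t" "ereal t < c" by (cases t') auto
  have "0 < t" using s t by simp
  define p where "p k = pmf_of_set (A k)" for k
  have set_p: "set_pmf (p k) = A k" for k using fin ne by (simp add: p_def)
  obtain B where B: "\<And>j. t * depth j - B \<le> (\<Sum>k<j. ln (card (A k)))"
    using sum_ge_depth[OF c[OF \<open>0 < t\<close> t(2)]] by blast
  have card_pos: "0 < card (A k)" for k using fin ne by (simp add: card_gt_0_iff)
  have weight: "weight p j w \<le> exp B * exp (- t * depth j)" if "w \<in> seqs A" for j w
  proof -
    have "weight p j w = (\<Prod>k<j. exp (- ln (card (A k))))"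
      unfolding weight_def using that fin ne card_pos
      by (intro prod.cong refl) (auto simp: p_def seqs_def exp_minus inverse_eq_divide)
    also have "\<dots> = exp (- (\<Sum>k<j. ln (card (A k))))" by (simp add: exp_sum[symmetric] sum_negf)
    also have "\<dots> \<le> exp (B - t * depth j)" using B[of j] by simp
    also have "\<dots> = exp B * exp (- t * depth j)" by (simp add: exp_add[symmetric])
    finally show ?thesis .
  qed
  let ?M = "code_measure p"
  interpret M: prob_space ?M by (rule prob_space_code_measure)
  have cell: "emeasure ?M V \<le> ennreal (exp B * exp (- t * depth j))"
    if "V \<in> sets borel" "w \<in> seqs A" "\<And>w'. w' \<in> seqs A \<Longrightarrow> point w' \<in> V \<Longrightarrow> agree j w w'" for V j w
  proof -
    have "measure ?M V \<le> weight p j w"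
      by (rule measure_code_le_weight[OF that(1)]) (use that(3) in \<open>auto simp: set_p seqs_def\<close>)
    then show ?thesis using weight[OF that(2), of j] by (simp add: M.emeasure_eq_measure)
  qed
  have "\<forall>\<^sub>F r in at_right 0. s / t < depth (level r + 0) / - ln r"
    by (rule order_tendstoD(1)[OF depth_level_ratio]) (use s t in auto)
  then obtain \<delta>0 where \<delta>0: "\<delta>0 > 0" "\<And>r. 0 < r \<Longrightarrow> r < \<delta>0 \<Longrightarrow> s / t < depth (level r) / - ln r"
    unfolding eventually_at_right_field by auto
  define \<delta> where "\<delta> = min (\<delta>0 / 2) (1/8)"
  show "hmeasure s (point ` seqs A) \<noteq> 0"
  proof (rule hmeasure_mass_distribution[where M = ?M and C = "exp B" and \<delta> = \<delta>])
    show "point ` seqs A \<in> sets ?M" using closed_point_seqs[OF A] by simp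
    show "0 < emeasure ?M (point ` seqs A)"
      using measure_point_seqs[of p] A by (simp add: set_p M.emeasure_eq_measure)
    show "0 < \<delta>" using \<delta>0 by (simp add: \<delta>_def)
    fix U :: "'a set" assume U: "bounded U" "diameter U \<le> \<delta>"
    show "\<exists>V\<in>sets ?M. U \<inter> point ` seqs A \<subseteq> V \<and> emeasure ?M V \<le> ennreal (exp B * diameter U powr s)"
    proof (cases "U \<inter> point ` seqs A = {}")
      case True
      then show ?thesis by (intro bexI[of _ "{}"]) auto
    next
      case False
      then obtain w where w: "w \<in> seqs A" "point w \<in> U" by blast
      have diam: "dist (point w) y \<le> diameter U" if "y \<in> U" for y
        using diameter_bounded_bound[OF U(1) w(2) that] .
      let ?V = "cball (point w) (diameter U)"
      have V: "?V \<in> sets borel" by simp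
      have UV: "U \<inter> point ` seqs A \<subseteq> ?V" using diam by auto
      show ?thesis
      proof (cases "diameter U = 0")
        \<comment> \<open>Here \<open>diameter U powr s\<close> is 0, so no mass at all is
          tolerated: the auxiliary measure must have no atoms, which holds because its cell masses
          tend to 0.\<close>
        case True
        have "emeasure ?M ?V \<le> ennreal (exp B * exp (- t * depth j))" for j
        proof (rule cell[OF V w(1)])
          fix w' assume "w' \<in> seqs A" "point w' \<in> ?V"
          then have "w = w'" using point_inj[of w w'] w sub True by auto
          then show "agree j w w'" by simp
        qed
        then have "measure ?M ?V \<le> exp B * exp (- t * depth j)" for j
          by (simp add: M.emeasure_eq_measure)
        moreover have "(\<lambda>j. exp B * exp (- t * depth j)) \<longlonglongrightarrow> exp B * 0"
        proof (intro tendsto_mult tendsto_const filterlim_compose[OF exp_at_bot])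
          show "filterlim (\<lambda>j. - t * depth j) at_bot sequentially"
            by (rule filterlim_tendsto_neg_mult_at_bot[OF tendsto_const _ depth_at_top]) (use \<open>0 < t\<close> in simp)
        qed
        ultimately have "measure ?M ?V \<le> exp B * 0"
          by (intro LIMSEQ_le_const[where X = "\<lambda>j. exp B * exp (- t * depth j)"]) auto
        then have "emeasure ?M ?V \<le> 0" by (simp add: M.emeasure_eq_measure measure_le_0_iff)
        then show ?thesis using UV V by (intro bexI[of _ ?V]) auto
      next
        case False
        then have d: "0 < diameter U" using diameter_ge_0[OF U(1)] by simp
        have d8: "diameter U \<le> 1/8" "diameter U < \<delta>0" using U(2) \<delta>0(1) by (auto simp: \<delta>_def)
        have "emeasure ?M ?V \<le> ennreal (exp B * exp (- t * depth (level (diameter U))))"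
        proof (rule cell[OF V w(1)])
          fix w' assume "w' \<in> seqs A" "point w' \<in> ?V"
          then show "agree (level (diameter U)) w w'"
            using agree_level[of w w'] w sub d d8 by auto
        qed
        also have "exp (- t * depth (level (diameter U))) \<le> diameter U powr s"
        proof -
          have l: "0 < - ln (diameter U)" using d d8 by simp
          have "s * - ln (diameter U) \<le> t * depth (level (diameter U))"
            using \<delta>0(2)[OF d d8(2)] l \<open>0 < t\<close> by (simp add: pos_less_divide_eq pos_divide_less_eq field_simps)
          then show ?thesis using d by (simp add: powr_def)
        qed
        finally show ?thesis using UV V by (intro bexI[of _ ?V]) (auto simp: mult_left_mono ennreal_leI)
      qed
    qed
  qed simp
qed

end

section \<open>Measures charging all digits: moment sums and covering estimates\<close>

locale grid_measure = grid_code n len for n :: "nat \<Rightarrow> nat" and len :: "nat \<Rightarrow> real" +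
  fixes p :: "nat \<Rightarrow> ('a::euclidean_space \<Rightarrow> nat) pmf"
  assumes set_p: "set_pmf (p k) = digits k"
begin

abbreviation mu :: "'a measure" where "mu \<equiv> code_measure p"

abbreviation words :: "nat \<Rightarrow> (nat \<Rightarrow> 'a \<Rightarrow> nat) set" where
  "words j \<equiv> PiE {..<j} digits"

definition info :: "nat \<Rightarrow> (nat \<Rightarrow> 'a \<Rightarrow> nat) \<Rightarrow> real" where
  "info j w = - ln (weight p j w)"

definition psum :: "real \<Rightarrow> nat \<Rightarrow> real" where
  "psum q k = (\<Sum>a\<in>digits k. pmf (p k) a powr q)"

definition extend :: "nat \<Rightarrow> (nat \<Rightarrow> 'a \<Rightarrow> nat) \<Rightarrow> nat \<Rightarrow> 'a \<Rightarrow> nat" where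
  "extend j v k = (if k < j then v k else (SOME a. a \<in> digits k))"

sublocale M: prob_space mu by (rule prob_space_code_measure)

lemma finite_words [simp]: "finite (words j)" by (intro finite_PiE) auto

lemma some_digit: "(SOME a. a \<in> digits k) \<in> digits k"
  using digits_nonempty by (auto simp: some_in_eq)

lemma extend_seqs: "v \<in> words j \<Longrightarrow> extend j v \<in> seqs digits"
  by (auto simp: seqs_def extend_def some_digit)

lemma agree_extend: "agree j v (extend j v)"
  by (auto simp: agree_def extend_def)

lemma restrict_words: "w \<in> seqs digits \<Longrightarrow> restrict w {..<j} \<in> words j"
  by (auto simp: seqs_def)

lemma agree_restrict: "agree j (restrict w {..<j}) w"
  by (auto simp: agree_def)

lemma words_agree_eq: "v \<in> words j \<Longrightarrow> v' \<in> words j \<Longrightarrow> agree j v v' \<Longrightarrow> v = v'"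
  by (rule PiE_ext) (auto simp: agree_def)

lemma weight_pos_words: "v \<in> words j \<Longrightarrow> 0 < weight p j v"
  unfolding weight_def by (rule prod_pos, rule pmf_positive) (auto simp: set_p dest: PiE_mem)

lemma weight_pos_seqs: "w \<in> seqs digits \<Longrightarrow> 0 < weight p j w"
  by (rule weight_pos) (auto simp: seqs_def set_p)

lemma info_nonneg: "0 \<le> info j w"
proof (cases "weight p j w = 0")
  case False
  then have "0 < weight p j w" using weight_nonneg[of p j w] by linarith
  then show ?thesis using weight_le_1[of p j w] by (simp add: info_def)
qed (simp add: info_def)

lemma info_agree: "agree j w w' \<Longrightarrow> info j w = info j w'"
  unfolding info_def using weight_agree by metis

lemma pmf_digit_pos: "a \<in> digits k \<Longrightarrow> 0 < pmf (p k) a"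
  by (rule pmf_positive) (simp add: set_p)

lemma psum_pos: "0 < psum q k"
  unfolding psum_def
proof (rule sum_pos)
  show "0 < pmf (p k) a powr q" if "a \<in> digits k" for a using pmf_digit_pos[OF that] by simp
qed (simp_all add: digits_nonempty)

lemma sum_words: "(\<Sum>v\<in>words j. weight p j v powr q) = (\<Prod>k<j. psum q k)"
proof -
  have "(\<Prod>k<j. psum q k) = (\<Sum>v\<in>words j. \<Prod>k<j. pmf (p k) (v k) powr q)"
    unfolding psum_def by (rule prod_sum_PiE) auto
  also have "\<dots> = (\<Sum>v\<in>words j. weight p j v powr q)"
    unfolding weight_def by (intro sum.cong refl prod_powr_distrib[symmetric])
  finally show ?thesis by simp
qed

lemma prod_psum_le:
  assumes "\<forall>\<^sub>F k in sequentially. ln (psum q k) \<le> c * len k"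
  obtains B where "\<And>j. (\<Prod>k<j. psum q k) \<le> exp (c * depth j + B)"
proof -
  obtain B where B: "\<And>j. (\<Sum>k<j. ln (psum q k)) \<le> c * depth j + B"
    using sum_le_depth[OF assms] by blast
  have "(\<Prod>k<j. psum q k) = exp (\<Sum>k<j. ln (psum q k))" for j
    by (simp add: exp_sum psum_pos)
  then show ?thesis using B by (intro that[of B]) simp
qed

lemma prod_psum_ge:
  assumes "\<forall>\<^sub>F k in sequentially. c * len k \<le> ln (psum q k)"
  obtains B where "\<And>j. exp (c * depth j - B) \<le> (\<Prod>k<j. psum q k)"
proof -
  obtain B where B: "\<And>j. c * depth j - B \<le> (\<Sum>k<j. ln (psum q k))"
    using sum_ge_depth[OF assms] by blast
  have "(\<Prod>k<j. psum q k) = exp (\<Sum>k<j. ln (psum q k))" for j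
    by (simp add: exp_sum psum_pos)
  then show ?thesis using B by (intro that[of B]) simp
qed

text \<open>Markov's inequality for the moment sum: each counted word satisfies
  \<open>weight p j v powr q\<close> \<ge> \<open>exp (- g)\<close>, whatever the sign of
  \<open>q\<close>.\<close>

lemma card_words_le:
  "real (card {v \<in> words j. q * info j v \<le> g}) \<le> exp g * (\<Prod>k<j. psum q k)"
proof -
  let ?V = "{v \<in> words j. q * info j v \<le> g}"
  have "real (card ?V) = (\<Sum>v\<in>?V. 1)" by simp
  also have "\<dots> \<le> (\<Sum>v\<in>?V. exp g * weight p j v powr q)"
  proof (rule sum_mono)
    fix v assume v: "v \<in> ?V"
    then have pos: "0 < weight p j v" using weight_pos_words by blast
    have "1 \<le> exp (g - q * info j v)" using v by simp
    also have "\<dots> = exp g * weight p j v powr q"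
      using pos by (simp add: powr_def info_def exp_add[symmetric])
    finally show "1 \<le> exp g * weight p j v powr q" .
  qed
  also have "\<dots> \<le> (\<Sum>v\<in>words j. exp g * weight p j v powr q)"
    by (intro sum_mono2) auto
  also have "\<dots> = exp g * (\<Prod>k<j. psum q k)" by (simp add: sum_distrib_left[symmetric] sum_words)
  finally show ?thesis .
qed

text \<open>For \<open>\<theta>\<close> close to 1, \<open>x\<close> is almost covered by a cell of generation \<open>j\<close> whose weight \<open>v\<close> satisfies
  \<open>v powr q \<ge> exp (- \<gamma> * depth j)\<close>; these cells are counted by the moment sums.\<close>

definition near_cell :: "real \<Rightarrow> real \<Rightarrow> real \<Rightarrow> 'a \<Rightarrow> nat \<Rightarrow> bool" where
  "near_cell q \<gamma> \<theta> x j \<longleftrightarrow> (\<exists>w\<in>seqs digits. q * info j w \<le> \<gamma> * depth j \<and> dist x (point w) \<le> exp (- \<theta> * depth j))"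

lemma exp_neg_depth_tendsto:
  assumes "0 < c"
  shows "(\<lambda>j. exp (- c * depth j)) \<longlonglongrightarrow> 0"
  by (rule filterlim_compose[OF exp_at_bot], rule filterlim_tendsto_neg_mult_at_bot[OF tendsto_const _ depth_at_top])
    (use assms in simp)

text \<open>By \<open>card_words_le\<close> at most about
  \<open>exp ((\<gamma>0 + \<sigma>) * depth j)\<close> words pass the test in
  \<open>near_cell\<close>, and balls of radius close to \<open>scale j\<close> around points coded
  by them cover each point of \<open>Y\<close> for infinitely many \<open>j\<close>. This is the
  upper bound of the formalism for a single \<open>q\<close>.\<close>

lemma hdim_le_spectrum:
  assumes psum: "\<And>c. \<sigma> < c \<Longrightarrow> \<forall>\<^sub>F k in sequentially. ln (psum q k) \<le> c * len k"
    and Y: "\<And>x \<gamma> \<theta>. x \<in> Y \<Longrightarrow> \<gamma>0 < \<gamma> \<Longrightarrow> \<theta> < 1 \<Longrightarrow> \<exists>\<^sub>F j in sequentially. near_cell q \<gamma> \<theta> x j"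
    and ne: "Y \<noteq> {}"
  shows "hdim Y \<le> ereal (\<gamma>0 + \<sigma>)"
proof -
  \<comment> \<open>Exponents in \<open>hdim\<close> are positive, so a negative bound is excluded
    separately: for large \<open>j\<close> fewer than one word would pass the test, although a point
    of \<open>Y\<close> supplies one.\<close>
  have nonneg: "0 \<le> \<gamma>0 + \<sigma>"
  proof (rule ccontr)
    assume neg: "\<not> 0 \<le> \<gamma>0 + \<sigma>"
    \<comment> \<open>As \<open>\<gamma>0 + \<sigma> = - 4 * \<kappa>\<close>, a loss of \<kappa> in
      the threshold and another one in the moment bound still leave decay at rate
      \<open>2 * \<kappa>\<close>.\<close>
    define \<kappa> where "\<kappa> = - (\<gamma>0 + \<sigma>) / 4"
    have \<kappa>: "0 < \<kappa>" using neg by (simp add: \<kappa>_def)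
    obtain B where B: "\<And>j. (\<Prod>k<j. psum q k) \<le> exp ((\<sigma> + \<kappa>) * depth j + B)"
      using prod_psum_le[OF psum[of "\<sigma> + \<kappa>"]] \<kappa> by auto
    have "\<forall>\<^sub>F j in sequentially. exp (- (2 * \<kappa>) * depth j) < exp (- B)"
      by (rule order_tendstoD(2)[OF exp_neg_depth_tendsto]) (use \<kappa> in auto)
    moreover obtain x where "x \<in> Y" using ne by blast
    then have "\<exists>\<^sub>F j in sequentially. near_cell q (\<gamma>0 + \<kappa>) 0 x j" using Y \<kappa> by simp
    ultimately have "\<exists>\<^sub>F j in sequentially. exp (- (2 * \<kappa>) * depth j) < exp (- B) \<and> near_cell q (\<gamma>0 + \<kappa>) 0 x j"
      by (simp add: eventually_frequently_const_simps frequently_eventually_conj conj_commute)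
    then obtain j where j: "exp (- (2 * \<kappa>) * depth j) < exp (- B)" "near_cell q (\<gamma>0 + \<kappa>) 0 x j"
      by (auto dest: frequently_ex)
    then obtain w where w: "w \<in> seqs digits" "q * info j w \<le> (\<gamma>0 + \<kappa>) * depth j" by (auto simp: near_cell_def)
    let ?V = "{v \<in> words j. q * info j v \<le> (\<gamma>0 + \<kappa>) * depth j}"
    have "restrict w {..<j} \<in> words j" by (rule restrict_words[OF w(1)])
    moreover have "q * info j (restrict w {..<j}) \<le> (\<gamma>0 + \<kappa>) * depth j"
      using w(2) info_agree[OF agree_restrict[of j w]] by simp
    ultimately have "restrict w {..<j} \<in> ?V" by (intro CollectI conjI)
    then have "?V \<noteq> {}" by (metis empty_iff)
    then have "0 < card ?V" by (subst card_gt_0_iff) simp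
    then have "1 \<le> card ?V" by linarith
    then have "1 \<le> real (card ?V)" by simp
    also have "\<dots> \<le> exp ((\<gamma>0 + \<kappa>) * depth j) * exp ((\<sigma> + \<kappa>) * depth j + B)"
      using card_words_le[of j q "(\<gamma>0 + \<kappa>) * depth j"] B[of j] by (smt (verit) exp_gt_zero mult_left_mono)
    also have "\<dots> = exp (- (2 * \<kappa>) * depth j + B)"
    proof -
      have g0: "\<gamma>0 = - \<sigma> - 4 * \<kappa>" by (simp add: \<kappa>_def field_simps)
      show ?thesis unfolding exp_add[symmetric] g0 by (simp add: algebra_simps)
    qed
    also have "\<dots> < 1" using j(1) by simp
    finally show False by simp
  qed
  have "hdim Y \<le> ereal s" if s: "\<gamma>0 + \<sigma> < s" for s
  proof -
    define \<eta> where "\<eta> = s - (\<gamma>0 + \<sigma>)"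
    have \<eta>: "0 < \<eta>" using s by (simp add: \<eta>_def)
    have s0: "0 < s" using s nonneg by simp
    \<comment> \<open>The excess \<eta> is spent in quarters: one in \<gamma>, one in the moment
      bound, one in the exponent of the radius (after multiplication by \<open>s\<close>), and the
      last one makes the series geometric. The radius uses the midpoint of \<theta> and 1, which is
      positive even for \<theta> = 0 and still below 1.\<close>
    define \<theta> where "\<theta> = max 0 (1 - \<eta> / (4 * s))"
    have \<theta>: "0 \<le> \<theta>" "\<theta> < 1" "s - \<eta> / 4 \<le> s * \<theta>"
      using \<eta> s0 by (auto simp: \<theta>_def max_def field_simps)
    define \<gamma> where "\<gamma> = \<gamma>0 + \<eta> / 4"
    define W where "W j = (point \<circ> extend j) ` {v \<in> words j. q * info j v \<le> \<gamma> * depth j}" for j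
    \<comment> \<open>One unit for the distance from \<open>x\<close> to the coded point,
      \<open>DIM('a)\<close> for moving inside the cell to the point selected by
      \<open>extend\<close>.\<close>
    define D where "D = 1 + real DIM('a)"
    have D: "0 < D" by (simp add: D_def)
    define \<rho> where "\<rho> j = D * exp (- (\<theta> / 2 + 1/2) * depth j)" for j
    have fin: "finite (W j)" for j by (simp add: W_def)
    obtain B where B: "\<And>j. (\<Prod>k<j. psum q k) \<le> exp ((\<sigma> + \<eta> / 4) * depth j + B)"
      using prod_psum_le[OF psum[of "\<sigma> + \<eta> / 4"]] \<eta> by auto
    have "real (card (W j)) \<le> exp (\<gamma> * depth j + ((\<sigma> + \<eta> / 4) * depth j + B))" for j
    proof -
      have "real (card (W j)) \<le> real (card {v \<in> words j. q * info j v \<le> \<gamma> * depth j})"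
        unfolding W_def by (intro of_nat_mono card_image_le) simp
      also have "\<dots> \<le> exp (\<gamma> * depth j) * exp ((\<sigma> + \<eta> / 4) * depth j + B)"
        using card_words_le[of j q "\<gamma> * depth j"] B[of j] by (smt (verit) exp_gt_zero mult_left_mono)
      finally show ?thesis by (simp add: exp_add)
    qed
    moreover have "\<gamma> * depth j + ((\<sigma> + \<eta> / 4) * depth j + B) = (s - \<eta> / 2) * depth j + B" for j
      by (simp add: \<gamma>_def \<eta>_def field_simps)
    ultimately have card: "real (card (W j)) \<le> exp ((s - \<eta> / 2) * depth j + B)" for j by simp
    have bound: "real (card (W j)) * (2 * \<rho> j) powr s \<le> exp B * (2 * D) powr s * exp (- (\<eta> / 4)) ^ j" for j
    proof -
      have "(2 * \<rho> j) powr s = (2 * D) powr s * exp (- (\<theta> / 2 + 1/2) * depth j) powr s"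
        using D by (simp add: \<rho>_def powr_mult)
      also have "exp (- (\<theta> / 2 + 1/2) * depth j) powr s = exp (- (s * (\<theta> / 2 + 1/2) * depth j))"
        by (simp add: powr_def algebra_simps)
      also have "\<dots> \<le> exp (- (s - \<eta> / 4) * depth j)"
      proof -
        have "s * \<theta> \<le> s * 1" using \<theta> s0 by (intro mult_left_mono) auto
        then have "s - \<eta> / 4 \<le> s * (\<theta> / 2 + 1/2)" using \<theta>(3) by (simp add: algebra_simps)
        then have "(s - \<eta> / 4) * depth j \<le> s * (\<theta> / 2 + 1/2) * depth j"
          by (intro mult_right_mono depth_nonneg)
        then show ?thesis by (simp add: algebra_simps)
      qed
      finally have "(2 * \<rho> j) powr s \<le> (2 * D) powr s * exp (- (s - \<eta> / 4) * depth j)"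
        using D by (simp add: mult_left_mono)
      then have "real (card (W j)) * (2 * \<rho> j) powr s
          \<le> exp ((s - \<eta> / 2) * depth j + B) * ((2 * D) powr s * exp (- (s - \<eta> / 4) * depth j))"
        using card[of j] by (intro mult_mono) auto
      also have "\<dots> = exp B * (2 * D) powr s * exp ((s - \<eta> / 2) * depth j + - (s - \<eta> / 4) * depth j)"
        by (simp only: exp_add mult_ac)
      also have "(s - \<eta> / 2) * depth j + - (s - \<eta> / 4) * depth j = - (\<eta> / 4) * depth j"
        by (simp add: algebra_simps)
      also have "exp (- (\<eta> / 4) * depth j) \<le> exp (- (\<eta> / 4) * real j)"
        using \<eta> depth_ge[of j] by simp
      also have "exp (- (\<eta> / 4) * real j) = exp (- (\<eta> / 4)) ^ j"
        by (simp add: exp_of_nat_mult[symmetric] mult.commute)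
      finally show ?thesis using D by (simp add: mult_left_mono)
    qed
    have "hmeasure s Y = 0"
    proof (rule hmeasure_limsup_zero[where W = W and \<rho> = \<rho>, OF s0 fin])
      show "0 < \<rho> j" for j using D by (simp add: \<rho>_def)
      have "\<rho> \<longlonglongrightarrow> D * 0"
        unfolding \<rho>_def by (intro tendsto_mult tendsto_const exp_neg_depth_tendsto) (use \<theta> in simp)
      then show "\<rho> \<longlonglongrightarrow> 0" by simp
      show "summable (\<lambda>j. real (card (W j)) * (2 * \<rho> j) powr s)"
      proof (rule summable_comparison_test)
        show "summable (\<lambda>j. exp B * (2 * D) powr s * exp (- (\<eta> / 4)) ^ j)"
          by (intro summable_mult summable_geometric) (use \<eta> in simp)
        show "\<exists>N. \<forall>j\<ge>N. norm (real (card (W j)) * (2 * \<rho> j) powr s) \<le> exp B * (2 * D) powr s * exp (- (\<eta> / 4)) ^ j"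
          using bound by (simp add: abs_mult)
      qed
      fix x assume "x \<in> Y"
      then have "\<exists>\<^sub>F j in sequentially. near_cell q \<gamma> (\<theta> / 2 + 1/2) x j"
        by (rule Y) (use \<eta> \<theta> in \<open>auto simp: \<gamma>_def\<close>)
      then show "\<exists>\<^sub>F j in sequentially. \<exists>w\<in>W j. dist x w \<le> \<rho> j"
      proof (rule frequently_elim1)
        fix j assume "near_cell q \<gamma> (\<theta> / 2 + 1/2) x j"
        then obtain w where w: "w \<in> seqs digits" "q * info j w \<le> \<gamma> * depth j"
          "dist x (point w) \<le> exp (- (\<theta> / 2 + 1/2) * depth j)" by (auto simp: near_cell_def)
        define v where "v = restrict w {..<j}"
        have v: "v \<in> words j" "agree j v w"
          using restrict_words[OF w(1)] agree_restrict by (auto simp: v_def)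
        have "point (extend j v) \<in> W j"
          using w v info_agree[OF v(2)] by (auto simp: W_def)
        moreover have "dist (point w) (point (extend j v)) \<le> DIM('a) * scale j"
          using v agree_trans[OF agree_sym[THEN iffD1, OF v(2)] agree_extend]
          by (intro dist_point_agree w(1) extend_seqs) auto
        moreover have "scale j \<le> exp (- (\<theta> / 2 + 1/2) * depth j)"
          using mult_right_mono[of "\<theta> / 2 + 1/2" 1 "depth j"] \<theta> depth_nonneg[of j] by (simp add: scale_def algebra_simps)
        then have "DIM('a) * scale j \<le> DIM('a) * exp (- (\<theta> / 2 + 1/2) * depth j)"
          by (intro mult_left_mono) auto
        ultimately have "point (extend j v) \<in> W j"
          "dist x (point (extend j v)) \<le> 1 * exp (- (\<theta> / 2 + 1/2) * depth j) + DIM('a) * exp (- (\<theta> / 2 + 1/2) * depth j)"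
          using w(3) dist_triangle[of x "point (extend j v)" "point w"] by linarith+
        then show "\<exists>w\<in>W j. dist x w \<le> \<rho> j"
          unfolding \<rho>_def D_def distrib_right[symmetric] by (rule rev_bexI)
      qed
    qed
    then show ?thesis by (rule hdim_le[OF s0])
  qed
  then have eps: "hdim Y \<le> ereal (\<gamma>0 + \<sigma>) + ereal e" if "0 < e" for e
    using that by simp
  show ?thesis by (rule ereal_le_epsilon2) (simp add: eps del: plus_ereal.simps)
qed

section \<open>The support\<close>

lemma closed_supp: "closed (point ` seqs digits :: 'a set)"
  by (rule closed_point_seqs) simp

lemma supp_mu: "supp_meas mu = point ` seqs digits"
proof
  show "supp_meas mu \<subseteq> point ` seqs digits"
  proof
    fix x assume x: "x \<in> supp_meas mu"
    show "x \<in> point ` seqs digits"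
    proof (rule ccontr)
      assume "x \<notin> point ` seqs digits"
      moreover have "closed (point ` seqs digits :: 'a set)" by (rule closed_point_seqs) simp
      then have "open (- (point ` seqs digits :: 'a set))" by (rule open_Compl)
      ultimately have "\<exists>e>0. ball x e \<subseteq> - (point ` seqs digits)" using open_contains_ball by blast
      then obtain e where e: "e > 0" "ball x e \<subseteq> - (point ` seqs digits)" by blast
      have "measure mu (ball x e) \<le> measure mu (- (point ` seqs digits))"
        using e by (intro M.finite_measure_mono) (auto simp: closed_supp)
      also have "\<dots> = 1 - measure mu (point ` seqs digits)"
        using M.prob_compl[of "point ` seqs digits"] closed_supp
        by (simp add: Compl_eq_Diff_UNIV)
      also have "\<dots> = 0" using measure_point_seqs[of p] by (simp add: set_p)
      finally have "emeasure mu (ball x e) = 0" by (simp add: M.emeasure_eq_measure measure_le_0_iff)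
      moreover have "0 < emeasure mu (ball x e)" using x e by (simp add: supp_meas_def)
      ultimately show False by simp
    qed
  qed
next
  show "point ` seqs digits \<subseteq> supp_meas mu"
  proof
    fix x assume "x \<in> (point ` seqs digits :: 'a set)"
    then obtain w where w: "w \<in> seqs digits" "x = point w" by blast
    have "0 < emeasure mu (ball x e)" if e: "0 < e" for e
    proof -
      have "\<forall>\<^sub>F j in sequentially. scale j < e / DIM('a)"
        using e by (intro order_tendstoD(2)[OF scale_tendsto_0]) auto
      then obtain j where j: "scale j < e / DIM('a)" by (auto simp: eventually_sequentially)
      have "weight p j w \<le> measure mu (ball x e)"
      proof (rule weight_le_measure_code)
        fix w' assume w': "\<And>k. w' k \<in> set_pmf (p k)" "agree j w w'"
        have "dist (point w) (point w') \<le> DIM('a) * scale j"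
          using w' w by (intro dist_point_agree) (auto simp: seqs_def set_p)
        also have "\<dots> < e" using j by (simp add: field_simps)
        finally show "point w' \<in> ball x e" by (simp add: w)
      qed simp
      then show ?thesis using weight_pos_seqs[OF w(1), of j] by (simp add: M.emeasure_eq_measure)
    qed
    then show "x \<in> supp_meas mu" by (simp add: supp_meas_def)
  qed
qed

lemma Mc_mu: "Mc mu"
proof -
  obtain w0 where w0: "w0 \<in> seqs (digits :: nat \<Rightarrow> ('a \<Rightarrow> nat) set)"
    using extend_seqs[of "\<lambda>_. undefined" 0] by auto
  have "dist (point w0) x \<le> DIM('a) * scale 0" if "x \<in> point ` seqs digits" for x :: 'a
    using that dist_point_agree[OF w0, of _ 0] by (auto simp: agree_def)
  then have "bounded (point ` seqs digits :: 'a set)" unfolding bounded_def by blast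
  then show ?thesis using closed_supp by (simp add: Mc_def supp_mu compact_eq_bounded_closed M.emeasure_eq_measure)
qed

subsection \<open>Local dimensions\<close>

lemma eventually_small: "\<forall>\<^sub>F r in at_right (0::real). 0 < r \<and> r \<le> 1/8"
  unfolding eventually_at_right_field by (intro exI[of _ "1/8"]) auto

lemma measure_cball_le:
  assumes "w \<in> seqs digits" "0 < r" "r \<le> 1/8"
  shows "measure mu (cball (point w) r) \<le> weight p (level r) w"
proof (rule measure_code_le_weight)
  fix w' assume "\<And>k. w' k \<in> set_pmf (p k)" "point w' \<in> cball (point w) r"
  then show "agree (level r) w w'"
    using agree_level[OF assms(1) _ assms(2,3), of w'] by (auto simp: seqs_def set_p)
qed simp

lemma measure_cball_ge:
  assumes "w \<in> seqs digits" "0 < r" "r \<le> 1/8"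
  shows "weight p (level r + (DIM('a) + 3)) w \<le> measure mu (cball (point w) r)"
proof (rule weight_le_measure_code)
  fix w' assume "\<And>k. w' k \<in> set_pmf (p k)" "agree (level r + (DIM('a) + 3)) w w'"
  then show "point w' \<in> cball (point w) r"
    using dist_level[OF assms(1) _ assms(2,3), of w'] by (auto simp: seqs_def set_p)
qed simp

lemma measure_cball_pos:
  assumes "w \<in> seqs digits" "0 < r" "r \<le> 1/8"
  shows "0 < measure mu (cball (point w) r)"
  using measure_cball_ge[OF assms] weight_pos_seqs[OF assms(1)] by (rule order.strict_trans2[rotated])

text \<open>Within the support, a ball of radius \<open>r\<close> lies between the cells of
  generations \<open>level r + (DIM('a) + 3)\<close> and \<open>level r\<close>, whose depths are
  both asymptotic to \<open>- ln r\<close>. Working in \<open>ereal\<close> treats infinite local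
  dimension at the same time.\<close>

lemma local_dim_tendsto:
  assumes w: "w \<in> seqs digits" and lim: "(\<lambda>j. ereal (info j w / depth j)) \<longlonglongrightarrow> \<alpha>"
  shows "((\<lambda>r. ereal (ln (measure mu (cball (point w) r)) / ln r)) \<longlongrightarrow> \<alpha>) (at_right 0)"
proof -
  have conv: "((\<lambda>r. ereal (info (level r + i) w / depth (level r + i)) * ereal (depth (level r + i) / - ln r))
      \<longlongrightarrow> \<alpha> * ereal 1) (at_right 0)" for i
  proof (rule tendsto_mult_ereal)
    show "((\<lambda>r. ereal (info (level r + i) w / depth (level r + i))) \<longlongrightarrow> \<alpha>) (at_right 0)"
      by (rule filterlim_compose[OF lim filterlim_level_add])
    show "((\<lambda>r. ereal (depth (level r + i) / - ln r)) \<longlongrightarrow> ereal 1) (at_right 0)"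
      using depth_level_ratio[of i] by (simp only: lim_ereal)
  qed auto
  have lev: "\<forall>\<^sub>F r in at_right 0. 1 \<le> level r"
    using filterlim_level unfolding filterlim_at_top by blast
  let ?e = "DIM('a) + 3"
  show ?thesis
  proof (rule tendsto_sandwich)
    show "((\<lambda>r. ereal (info (level r) w / depth (level r)) * ereal (depth (level r) / - ln r)) \<longlongrightarrow> \<alpha>) (at_right 0)"
      using conv[of 0] by simp
    show "((\<lambda>r. ereal (info (level r + ?e) w / depth (level r + ?e)) * ereal (depth (level r + ?e) / - ln r)) \<longlongrightarrow> \<alpha>) (at_right 0)"
      using conv[of ?e] by simp
    show "\<forall>\<^sub>F r in at_right 0. ereal (info (level r) w / depth (level r)) * ereal (depth (level r) / - ln r)
        \<le> ereal (ln (measure mu (cball (point w) r)) / ln r)"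
      using eventually_small lev
    proof eventually_elim
      case (elim r)
      have d: "0 < depth (level r)" using elim by (intro depth_pos) auto
      have l: "ln r < 0" using elim by simp
      have "ln (measure mu (cball (point w) r)) \<le> - info (level r) w"
        using measure_cball_le[OF w, of r] measure_cball_pos[OF w, of r] elim by (simp add: info_def weight_pos_seqs w)
      then have "- info (level r) w / ln r \<le> ln (measure mu (cball (point w) r)) / ln r"
        using l by (intro divide_right_mono_neg) auto
      then show ?case using d l by simp
    qed
    show "\<forall>\<^sub>F r in at_right 0. ereal (ln (measure mu (cball (point w) r)) / ln r)
       \<le> ereal (info (level r + ?e) w / depth (level r + ?e)) * ereal (depth (level r + ?e) / - ln r)"
      using eventually_small
    proof eventually_elim
      case (elim r)
      have d: "0 < depth (level r + ?e)" by (intro depth_pos) auto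
      have l: "ln r < 0" using elim by simp
      have "- info (level r + ?e) w \<le> ln (measure mu (cball (point w) r))"
        using measure_cball_ge[OF w, of r] measure_cball_pos[OF w, of r] elim by (simp add: info_def weight_pos_seqs w)
      then have "ln (measure mu (cball (point w) r)) / ln r \<le> - info (level r + ?e) w / ln r"
        using l by (intro divide_right_mono_neg) auto
      then show ?case using d l by simp
    qed
  qed
qed

lemma point_in_levelE:
  assumes w: "w \<in> seqs digits" and lim: "(\<lambda>j. ereal (info j w / depth j)) \<longlonglongrightarrow> \<alpha>"
  shows "point w \<in> levelE mu \<alpha>"
  using local_dim_tendsto[OF assms] w
  by (auto simp: levelE_def supp_mu lower_ldim_def upper_ldim_def
      intro!: lim_imp_Liminf lim_imp_Limsup)

abbreviation cut :: "'a set \<Rightarrow> 'a measure" where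
  "cut B \<equiv> density mu (indicator B)"

lemma measure_cut: "B \<in> sets borel \<Longrightarrow> V \<in> sets borel \<Longrightarrow> measure (cut B) V = measure mu (B \<inter> V)"
  by (simp add: measure_restricted)

lemma emeasure_cut: "B \<in> sets borel \<Longrightarrow> V \<in> sets borel \<Longrightarrow> emeasure (cut B) V = ennreal (measure mu (B \<inter> V))"
  by (simp add: emeasure_restricted M.emeasure_eq_measure)

lemma supp_cut:
  assumes "B \<in> sets borel"
  shows "supp_meas (cut B) \<subseteq> point ` seqs digits"
  unfolding supp_mu[symmetric] supp_meas_def
proof (intro subsetI CollectI allI impI)
  fix x and e :: real assume x: "x \<in> {x. \<forall>e>0. 0 < emeasure (cut B) (ball x e)}" and "0 < e"
  then have "0 < emeasure (cut B) (ball x e)" by simp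
  also have "\<dots> = emeasure mu (B \<inter> ball x e)" using assms by (simp add: emeasure_restricted)
  also have "\<dots> \<le> emeasure mu (ball x e)" by (intro emeasure_mono) auto
  finally show "0 < emeasure mu (ball x e)" .
qed

lemma cut_cball_pos:
  assumes "B \<in> sets borel" "x \<in> supp_meas (cut B)" "0 < r"
  shows "0 < measure mu (B \<inter> cball x r)"
proof -
  have "0 < measure mu (B \<inter> ball x r)"
    using assms emeasure_cut[of B "ball x r"] by (auto simp: supp_meas_def)
  also have "\<dots> \<le> measure mu (B \<inter> cball x r)"
    using assms by (intro M.finite_measure_mono) auto
  finally show ?thesis .
qed

lemma frequently_level:
  assumes "\<exists>\<^sub>F r in at_right 0. P (level r + i)"
  shows "\<exists>\<^sub>F j in sequentially. P j"
proof (rule ccontr)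
  assume "\<not> ?thesis"
  then have "\<forall>\<^sub>F j in sequentially. \<not> P j" by (simp add: frequently_def)
  then have "\<forall>\<^sub>F r in at_right 0. \<not> P (level r + i)"
    by (rule eventually_compose_filterlim[OF _ filterlim_level_add])
  then show False using assms by (simp add: frequently_def)
qed

lemma near_cell_self:
  assumes "w \<in> seqs digits" "q * info j w \<le> \<gamma> * depth j"
  shows "near_cell q \<gamma> \<theta> (point w) j"
  unfolding near_cell_def using assms by (intro bexI[of _ w]) auto

text \<open>For positive \<open>q\<close> cells of large mass are wanted. The lower limit provides
  arbitrarily small balls of restricted mass at least \<open>r powr a\<close>; this is at most their
  \<open>mu\<close>-mass and hence at most the weight of the cell of \<open>point w\<close> at
  \<open>level r\<close>.\<close>

lemma near_cell_pos:
  assumes w: "w \<in> seqs digits" and B: "B \<in> sets borel" and x: "point w \<in> supp_meas (cut B)"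
    and \<alpha>: "lower_ldim (cut B) (point w) = \<alpha>" and q: "0 < q" and \<gamma>: "\<alpha> * ereal q < ereal \<gamma>"
  shows "\<exists>\<^sub>F j in sequentially. near_cell q \<gamma> \<theta> (point w) j"
proof -
  have "\<alpha> < ereal (\<gamma> / q)" using \<gamma> q by (cases \<alpha>) (auto simp: field_simps)
  then obtain a' where a': "\<alpha> < a'" "a' < ereal (\<gamma> / q)" using dense by blast
  then obtain a where a: "\<alpha> < ereal a" "a < \<gamma> / q" by (cases a') auto
  let ?Q = "\<lambda>r. ln (measure (cut B) (cball (point w) r)) / ln r"
  have "\<exists>\<^sub>F r in at_right 0. ?Q r < a"
  proof (rule ccontr)
    assume "\<not> ?thesis"
    then have "\<forall>\<^sub>F r in at_right 0. ereal a \<le> ereal (?Q r)" by (simp add: frequently_def not_less)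
    from Liminf_bounded[OF this] show False using a \<alpha> by (simp add: lower_ldim_def not_less[symmetric])
  qed
  moreover have "\<forall>\<^sub>F r in at_right 0. q * a * (1 / (depth (level r + 0) / - ln r)) < \<gamma>"
  proof (rule order_tendstoD(2))
    show "((\<lambda>r. q * a * (1 / (depth (level r + 0) / - ln r))) \<longlongrightarrow> q * a * (1 / 1)) (at_right 0)"
      by (intro tendsto_intros depth_level_ratio) simp
    show "q * a * (1 / 1) < \<gamma>" using a q by (simp add: field_simps)
  qed
  moreover have "\<forall>\<^sub>F r in at_right 0. 1 \<le> level r"
    using filterlim_level unfolding filterlim_at_top by blast
  ultimately have "\<exists>\<^sub>F r in at_right 0. ?Q r < a \<and>
      (q * a * (1 / (depth (level r + 0) / - ln r)) < \<gamma> \<and> 1 \<le> level r \<and> (0 < r \<and> r \<le> 1/8))"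
    using eventually_small by (rule frequently_eventually_frequently[OF _ eventually_conj[OF _ eventually_conj]])
  then have "\<exists>\<^sub>F r in at_right 0. near_cell q \<gamma> \<theta> (point w) (level r + 0)"
  proof (rule frequently_elim1)
    fix r assume r: "?Q r < a \<and> (q * a * (1 / (depth (level r + 0) / - ln r)) < \<gamma> \<and> 1 \<le> level r \<and> (0 < r \<and> r \<le> 1/8))"
    then have l: "0 < - ln r" by simp
    have d: "0 < depth (level r)" using r by (intro depth_pos) auto
    have pos: "0 < measure (cut B) (cball (point w) r)"
      using cut_cball_pos[OF B x] r B by (simp add: measure_cut)
    have "measure (cut B) (cball (point w) r) \<le> measure mu (cball (point w) r)"
      unfolding measure_cut[OF B borel_closed[OF closed_cball]] by (intro M.finite_measure_mono) auto
    also have "\<dots> \<le> weight p (level r) w" using r by (intro measure_cball_le w) auto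
    finally have "info (level r) w \<le> - ln (measure (cut B) (cball (point w) r))"
      using pos weight_pos_seqs[OF w] by (simp add: info_def)
    also have "\<dots> = ?Q r * - ln r" using l by (simp add: field_simps)
    also have "\<dots> \<le> a * - ln r" using r l by (intro mult_right_mono) auto
    finally have "q * info (level r) w \<le> q * (a * - ln r)" using q by (intro mult_left_mono) auto
    also have "\<dots> \<le> \<gamma> * depth (level r)" using r l d by (simp add: field_simps)
    finally show "near_cell q \<gamma> \<theta> (point w) (level r + 0)" using w by (simp add: near_cell_self)
  qed
  then show ?thesis by (rule frequently_level)
qed

lemma filterlim_times_at_right:
  assumes "0 < (c::real)"
  shows "filterlim (\<lambda>h. c * h) (at_right 0) (at_right 0)"
  unfolding filterlim_at
proof
  have "((\<lambda>h. c * h) \<longlongrightarrow> c * 0) (at_right 0)" by (intro tendsto_intros)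
  then show "((\<lambda>h. c * h) \<longlongrightarrow> 0) (at_right 0)" by simp
  show "\<forall>\<^sub>F h in at_right 0. c * h \<in> {0<..} \<and> c * h \<noteq> 0"
    using eventually_small by eventually_elim (use assms in auto)
qed

text \<open>Constant factors in the radius vanish on the logarithmic scale, so the ball of radius
  \<open>c * h\<close> found inside and the surrounding ball of radius \<open>2 * h\<close> can be
  compared with the same generation.\<close>

lemma ln_scale_ratio:
  assumes "0 < c" "0 < c'"
  shows "((\<lambda>h. - ln (c' * h) / depth (level (c * h) + i)) \<longlongrightarrow> 1) (at_right 0)"
proof -
  note lim = filterlim_times_at_right[OF assms(1)]
  have 1: "((\<lambda>h. depth (level (c * h) + i) / - ln (c * h)) \<longlongrightarrow> 1) (at_right 0)"
    by (rule filterlim_compose[OF depth_level_ratio lim])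
  have "((\<lambda>h. 1 + (- ln (c' / c)) / - ln (c * h)) \<longlongrightarrow> 1 + 0) (at_right 0)"
  proof (intro tendsto_add tendsto_const real_tendsto_divide_at_top)
    have "filterlim (\<lambda>h. ln (c * h)) at_bot (at_right 0)"
      by (rule filterlim_compose[OF ln_at_0 lim])
    then show "filterlim (\<lambda>h. - ln (c * h)) at_top (at_right 0)"
      by (simp add: filterlim_uminus_at_bot)
  qed (rule tendsto_const)
  then have "((\<lambda>h. (1 + (- ln (c' / c)) / - ln (c * h)) / (depth (level (c * h) + i) / - ln (c * h))) \<longlongrightarrow> (1 + 0) / 1) (at_right 0)"
    by (intro tendsto_divide 1) auto
  moreover have "\<forall>\<^sub>F h in at_right 0. (1 + (- ln (c' / c)) / - ln (c * h)) / (depth (level (c * h) + i) / - ln (c * h))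
      = - ln (c' * h) / depth (level (c * h) + i)"
  proof -
    have "\<forall>\<^sub>F h in at_right 0. 1 \<le> level (c * h)"
      using filterlim_compose[OF filterlim_level lim] unfolding filterlim_at_top by blast
    moreover have "\<forall>\<^sub>F h in at_right 0. 0 < c * h \<and> c * h \<le> 1/8"
      by (rule eventually_compose_filterlim[OF eventually_small lim])
    ultimately show ?thesis
      using eventually_small
    proof eventually_elim
      case (elim h)
      have "0 < depth (level (c * h) + i)" using elim by (intro depth_pos) auto
      moreover have "ln (c * h) < 0" using elim by (intro ln_less_zero) auto
      moreover have "ln (c' * h) = ln (c' / c) + ln (c * h)"
        using elim assms by (simp add: ln_mult ln_div)
      ultimately show ?case by (simp add: field_simps)
    qed
  qed
  ultimately show ?thesis by (simp add: Lim_transform_eventually)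
qed

text \<open>For negative \<open>q\<close> cells of small mass are wanted. The weight of a cell
  inside \<open>cball (point w) (c * h)\<close> is bounded by the restricted mass of
  \<open>cball x (2 * h)\<close>, which is at most \<open>(2 * h) powr a\<close> for all small
  \<open>h\<close>. The cell may miss \<open>x\<close>, but its code point is within
  \<open>h\<close>, and \<open>\<theta> < 1\<close> absorbs the constants relating \<open>h\<close>
  to its scale.\<close>

lemma near_cell_neg:
  assumes B: "B \<in> sets borel"
    and \<alpha>: "lower_ldim (cut B) x = \<alpha>" "\<alpha> \<noteq> -\<infinity>" and q: "q < 0"
    and \<gamma>: "\<alpha> * ereal q < ereal \<gamma>" and \<theta>: "\<theta> < 1" and c: "0 < c"
    and accessible: "\<And>\<epsilon>. 0 < \<epsilon> \<Longrightarrow> \<exists>h>0. h < \<epsilon> \<and> (\<exists>w\<in>seqs digits. dist x (point w) \<le> h \<and>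
                 cball (point w) (c * h) \<subseteq> B \<inter> cball x (2 * h))"
  shows "\<exists>\<^sub>F j in sequentially. near_cell q \<gamma> \<theta> x j"
proof -
  have "\<exists>a. ereal a < \<alpha> \<and> q * a < \<gamma>"
  proof (cases \<alpha>)
    case (real r)
    then have "\<gamma> / q < r" using \<gamma> q by (simp add: field_simps)
    then obtain a where "\<gamma> / q < a" "a < r" using dense by blast
    then show ?thesis using real q by (intro exI[of _ a]) (simp add: field_simps)
  next
    case PInf
    then show ?thesis using q by (intro exI[of _ "\<gamma> / q + 1"]) (simp add: distrib_left)
  qed (use \<alpha> in simp)
  then obtain a where a: "ereal a < \<alpha>" "q * a < \<gamma>" by blast
  let ?Q = "\<lambda>r. ln (measure (cut B) (cball x r)) / ln r"
  let ?e = "DIM('a) + 3"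
  define J where "J h = level (c * h) + ?e" for h
  have "\<forall>\<^sub>F r in at_right 0. ereal a < ereal (?Q r)"
    using a(1) less_LiminfD unfolding \<alpha>(1)[symmetric] lower_ldim_def by blast
  then have E1: "\<forall>\<^sub>F h in at_right 0. a < ?Q (2 * h)"
    using eventually_compose_filterlim[OF _ filterlim_times_at_right[of 2]] by simp
  have E2: "\<forall>\<^sub>F h in at_right 0. q * a * (- ln (2 * h) / depth (J h)) < \<gamma>"
  proof (rule order_tendstoD(2))
    show "((\<lambda>h. q * a * (- ln (2 * h) / depth (J h))) \<longlongrightarrow> q * a * 1) (at_right 0)"
      unfolding J_def by (intro tendsto_mult tendsto_const ln_scale_ratio c) simp
  qed (use a in simp)
  have E3: "\<forall>\<^sub>F h in at_right 0. \<theta> < - ln (1 * h) / depth (J h)"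
    unfolding J_def by (rule order_tendstoD(1)[OF ln_scale_ratio \<theta>]) (use c in auto)
  have E4: "\<forall>\<^sub>F h in at_right 0. 0 < c * h \<and> c * h \<le> 1/8"
    by (rule eventually_compose_filterlim[OF eventually_small filterlim_times_at_right[OF c]])
  have E5: "\<forall>\<^sub>F h in at_right 0. N \<le> J h" for N
    using filterlim_compose[OF filterlim_level_add[of ?e] filterlim_times_at_right[OF c]]
    unfolding filterlim_at_top J_def by blast
  show ?thesis
    unfolding frequently_sequentially
  proof
    fix N
    from E1 E2 E3 E4 E5[of N] eventually_small
    have "\<forall>\<^sub>F h in at_right 0. a < ?Q (2 * h) \<and> q * a * (- ln (2 * h) / depth (J h)) < \<gamma> \<and>
        \<theta> < - ln (1 * h) / depth (J h) \<and> 0 < c * h \<and> c * h \<le> 1/8 \<and> N \<le> J h \<and> h \<le> 1/8"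
      by eventually_elim auto
    then obtain \<epsilon> where \<epsilon>: "0 < \<epsilon>" and P: "\<And>h. 0 < h \<Longrightarrow> h < \<epsilon> \<Longrightarrow> a < ?Q (2 * h) \<and> q * a * (- ln (2 * h) / depth (J h)) < \<gamma> \<and>
        \<theta> < - ln (1 * h) / depth (J h) \<and> 0 < c * h \<and> c * h \<le> 1/8 \<and> N \<le> J h \<and> h \<le> 1/8"
      unfolding eventually_at_right_field by auto
    obtain h w where h: "0 < h" "h < \<epsilon>" and w: "w \<in> seqs digits" "dist x (point w) \<le> h"
      "cball (point w) (c * h) \<subseteq> B \<inter> cball x (2 * h)" using accessible[OF \<epsilon>] by blast
    note Ph = P[OF h]
    have d: "0 < depth (J h)" unfolding J_def by (intro depth_pos) auto
    have l: "ln (2 * h) < 0" using h Ph by (intro ln_less_zero) auto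
    have "weight p (J h) w \<le> measure mu (cball (point w) (c * h))"
      unfolding J_def using Ph by (intro measure_cball_ge w) auto
    also have "\<dots> \<le> measure (cut B) (cball x (2 * h))"
      unfolding measure_cut[OF B borel_closed[OF closed_cball]] using w(3) B by (intro M.finite_measure_mono) auto
    finally have le: "weight p (J h) w \<le> measure (cut B) (cball x (2 * h))" .
    have "ln (weight p (J h) w) \<le> ln (measure (cut B) (cball x (2 * h)))"
      using le weight_pos_seqs[OF w(1), of "J h"] by (subst ln_le_cancel_iff) auto
    then have "- ln (measure (cut B) (cball x (2 * h))) \<le> info (J h) w" by (simp add: info_def)
    moreover have "- ln (measure (cut B) (cball x (2 * h))) = ?Q (2 * h) * - ln (2 * h)"
      using l by (simp add: field_simps)
    moreover have "a * - ln (2 * h) \<le> ?Q (2 * h) * - ln (2 * h)"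
      using Ph l by (intro mult_right_mono) auto
    ultimately have "a * - ln (2 * h) \<le> info (J h) w" by linarith
    then have "q * info (J h) w \<le> q * (a * - ln (2 * h))" using q by (intro mult_left_mono_neg) auto
    also have "\<dots> = q * a * (- ln (2 * h) / depth (J h)) * depth (J h)" using d by simp
    also have "\<dots> \<le> \<gamma> * depth (J h)" using Ph d by (intro mult_right_mono) auto
    finally have 1: "q * info (J h) w \<le> \<gamma> * depth (J h)" .
    have "\<theta> < - ln h / depth (J h)" using Ph by simp
    then have "\<theta> * depth (J h) \<le> - ln h" unfolding pos_less_divide_eq[OF d] by simp
    then have "exp (ln h) \<le> exp (- \<theta> * depth (J h))" by simp
    then have "dist x (point w) \<le> exp (- \<theta> * depth (J h))" using w(2) h by simp
    then have "near_cell q \<gamma> \<theta> x (J h)" unfolding near_cell_def using 1 w(1) by blast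
    then show "\<exists>j\<ge>N. near_cell q \<gamma> \<theta> x j" using Ph by blast
  qed
qed

text \<open>Balls around an atom have mass bounded below, so the lower local dimension is at most 0.
  Its product with the negative \<open>q\<close> is nonnegative, hence \<gamma> is positive and
  every generation passes the test.\<close>

lemma near_cell_atom:
  assumes w: "w \<in> seqs digits" and B: "B \<in> sets borel" "0 < measure mu (B \<inter> {point w})"
    and \<alpha>: "lower_ldim (cut B) (point w) = \<alpha>" and q: "q < 0" and \<gamma>: "\<alpha> * ereal q < ereal \<gamma>"
  shows "near_cell q \<gamma> \<theta> (point w) j"
proof -
  let ?Q = "\<lambda>r. ln (measure (cut B) (cball (point w) r)) / ln r"
  let ?m = "measure mu (B \<inter> {point w})"
  have "\<alpha> \<le> 0"
  proof (rule ccontr)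
    assume "\<not> \<alpha> \<le> 0"
    then obtain a' where "0 < a'" "a' < \<alpha>" using dense by (metis not_le)
    then obtain a where a: "0 < a" "ereal a < \<alpha>" by (cases a') auto
    have "\<forall>\<^sub>F r in at_right 0. ereal a < ereal (?Q r)"
      using a(2) less_LiminfD unfolding \<alpha>(1)[symmetric] lower_ldim_def by blast
    then have 1: "\<forall>\<^sub>F r in at_right 0. a < ?Q r" by simp
    have "((\<lambda>r. ln ?m / ln r) \<longlongrightarrow> 0) (at_right 0)"
      by (rule tendsto_divide_0[OF tendsto_const filterlim_mono[OF ln_at_0 at_bot_le_at_infinity order_refl]])
    then have 2: "\<forall>\<^sub>F r in at_right 0. ln ?m / ln r < a" using a by (intro order_tendstoD(2)) auto
    from 1 2 eventually_small have "\<forall>\<^sub>F r in at_right (0::real). False"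
    proof eventually_elim
      case (elim r)
      have "?m \<le> measure (cut B) (cball (point w) r)"
        unfolding measure_cut[OF B(1) borel_closed[OF closed_cball]]
        using elim B by (intro M.finite_measure_mono) auto
      then have "ln ?m \<le> ln (measure (cut B) (cball (point w) r))" using B(2) by (subst ln_le_cancel_iff) auto
      then have "?Q r \<le> ln ?m / ln r" using elim by (intro divide_right_mono_neg) auto
      then show ?case using elim by linarith
    qed
    then show False by simp
  qed
  then have "0 \<le> \<alpha> * ereal q" using q by (cases \<alpha>) (auto simp: mult_nonpos_nonpos)
  then have "0 < ereal \<gamma>" using \<gamma> by (rule order.strict_trans1)
  then have "0 \<le> \<gamma> * depth j" using depth_nonneg[of j] by simp
  moreover have "q * info j w \<le> 0" using q info_nonneg by (simp add: mult_nonpos_nonneg)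
  ultimately show ?thesis by (intro near_cell_self w) linarith
qed

lemma near_cell_cut:
  assumes B: "B \<in> sets borel" and x: "x \<in> supp_meas (cut B)"
    and \<alpha>: "lower_ldim (cut B) x = \<alpha>" "\<alpha> \<noteq> -\<infinity>"
    and \<gamma>: "\<alpha> * ereal q < ereal \<gamma>" and \<theta>: "\<theta> < 1"
    and accessible: "0 < measure mu (B \<inter> {x}) \<or> (\<exists>c>0. \<forall>\<epsilon>>0. \<exists>h>0. h < \<epsilon> \<and> (\<exists>w\<in>seqs digits. dist x (point w) \<le> h \<and>
                 cball (point w) (c * h) \<subseteq> B \<inter> cball x (2 * h)))"
  shows "\<exists>\<^sub>F j in sequentially. near_cell q \<gamma> \<theta> x j"
proof -
  obtain w where w: "w \<in> seqs digits" "x = point w" using supp_cut[OF B] x by blast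
  consider "0 < q" | "q = 0" | "q < 0" by linarith
  then show ?thesis
  proof cases
    case 1
    then show ?thesis using near_cell_pos[OF w(1) B] x \<alpha> \<gamma> by (simp add: w)
  next
    case 2
    then have "0 < \<gamma>" using \<gamma> by (simp add: zero_ereal_def[symmetric])
    then have "near_cell q \<gamma> \<theta> x j" for j
      using 2 near_cell_self[OF w(1), of q j \<gamma> \<theta>] depth_nonneg[of j] by (simp add: w)
    then show ?thesis by (simp add: eventually_frequently)
  next
    case 3
    from accessible show ?thesis
    proof
      assume "0 < measure mu (B \<inter> {x})"
      then have "near_cell q \<gamma> \<theta> x j" for j
        using near_cell_atom[OF w(1) B _ _ 3 \<gamma>] \<alpha> by (simp add: w)
      then show ?thesis by (simp add: eventually_frequently)
    next
      assume "\<exists>c>0. \<forall>\<epsilon>>0. \<exists>h>0. h < \<epsilon> \<and> (\<exists>w\<in>seqs digits. dist x (point w) \<le> h \<and>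
                 cball (point w) (c * h) \<subseteq> B \<inter> cball x (2 * h))"
      then show ?thesis using near_cell_neg[OF B \<alpha> 3 \<gamma> \<theta>] by blast
    qed
  qed
qed

subsection \<open>The \<open>L\<^sup>q\<close> spectrum\<close>

lemma card_digits_le: "ln (real (card (digits k :: ('a \<Rightarrow> nat) set))) \<le> DIM('a) * len k"
proof -
  have "real (n k) \<le> exp (len k)" using n_le[of k] by linarith
  then have "ln (real (n k)) \<le> len k" using n_pos[of k] ln_le_cancel_iff[of "real (n k)" "exp (len k)"] by simp
  then have "DIM('a) * ln (real (n k)) \<le> DIM('a) * len k" by (intro mult_left_mono) auto
  then show ?thesis using n_pos[of k] by (simp add: card_digits ln_realpow)
qed

lemma prod_card_digits_le:
  "(\<Prod>k\<in>{j..<j + i}. real (card (digits k :: ('a \<Rightarrow> nat) set))) \<le> exp (DIM('a) * (depth (j + i) - depth j))"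
proof (induction i)
  case (Suc i)
  have pos: "0 < real (card (digits (j + i) :: ('a \<Rightarrow> nat) set))"
    using digits_nonempty by (simp add: card_gt_0_iff)
  have "real (card (digits (j + i) :: ('a \<Rightarrow> nat) set)) \<le> exp (DIM('a) * len (j + i))"
    using card_digits_le[of "j + i"] pos by (metis exp_le_cancel_iff exp_ln)
  then have "(\<Prod>k\<in>{j..<j + i}. real (card (digits k :: ('a \<Rightarrow> nat) set))) * real (card (digits (j + i) :: ('a \<Rightarrow> nat) set))
     \<le> exp (DIM('a) * (depth (j + i) - depth j)) * exp (DIM('a) * len (j + i))"
    using Suc.IH by (intro mult_mono) (auto simp: prod_nonneg)
  then show ?case by (simp add: exp_add[symmetric] depth_Suc algebra_simps)
qed simp

text \<open>Words are counted at full length but weighted by their prefix, as happens when several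
  centres of a packing share a cell of generation \<open>j\<close>.\<close>

lemma sum_words_prefix:
  "(\<Sum>v\<in>words (j + i). weight p j v powr q) =
    (\<Prod>k<j. psum q k) * (\<Prod>k\<in>{j..<j + i}. real (card (digits k :: ('a \<Rightarrow> nat) set)))"
proof -
  have split: "{..<j + i} = {..<j} \<union> {j..<j + i}" by auto
  define f where "f k a = (if k < j then pmf (p k) a powr q else 1)" for k a
  have 1: "(\<Prod>k<j + i. \<Sum>a\<in>digits k. f k a) = (\<Sum>v\<in>words (j + i). \<Prod>k<j + i. f k (v k))"
    by (rule prod_sum_PiE) auto
  have 2: "(\<Prod>k<j + i. f k (v k)) = weight p j v powr q" for v
  proof -
    have "(\<Prod>k<j + i. f k (v k)) = (\<Prod>k<j. f k (v k)) * (\<Prod>k\<in>{j..<j + i}. f k (v k))"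
      unfolding split by (rule prod.union_disjoint) auto
    also have "\<dots> = weight p j v powr q" by (simp add: f_def weight_def prod_powr_distrib)
    finally show ?thesis .
  qed
  have "(\<Sum>v\<in>words (j + i). weight p j v powr q) = (\<Prod>k<j + i. \<Sum>a\<in>digits k. f k a)"
    unfolding 1 2 ..
  also have "\<dots> = (\<Prod>k<j. \<Sum>a\<in>digits k. f k a) * (\<Prod>k\<in>{j..<j + i}. \<Sum>a\<in>digits k. f k a)"
    unfolding split by (rule prod.union_disjoint) auto
  finally show ?thesis by (simp add: f_def psum_def)
qed

text \<open>For negative \<open>q\<close> ball masses must be bounded below, so the moments of the
  deeper generation enter. For \<open>q\<close> \<ge> 0 the cell of generation \<open>j\<close>
  bounds the mass, and the exponential bounds the number of centres sharing that cell.\<close>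

definition upper_sum :: "real \<Rightarrow> nat \<Rightarrow> real" where
  "upper_sum q j = (if q < 0 then \<Prod>k<j + (DIM('a) + 3). psum q k
     else (\<Prod>k<j. psum q k) * exp (DIM('a) * (depth (j + (DIM('a) + 3)) - depth j)))"

text \<open>Centres with the same word of length \<open>level r + (DIM('a) + 3)\<close> are within
  distance \<open>r\<close>, so their balls meet; a packing therefore injects into the words of that
  length.\<close>

lemma packing_upper:
  assumes r: "0 < r" "r \<le> 1/8" and X: "X \<in> packing_sums mu q r"
  shows "X \<le> upper_sum q (level r)"
proof -
  let ?j = "level r" and ?e = "DIM('a) + 3"
  obtain P where P: "finite P" "P \<subseteq> point ` seqs digits" "disjoint_family_on (\<lambda>x. cball x r) P"
    "X = (\<Sum>x\<in>P. measure mu (cball x r) powr q)"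
    using X by (auto simp: packing_sums_def supp_mu)
  have "\<forall>x\<in>P. \<exists>w. w \<in> seqs digits \<and> point w = x" using P(2) by auto
  then obtain c where c': "\<forall>x\<in>P. c x \<in> seqs digits \<and> point (c x) = x" by (rule bchoice[THEN exE])
  have c: "c x \<in> seqs digits \<and> point (c x) = x" if "x \<in> P" for x using c' that by (rule bspec)
  define g where "g x = restrict (c x) {..<?j + ?e}" for x
  have gw: "g x \<in> words (?j + ?e)" if "x \<in> P" for x using c[OF that] restrict_words by (auto simp: g_def)
  have ag: "agree (?j + ?e) (g x) (c x)" for x unfolding g_def by (rule agree_restrict)
  have inj: "inj_on g P"
  proof (rule inj_onI)
    fix x y assume xy: "x \<in> P" "y \<in> P" "g x = g y"
    then have "agree (?j + ?e) (c x) (c y)" using ag[of x] ag[of y] agree_sym agree_trans by metis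
    then have "dist x y \<le> r" using dist_level[of "c x" "c y" r] c xy r by auto
    then have "y \<in> cball x r \<inter> cball y r" using r by auto
    then show "x = y" using P(3) xy unfolding disjoint_family_on_def by blast
  qed
  have "X \<le> (\<Sum>x\<in>P. weight p (if q < 0 then ?j + ?e else ?j) (g x) powr q)"
    unfolding P(4)
  proof (rule sum_mono)
    fix x assume x: "x \<in> P"
    note cx = c[OF x]
    have w1: "weight p (?j + ?e) (g x) = weight p (?j + ?e) (c x)" by (rule weight_agree[OF ag])
    have w2: "weight p ?j (g x) = weight p ?j (c x)" by (rule weight_agree[OF agree_mono[OF ag]]) simp
    show "measure mu (cball x r) powr q \<le> weight p (if q < 0 then ?j + ?e else ?j) (g x) powr q"
    proof (cases "q < 0")
      case True
      then show ?thesis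
        using measure_cball_ge[of "c x" r] cx r w1 weight_pos_seqs[of "c x"] by (auto intro!: powr_mono2')
    next
      case False
      then show ?thesis
        using measure_cball_le[of "c x" r] cx r w2 by (auto intro!: powr_mono2)
    qed
  qed
  also have "\<dots> = (\<Sum>v\<in>g ` P. weight p (if q < 0 then ?j + ?e else ?j) v powr q)"
    by (simp add: sum.reindex[OF inj])
  also have "\<dots> \<le> (\<Sum>v\<in>words (?j + ?e). weight p (if q < 0 then ?j + ?e else ?j) v powr q)"
    using gw by (intro sum_mono2) auto
  also have "\<dots> \<le> upper_sum q ?j"
  proof (cases "q < 0")
    case False
    have "0 \<le> (\<Prod>k<?j. psum q k)" using psum_pos by (intro prod_nonneg) (auto intro: less_imp_le)
    then show ?thesis
      using False prod_card_digits_le[of ?j ?e] by (simp add: sum_words_prefix upper_sum_def mult_left_mono del: add_Suc_right)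
  qed (simp add: sum_words upper_sum_def)
  finally show ?thesis .
qed

text \<open>By pigeonhole some digit has at least the average probability, and there are at most
  \<open>exp (DIM('a) * len k)\<close> digits. Continuing a word by such digits loses a controlled
  factor, whereas an arbitrary continuation could be far less likely.\<close>

definition best :: "nat \<Rightarrow> 'a \<Rightarrow> nat" where
  "best k = (SOME a. a \<in> digits k \<and> exp (- (DIM('a) * len k)) \<le> pmf (p k) a)"

lemma best: "best k \<in> digits k" "exp (- (DIM('a) * len k)) \<le> pmf (p k) (best k)"
proof -
  have "\<exists>a. a \<in> digits k \<and> exp (- (DIM('a) * len k)) \<le> pmf (p k) a"
  proof (rule ccontr)
    assume *: "\<not> ?thesis"
    have pos: "0 < real (card (digits k :: ('a \<Rightarrow> nat) set))"
      using digits_nonempty by (simp add: card_gt_0_iff)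
    have "1 = (\<Sum>a\<in>digits k. pmf (p k) a)" by (simp add: sum_pmf_eq_1 set_p)
    also have "\<dots> < (\<Sum>a\<in>(digits k :: ('a \<Rightarrow> nat) set). exp (- (DIM('a) * len k)))"
      using * digits_nonempty by (intro sum_strict_mono) (auto simp: not_le)
    also have "\<dots> = card (digits k :: ('a \<Rightarrow> nat) set) * exp (- (DIM('a) * len k))" by simp
    also have "\<dots> \<le> exp (DIM('a) * len k) * exp (- (DIM('a) * len k))"
      using card_digits_le[of k] pos by (intro mult_right_mono) (metis exp_le_cancel_iff exp_ln, simp)
    also have "\<dots> = 1" by (simp add: exp_add[symmetric])
    finally show False by simp
  qed
  then show "best k \<in> digits k" "exp (- (DIM('a) * len k)) \<le> pmf (p k) (best k)"
    unfolding best_def by (metis (mono_tags, lifting) someI_ex)+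
qed

definition complete :: "nat \<Rightarrow> (nat \<Rightarrow> 'a \<Rightarrow> nat) \<Rightarrow> nat \<Rightarrow> 'a \<Rightarrow> nat" where
  "complete j v k = (if k < j then v k else best k)"

lemma weight_complete:
  "weight p j v * exp (- (DIM('a) * (depth (j + i) - depth j))) \<le> weight p (j + i) (complete j v)"
proof (induction i)
  case 0
  then show ?case by (simp add: weight_def complete_def)
next
  case (Suc i)
  have "weight p j v * exp (- (DIM('a) * (depth (j + Suc i) - depth j)))
     = weight p j v * exp (- (DIM('a) * (depth (j + i) - depth j))) * exp (- (DIM('a) * len (j + i)))"
    by (simp add: exp_add[symmetric] depth_Suc algebra_simps)
  also have "\<dots> \<le> weight p (j + i) (complete j v) * pmf (p (j + i)) (best (j + i))"
    using Suc.IH best[of "j + i"] by (intro mult_mono) (auto simp: weight_nonneg)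
  also have "\<dots> = weight p (j + Suc i) (complete j v)" by (simp add: weight_def complete_def)
  finally show ?case .
qed

definition lower_sum :: "real \<Rightarrow> nat \<Rightarrow> real" where
  "lower_sum q j = (\<Prod>k<j. psum q k) * exp (- (\<bar>q\<bar> * (DIM('a) * (depth (j + (DIM('a) + 3)) - depth j))))"

text \<open>One centre per cell of generation \<open>level r\<close> suffices: distinct cells are at
  least \<open>scale (level r) / 2\<close> \<ge> \<open>4 * r\<close> apart. For \<open>q\<close>
  \<ge> 0 the completion by \<open>best\<close> keeps the mass of the ball comparable with the
  weight of its cell.\<close>

lemma packing_lower:
  assumes r: "0 < r" "r \<le> 1/8"
  shows "\<exists>X\<in>packing_sums mu q r. lower_sum q (level r) \<le> X"
proof -
  let ?j = "level r" and ?e = "DIM('a) + 3"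
  have cs: "complete ?j v \<in> seqs digits" if "v \<in> words ?j" for v
    using that best by (auto simp: complete_def seqs_def)
  have ca: "agree ?j v (complete ?j v)" for v by (auto simp: agree_def complete_def)
  define g where "g v = point (complete ?j v)" for v
  have far: "2 * r < dist (g v) (g v')" if "v \<in> words ?j" "v' \<in> words ?j" "v \<noteq> v'" for v v'
  proof -
    have "\<not> agree ?j (complete ?j v) (complete ?j v')"
    proof
      assume "agree ?j (complete ?j v) (complete ?j v')"
      then have "agree ?j v v'" using ca[of v] ca[of v'] agree_sym agree_trans by metis
      then show False using words_agree_eq that by metis
    qed
    from dist_point_disagree[OF cs[OF that(1)] cs[OF that(2)] this]
    show ?thesis using scale_level(1)[OF r] r by (simp add: g_def)
  qed
  have inj: "inj_on g (words ?j)"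
  proof (rule inj_onI, rule ccontr)
    fix v v' assume "v \<in> words ?j" "v' \<in> words ?j" "g v = g v'" "v \<noteq> v'"
    then show False using far[of v v'] r by simp
  qed
  let ?P = "g ` words ?j"
  let ?X = "\<Sum>x\<in>?P. measure mu (cball x r) powr q"
  have "disjoint_family_on (\<lambda>x. cball x r) ?P"
    unfolding disjoint_family_on_def
  proof (intro ballI impI)
    fix x y assume "x \<in> ?P" "y \<in> ?P" "x \<noteq> y"
    then have "2 * r < dist x y" using far by auto
    show "cball x r \<inter> cball y r = {}"
    proof (rule ccontr)
      assume "\<not> ?thesis"
      then obtain z where "dist x z \<le> r" "dist y z \<le> r" by auto
      then show False using dist_triangle2[of x y z] \<open>2 * r < dist x y\<close> by simp
    qed
  qed
  moreover have "?P \<subseteq> supp_meas mu" using cs by (auto simp: supp_mu g_def)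
  ultimately have "?X \<in> packing_sums mu q r" unfolding packing_sums_def by auto
  moreover have "lower_sum q ?j \<le> ?X"
  proof -
    let ?E = "exp (- (\<bar>q\<bar> * (DIM('a) * (depth (?j + ?e) - depth ?j))))"
    have "lower_sum q ?j = (\<Sum>v\<in>words ?j. weight p ?j v powr q * ?E)"
      by (simp add: lower_sum_def sum_words sum_distrib_right[symmetric])
    also have "\<dots> \<le> (\<Sum>v\<in>words ?j. measure mu (cball (g v) r) powr q)"
    proof (rule sum_mono)
      fix v assume v: "v \<in> words ?j"
      have wp: "0 < weight p ?j v" using weight_pos_words[OF v] .
      have D: "0 \<le> DIM('a) * (depth (?j + ?e) - depth ?j)"
        using depth_mono[of ?j "?j + ?e"] by simp
      show "weight p ?j v powr q * ?E \<le> measure mu (cball (g v) r) powr q"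
      proof (cases "q < 0")
        case True
        have "weight p ?j v powr q * ?E \<le> weight p ?j v powr q * 1"
          using D by (intro mult_left_mono) auto
        also have "\<dots> \<le> measure mu (cball (g v) r) powr q"
          unfolding mult_1_right
        proof (rule powr_mono2')
          show "measure mu (cball (g v) r) \<le> weight p ?j v"
            using measure_cball_le[OF cs[OF v] r] weight_agree[OF ca[of v]] by (simp add: g_def)
        qed (use True measure_cball_pos[OF cs[OF v] r] in \<open>auto simp: g_def\<close>)
        finally show ?thesis .
      next
        case False
        have "weight p ?j v powr q * ?E = (weight p ?j v * exp (- (DIM('a) * (depth (?j + ?e) - depth ?j)))) powr q"
          using False wp by (simp add: powr_mult) (simp add: powr_def)
        also have "\<dots> \<le> measure mu (cball (g v) r) powr q"
        proof (rule powr_mono2)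
          show "weight p ?j v * exp (- (DIM('a) * (depth (?j + ?e) - depth ?j))) \<le> measure mu (cball (g v) r)"
            using weight_complete[of ?j v ?e] measure_cball_ge[OF cs[OF v] r] unfolding g_def by linarith
        qed (use False wp in auto)
        finally show ?thesis .
      qed
    qed
    also have "\<dots> = ?X" by (simp add: sum.reindex[OF inj])
    finally show ?thesis .
  qed
  ultimately show ?thesis by blast
qed

lemma lower_sum_pos: "0 < lower_sum q j"
  unfolding lower_sum_def using psum_pos by (intro mult_pos_pos prod_pos) auto

lemma Sup_packing:
  assumes r: "0 < r" "r \<le> 1/8"
  shows "Sup (packing_sums mu q r) \<le> upper_sum q (level r)" "lower_sum q (level r) \<le> Sup (packing_sums mu q r)"
proof -
  obtain X where X: "X \<in> packing_sums mu q r" "lower_sum q (level r) \<le> X" using packing_lower[OF r] by blast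
  show "Sup (packing_sums mu q r) \<le> upper_sum q (level r)"
    using X packing_upper[OF r] by (intro cSup_least) auto
  have "X \<le> Sup (packing_sums mu q r)"
    using X packing_upper[OF r] by (intro cSup_upper bdd_aboveI) auto
  then show "lower_sum q (level r) \<le> Sup (packing_sums mu q r)" using X by linarith
qed

text \<open>The corrections in \<open>upper_sum\<close> and \<open>lower_sum\<close> come from
  additive constants and from bounded shifts of the generation, and all of them are negligible
  against \<open>- ln r\<close>. An infinite \<sigma> is included since \<tau> takes the value
  \<open>-\<infinity>\<close> outside its domain.\<close>

lemma Lq_tendsto:
  fixes \<sigma> :: ereal
  assumes up: "\<And>c. \<sigma> < ereal c \<Longrightarrow> \<forall>\<^sub>F k in sequentially. ln (psum q k) \<le> c * len k"
    and low: "\<And>c. ereal c < \<sigma> \<Longrightarrow> \<forall>\<^sub>F k in sequentially. c * len k \<le> ln (psum q k)"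
  shows "((\<lambda>r. ereal (ln (Sup (packing_sums mu q r)) / ln r)) \<longlongrightarrow> - \<sigma>) (at_right 0)"
proof -
  let ?S = "\<lambda>r. Sup (packing_sums mu q r)" and ?e = "DIM('a) + 3"
  let ?m = "if q < 0 then 0 else real DIM('a)"
  let ?d = "\<lambda>i r. depth (level r + i) / - ln r"
  have Bl: "((\<lambda>r. B / - ln r) \<longlongrightarrow> 0) (at_right (0::real))" for B
  proof (intro real_tendsto_divide_at_top tendsto_const)
    show "filterlim (\<lambda>r. - ln r) at_top (at_right (0::real))"
      using ln_at_0 by (simp add: filterlim_uminus_at_bot)
  qed (rule tendsto_const)
  show ?thesis
  proof (rule order_tendstoI)
    fix y assume "y < - \<sigma>"
    then have "\<sigma> < - y" using ereal_less_uminus_reorder by blast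
    then obtain b where b: "\<sigma> < ereal b" "ereal b < - y" using ereal_dense2 by blast
    obtain c where c: "\<sigma> < ereal c" "c < b" using ereal_dense2[OF b(1)] by auto
    obtain B where B: "\<And>j. (\<Prod>k<j. psum q k) \<le> exp (c * depth j + B)"
      using prod_psum_le[OF up[OF c(1)]] by blast
    have "\<forall>\<^sub>F r in at_right 0. c * ?d (if q < 0 then ?e else 0) r + B / - ln r + ?m * (?d ?e r - ?d 0 r) < b"
    proof (rule order_tendstoD(2))
      show "((\<lambda>r. c * ?d (if q < 0 then ?e else 0) r + B / - ln r + ?m * (?d ?e r - ?d 0 r))
        \<longlongrightarrow> c * 1 + 0 + ?m * (1 - 1)) (at_right 0)"
        by (intro tendsto_add tendsto_mult tendsto_diff tendsto_const depth_level_ratio Bl)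
      show "c * 1 + 0 + ?m * (1 - 1) < b" using c by simp
    qed
    then show "\<forall>\<^sub>F r in at_right 0. y < ereal (ln (?S r) / ln r)"
      using eventually_small
    proof eventually_elim
      case (elim r)
      have l: "0 < - ln r" using elim by simp
      have S: "0 < ?S r" using Sup_packing(2)[of r q] lower_sum_pos[of q "level r"] elim by linarith
      have "?S r \<le> upper_sum q (level r)" using Sup_packing(1) elim by blast
      also have "\<dots> \<le> exp (c * depth (level r + (if q < 0 then ?e else 0)) + B + ?m * (depth (level r + ?e) - depth (level r)))"
      proof (cases "q < 0")
        case True
        then show ?thesis using B[of "level r + ?e"] by (simp add: upper_sum_def)
      next
        case False
        then show ?thesis using B[of "level r"] by (simp add: upper_sum_def exp_add[of "c * depth (level r) + B"])
      qed
      finally have "ln (?S r) \<le> ln (exp (c * depth (level r + (if q < 0 then ?e else 0)) + B + ?m * (depth (level r + ?e) - depth (level r))))"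
        using S by (subst ln_le_cancel_iff) auto
      then have "ln (?S r) / - ln r \<le> (c * depth (level r + (if q < 0 then ?e else 0)) + B + ?m * (depth (level r + ?e) - depth (level r))) / - ln r"
        using l unfolding ln_exp by (intro divide_right_mono) auto
      also have "\<dots> = c * ?d (if q < 0 then ?e else 0) r + B / - ln r + ?m * (?d ?e r - ?d 0 r)"
        unfolding add_divide_distrib diff_divide_distrib[symmetric] times_divide_eq_right add_0_right ..
      also have "\<dots> < b" using elim by blast
      finally have "- b < ln (?S r) / ln r" by simp
      then have "- ereal b < ereal (ln (?S r) / ln r)" by simp
      moreover have "y < - ereal b" using b(2) ereal_less_uminus_reorder by blast
      ultimately show ?case by (rule order.strict_trans[rotated])
    qed
  next
    fix y assume "- \<sigma> < y"
    then have "- y < \<sigma>" using ereal_uminus_less_reorder by blast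
    then obtain b where b: "- y < ereal b" "ereal b < \<sigma>" using ereal_dense2 by blast
    obtain c where c: "ereal c < \<sigma>" "b < c" using ereal_dense2[OF b(2)] by auto
    obtain B where B: "\<And>j. exp (c * depth j - B) \<le> (\<Prod>k<j. psum q k)"
      using prod_psum_ge[OF low[OF c(1)]] by blast
    have "\<forall>\<^sub>F r in at_right 0. b < c * ?d 0 r - B / - ln r - \<bar>q\<bar> * (DIM('a) * (?d ?e r - ?d 0 r))"
    proof (rule order_tendstoD(1))
      show "((\<lambda>r. c * ?d 0 r - B / - ln r - \<bar>q\<bar> * (DIM('a) * (?d ?e r - ?d 0 r)))
        \<longlongrightarrow> c * 1 - 0 - \<bar>q\<bar> * (real DIM('a) * (1 - 1))) (at_right 0)"
        by (intro tendsto_diff tendsto_mult tendsto_const depth_level_ratio Bl)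
      show "b < c * 1 - 0 - \<bar>q\<bar> * (real DIM('a) * (1 - 1))" using c by simp
    qed
    then show "\<forall>\<^sub>F r in at_right 0. ereal (ln (?S r) / ln r) < y"
      using eventually_small
    proof eventually_elim
      case (elim r)
      have l: "0 < - ln r" using elim by simp
      let ?T = "c * depth (level r) - B - \<bar>q\<bar> * (DIM('a) * (depth (level r + ?e) - depth (level r)))"
      have "exp ?T = exp (c * depth (level r) - B) * exp (- (\<bar>q\<bar> * (DIM('a) * (depth (level r + ?e) - depth (level r)))))"
        unfolding exp_add[symmetric] by simp
      also have "\<dots> \<le> lower_sum q (level r)"
        using B[of "level r"] unfolding lower_sum_def by (intro mult_right_mono) auto
      also have "\<dots> \<le> ?S r" using Sup_packing(2) elim by blast
      finally have "exp ?T \<le> ?S r" .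
      then have "ln (exp ?T) \<le> ln (?S r)" by (subst ln_le_cancel_iff) (auto intro: less_le_trans[OF exp_gt_zero])
      then have "?T / - ln r \<le> ln (?S r) / - ln r"
        using l unfolding ln_exp by (intro divide_right_mono) auto
      moreover have "?T / - ln r = c * ?d 0 r - B / - ln r - \<bar>q\<bar> * (DIM('a) * (?d ?e r - ?d 0 r))"
        by (simp add: diff_divide_distrib right_diff_distrib)
      ultimately have "b < ln (?S r) / - ln r" using elim by linarith
      then have "ln (?S r) / ln r < - b" by simp
      then have "ereal (ln (?S r) / ln r) < - ereal b" by simp
      moreover have "- ereal b < y" using b(1) ereal_uminus_less_reorder by blast
      ultimately show ?case by (rule order.strict_trans)
    qed
  qed
qed

lemma Lq_spectrum_mu:
  fixes \<sigma> :: ereal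
  assumes "\<And>c. \<sigma> < ereal c \<Longrightarrow> \<forall>\<^sub>F k in sequentially. ln (psum q k) \<le> c * len k"
    and "\<And>c. ereal c < \<sigma> \<Longrightarrow> \<forall>\<^sub>F k in sequentially. c * len k \<le> ln (psum q k)"
  shows "Lq_spectrum mu q = - \<sigma>"
  unfolding Lq_spectrum_def
  by (rule lim_imp_Liminf[OF trivial_limit_at_right_real Lq_tendsto[OF assms]])

subsection \<open>Restrictions to balls\<close>

text \<open>On the boundary of \<open>B\<close> the restricted measure can be much smaller than \<open>mu\<close> around \<open>x\<close>. Its lower
  local dimension is still controlled if \<open>B\<close> contains, at arbitrarily small scales \<open>h\<close>, balls of
  comparable size centred in the support at distance at most \<open>h\<close> from \<open>x\<close>.\<close>

definition accessible :: "'a set \<Rightarrow> 'a \<Rightarrow> bool" where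
  "accessible B x \<longleftrightarrow> 0 < measure mu (B \<inter> {x}) \<or>
    (\<exists>c>0. \<forall>\<epsilon>>0. \<exists>h>0. h < \<epsilon> \<and> (\<exists>w\<in>seqs digits. dist x (point w) \<le> h \<and>
        cball (point w) (c * h) \<subseteq> B \<inter> cball x (2 * h)))"

lemma accessible_interior:
  assumes w: "w \<in> seqs digits" and d: "0 < d" "cball (point w) d \<subseteq> B"
  shows "accessible B (point w)"
proof -
  have "\<exists>h>0. h < \<epsilon> \<and> (\<exists>v\<in>seqs digits. dist (point w) (point v) \<le> h \<and>
        cball (point v) (1 * h) \<subseteq> B \<inter> cball (point w) (2 * h))" if "0 < \<epsilon>" for \<epsilon>
  proof (intro exI conjI bexI)
    let ?h = "min (\<epsilon> / 2) d"
    show "0 < ?h" "?h < \<epsilon>" "dist (point w) (point w) \<le> ?h" using that d by auto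
    have "cball (point w) (1 * ?h) \<subseteq> cball (point w) d" by (rule subset_cball) simp
    moreover have "cball (point w) (1 * ?h) \<subseteq> cball (point w) (2 * ?h)" using \<open>0 < ?h\<close> by (intro subset_cball) simp
    ultimately show "cball (point w) (1 * ?h) \<subseteq> B \<inter> cball (point w) (2 * ?h)" using d by blast
  qed (rule w)
  then show ?thesis unfolding accessible_def by (intro disjI2 exI[of _ 1]) auto
qed

lemma measure_inter_seqs:
  assumes "V \<in> sets borel"
  shows "measure mu V = measure mu (V \<inter> point ` seqs digits)"
proof (rule antisym)
  have null: "measure mu (- (point ` seqs digits)) = 0"
    using M.prob_compl[of "point ` seqs digits"] closed_supp measure_point_seqs[of p]
    by (simp add: Compl_eq_Diff_UNIV set_p)
  have "measure mu V \<le> measure mu ((V \<inter> point ` seqs digits) \<union> - (point ` seqs digits))"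
    using assms closed_supp by (intro M.finite_measure_mono) auto
  also have "\<dots> \<le> measure mu (V \<inter> point ` seqs digits) + measure mu (- (point ` seqs digits))"
    using assms closed_supp by (intro measure_Un_le) auto
  finally show "measure mu V \<le> measure mu (V \<inter> point ` seqs digits)" using null by simp
  show "measure mu (V \<inter> point ` seqs digits) \<le> measure mu V"
    using assms by (intro M.finite_measure_mono) auto
qed

lemma supp_cut_closed:
  assumes "closed B"
  shows "supp_meas (cut B) \<subseteq> B"
proof
  fix x assume x: "x \<in> supp_meas (cut B)"
  show "x \<in> B"
  proof (rule ccontr)
    assume "x \<notin> B"
    then obtain e where e: "0 < e" "ball x e \<subseteq> - B"
      using assms open_contains_ball[of "- B"] by (metis ComplI open_Compl)
    then have "B \<inter> ball x e = {}" by blast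
    then show False using x e emeasure_cut[of B "ball x e"] assms by (auto simp: supp_meas_def)
  qed
qed

text \<open>Here the product structure of the support is used: it can be entered from \<open>x\<close> along one coordinate
  at a time. If no coordinate direction pointing into the ball meets the support arbitrarily close to
  \<open>x\<close>, then nearby points of the support lie on the outer side of the tangent hyperplane, so \<open>x\<close> is
  isolated in the ball and hence an atom.\<close>

lemma accessible_ball:
  assumes R: "0 < R" and x: "x \<in> supp_meas (cut (cball c R))"
  shows "accessible (cball c R) x"
proof -
  obtain w where w: "w \<in> seqs digits" "x = point w" using supp_cut[of "cball c R"] x by auto
  have xB: "x \<in> cball c R" using supp_cut_closed[of "cball c R"] x by auto
  show ?thesis
  proof (cases "dist c x < R")
    case True
    have "cball (point w) (R - dist c x) \<subseteq> cball c R"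
      unfolding w(2)[symmetric] by (auto, smt (verit) dist_triangle)
    then show ?thesis using accessible_interior[OF w(1), of "R - dist c x"] True w(2) by simp
  next
    case False
    then have R': "norm (x - c) = R" using xB by (simp add: dist_norm norm_minus_commute)
    \<comment> \<open>The inner normal at the boundary point \<open>x\<close>, of length
      \<open>R\<close>; the identity \<open>sq\<close> is the law of cosines for the triangle
      \<open>x\<close>, \<open>y\<close>, \<open>c\<close>.\<close>
    define nn where "nn = c - x"
    have nn: "norm nn = R" using R' by (simp add: nn_def norm_minus_commute)
    have sq: "(norm (y - c))\<^sup>2 = R\<^sup>2 - 2 * (nn \<bullet> (y - x)) + (norm (y - x))\<^sup>2" for y
    proof -
      have gen: "(norm (u - nn))\<^sup>2 = (norm u)\<^sup>2 + (norm nn)\<^sup>2 - 2 * (u \<bullet> nn)" for u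
        by (simp add: power2_norm_eq_inner inner_diff_left inner_diff_right inner_commute)
      have "(y - x) - nn = y - c" by (simp add: nn_def)
      from gen[of "y - x", unfolded this]
      show ?thesis by (simp add: nn inner_commute)
    qed
    show ?thesis
    proof (cases "\<exists>b\<in>Basis. nn \<bullet> b \<noteq> 0 \<and> (\<forall>\<epsilon>>0. \<exists>t. 0 < t * (nn \<bullet> b) \<and> \<bar>t\<bar> < \<epsilon> \<and> x + t *\<^sub>R b \<in> point ` seqs digits)")
      case True
      then obtain b where b: "b \<in> Basis" "nn \<bullet> b \<noteq> 0"
        and t: "\<And>\<epsilon>. 0 < \<epsilon> \<Longrightarrow> \<exists>t. 0 < t * (nn \<bullet> b) \<and> \<bar>t\<bar> < \<epsilon> \<and> x + t *\<^sub>R b \<in> point ` seqs digits" by blast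
      \<comment> \<open>A step \<open>t\<close> along \<open>b\<close> into the ball changes the
        squared distance to \<open>c\<close> by
        \<open>- 4 * R * c1 * \<bar>t\<bar> + t\<^sup>2\<close>. For
        \<open>\<bar>t\<bar> < 2 * R * c1\<close> at least half of the gain survives, which leaves
        room for a ball of radius \<open>c1 * \<bar>t\<bar>\<close>.\<close>
      define c1 where "c1 = \<bar>nn \<bullet> b\<bar> / (2 * R)"
      have c1: "0 < c1" "c1 \<le> 1/2"
        using b R Basis_le_norm[OF b(1), of nn] nn by (auto simp: c1_def field_simps)
      have "\<exists>h>0. h < \<epsilon> \<and> (\<exists>v\<in>seqs digits. dist x (point v) \<le> h \<and>
          cball (point v) (c1 * h) \<subseteq> cball c R \<inter> cball x (2 * h))" if "0 < \<epsilon>" for \<epsilon>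
      proof -
        have "0 < min \<epsilon> (2 * R * c1)" using that R c1 by simp
        from t[OF this] obtain t v where t: "0 < t * (nn \<bullet> b)" "\<bar>t\<bar> < \<epsilon>" "\<bar>t\<bar> < 2 * R * c1"
          and v: "v \<in> seqs digits" "point v = x + t *\<^sub>R b" by force
        have h: "0 < \<bar>t\<bar>" using t by auto
        have dxv: "dist x (point v) = \<bar>t\<bar>" using b v by (simp add: dist_norm)
        have tb: "t * (nn \<bullet> b) = 2 * R * c1 * \<bar>t\<bar>"
          using t(1) R by (simp add: c1_def abs_mult[symmetric] mult.commute)
        have "(norm (point v - c))\<^sup>2 = R\<^sup>2 - 2 * (2 * R * c1 * \<bar>t\<bar>) + \<bar>t\<bar>\<^sup>2"
          using sq[of "point v"] b v tb by (simp add: inner_scaleR_right)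
        also have "\<dots> \<le> (R - c1 * \<bar>t\<bar>)\<^sup>2"
        proof -
          have "\<bar>t\<bar> * \<bar>t\<bar> \<le> 2 * R * c1 * \<bar>t\<bar>" using t(3) by (intro mult_right_mono) auto
          moreover have "0 \<le> (c1 * \<bar>t\<bar>)\<^sup>2" by simp
          ultimately show ?thesis by (simp add: power2_eq_square algebra_simps)
        qed
        finally have "norm (point v - c) \<le> R - c1 * \<bar>t\<bar>"
        proof (rule power2_le_imp_le)
          have "c1 * \<bar>t\<bar> \<le> 1/2 * (2 * R * c1)" using t(3) c1 R h by (intro mult_mono) auto
          also have "\<dots> \<le> R" using c1 R by simp
          finally show "0 \<le> R - c1 * \<bar>t\<bar>" by simp
        qed
        then have dvc: "dist (point v) c \<le> R - c1 * \<bar>t\<bar>" by (simp add: dist_norm)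
        have c1t: "c1 * \<bar>t\<bar> \<le> \<bar>t\<bar>" using c1 h by simp
        have "cball (point v) (c1 * \<bar>t\<bar>) \<subseteq> cball c R \<inter> cball x (2 * \<bar>t\<bar>)"
        proof
          fix z assume "z \<in> cball (point v) (c1 * \<bar>t\<bar>)"
          then have z: "dist (point v) z \<le> c1 * \<bar>t\<bar>" by simp
          have "dist c z \<le> dist (point v) c + dist (point v) z" by (rule dist_triangle3)
          moreover have "dist x z \<le> dist x (point v) + dist (point v) z" by (rule dist_triangle)
          ultimately show "z \<in> cball c R \<inter> cball x (2 * \<bar>t\<bar>)" using z dvc dxv c1t by simp
        qed
        then show ?thesis using h t(2) v(1) dxv by (intro exI[of _ "\<bar>t\<bar>"] conjI bexI[of _ v]) auto
      qed
      then show ?thesis unfolding accessible_def using c1 by blast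
    next
      case False
      \<comment> \<open>There are finitely many coordinates, so a single \<epsilon> excludes inward
        points of the support on all axes through \<open>x\<close> that are not tangent.\<close>
      have "\<exists>\<epsilon>>0. \<forall>b\<in>Basis. nn \<bullet> b \<noteq> 0 \<longrightarrow> (\<forall>t. 0 < t * (nn \<bullet> b) \<and> \<bar>t\<bar> < \<epsilon> \<longrightarrow> x + t *\<^sub>R b \<notin> point ` seqs digits)"
      proof -
        have "\<forall>b\<in>Basis. \<exists>\<epsilon>>0. nn \<bullet> b \<noteq> 0 \<longrightarrow> (\<forall>t. 0 < t * (nn \<bullet> b) \<and> \<bar>t\<bar> < \<epsilon> \<longrightarrow> x + t *\<^sub>R b \<notin> point ` seqs digits)"
        proof
          fix b :: 'a assume b: "b \<in> Basis"
          show "\<exists>\<epsilon>>0. nn \<bullet> b \<noteq> 0 \<longrightarrow> (\<forall>t. 0 < t * (nn \<bullet> b) \<and> \<bar>t\<bar> < \<epsilon> \<longrightarrow> x + t *\<^sub>R b \<notin> point ` seqs digits)"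
          proof (cases "nn \<bullet> b = 0")
            case True
            then show ?thesis by (intro exI[of _ 1]) simp
          next
            case nz: False
            then show ?thesis using False b by blast
          qed
        qed
        then obtain e where e: "\<And>b. b \<in> Basis \<Longrightarrow> 0 < e b"
          "\<And>b t. b \<in> Basis \<Longrightarrow> nn \<bullet> b \<noteq> 0 \<Longrightarrow> 0 < t * (nn \<bullet> b) \<Longrightarrow> \<bar>t\<bar> < e b \<Longrightarrow> x + t *\<^sub>R b \<notin> point ` seqs digits"
          by (metis (no_types, lifting))
        have "0 < Min (e ` Basis)" using e by (subst Min_gr_iff) auto
        moreover have "\<bar>t\<bar> < Min (e ` Basis) \<Longrightarrow> b \<in> Basis \<Longrightarrow> \<bar>t\<bar> < e b" for t b
          by (subst (asm) Min_gr_iff) auto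
        ultimately show ?thesis using e by (intro exI[of _ "Min (e ` Basis)"]) blast
      qed
      then obtain \<epsilon> where \<epsilon>: "0 < \<epsilon>" and iso: "\<And>b t. b \<in> Basis \<Longrightarrow> nn \<bullet> b \<noteq> 0 \<Longrightarrow> 0 < t * (nn \<bullet> b) \<Longrightarrow> \<bar>t\<bar> < \<epsilon> \<Longrightarrow> x + t *\<^sub>R b \<notin> point ` seqs digits"
        by blast
      have single: "y = x" if y: "y \<in> point ` seqs digits" "y \<in> cball c R" "dist x y < \<epsilon>" for y
      proof -
        obtain v where v: "v \<in> seqs digits" "y = point v" using y by blast
        have "(nn \<bullet> b) * ((y - x) \<bullet> b) \<le> 0" if b: "b \<in> Basis" for b
        proof (rule ccontr)
          assume pos: "\<not> (nn \<bullet> b) * ((y - x) \<bullet> b) \<le> 0"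
          \<comment> \<open>Replacing coordinate \<open>b\<close> of \<open>x\<close> by that of
            \<open>y\<close> gives a point of the support on the axis through \<open>x\<close>;
            \<open>iso\<close> forbids it to lie on the inner side. Hence every summand of
            \<open>nn \<bullet> (y - x)\<close> is at most 0.\<close>
          obtain u where u: "u \<in> seqs digits" "point u = point w + ((point v - point w) \<bullet> b) *\<^sub>R b"
            using swap_coordinate[OF w(1) v(1) b] .
          have "\<bar>(y - x) \<bullet> b\<bar> \<le> norm (y - x)" by (rule Basis_le_norm[OF b])
          also have "\<dots> < \<epsilon>" using y(3) by (simp add: dist_norm norm_minus_commute)
          finally have "x + ((y - x) \<bullet> b) *\<^sub>R b \<notin> point ` seqs digits"
            using pos b by (intro iso) (auto simp: mult.commute)
          then show False using u w v by (metis imageI)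
        qed
        then have "nn \<bullet> (y - x) \<le> 0"
          by (subst euclidean_inner) (rule sum_nonpos)
        moreover have "(norm (y - c))\<^sup>2 \<le> R\<^sup>2"
          using y(2) R by (intro power_mono) (auto simp: dist_norm norm_minus_commute)
        ultimately have "(norm (y - x))\<^sup>2 \<le> 0" using sq[of y] by linarith
        then show ?thesis by simp
      qed
      have "cball c R \<inter> ball x \<epsilon> \<inter> point ` seqs digits \<subseteq> cball c R \<inter> {x}"
        using single by (auto simp: dist_commute)
      then have "measure mu (cball c R \<inter> ball x \<epsilon> \<inter> point ` seqs digits) \<le> measure mu (cball c R \<inter> {x})"
        by (intro M.finite_measure_mono) auto
      moreover have "0 < measure mu (cball c R \<inter> ball x \<epsilon>)"
        using x \<epsilon> emeasure_cut[of "cball c R" "ball x \<epsilon>"] by (auto simp: supp_meas_def)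
      moreover have "measure mu (cball c R \<inter> ball x \<epsilon>) = measure mu (cball c R \<inter> ball x \<epsilon> \<inter> point ` seqs digits)"
        by (rule measure_inter_seqs) auto
      ultimately show ?thesis unfolding accessible_def by auto
    qed
  qed
qed

section \<open>Cantor subsets of the level sets and matching upper bounds\<close>

lemma info_sum:
  assumes "w \<in> seqs digits"
  shows "info j w = (\<Sum>k<j. - ln (pmf (p k) (w k)))"
proof -
  have pos: "0 < pmf (p k) (w k)" for k using assms by (intro pmf_digit_pos) (simp add: seqs_def)
  have "ln (\<Prod>k<j. pmf (p k) (w k)) = (\<Sum>k<j. ln (pmf (p k) (w k)))"
    by (rule ln_prod) (rule finite_lessThan, rule pos[THEN less_imp_neq, THEN not_sym])
  then show ?thesis by (simp add: info_def weight_def sum_negf)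
qed

text \<open>A Cesaro mean with weights \<open>len k\<close>: the total weight \<open>depth j\<close>
  tends to infinity, so the averages inherit the limit of the single exponents. The one-sided
  estimates cover infinite limits as well.\<close>

lemma info_tendsto:
  assumes w: "w \<in> seqs digits"
    and lim: "(\<lambda>k. ereal (- ln (pmf (p k) (w k)) / len k)) \<longlonglongrightarrow> \<alpha>"
  shows "(\<lambda>j. ereal (info j w / depth j)) \<longlonglongrightarrow> \<alpha>"
proof -
  have len: "0 < len k" for k using len_ge_1[of k] by linarith
  have Bd: "(\<lambda>j. B / depth j) \<longlonglongrightarrow> 0" for B
    by (rule real_tendsto_divide_at_top[OF tendsto_const depth_at_top])
  show ?thesis
  proof (rule order_tendstoI)
    fix y assume "y < \<alpha>"
    then obtain b where b: "y < ereal b" "ereal b < \<alpha>" using ereal_dense2 by blast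
    obtain c where c: "y < ereal c" "c < b" using ereal_dense2[OF b(1)] by auto
    have "\<forall>\<^sub>F k in sequentially. ereal b < ereal (- ln (pmf (p k) (w k)) / len k)"
      by (rule order_tendstoD(1)[OF lim b(2)])
    then have "\<forall>\<^sub>F k in sequentially. b * len k \<le> - ln (pmf (p k) (w k))"
    proof eventually_elim
      case (elim k)
      then have "b < - ln (pmf (p k) (w k)) / len k" by simp
      then show ?case unfolding pos_less_divide_eq[OF len] by simp
    qed
    from sum_ge_depth[OF this] obtain B where B: "\<And>j. b * depth j - B \<le> info j w"
      unfolding info_sum[OF w] by blast
    have "\<forall>\<^sub>F j in sequentially. B / depth j < b - c"
      by (rule order_tendstoD(2)[OF Bd]) (use c in simp)
    then show "\<forall>\<^sub>F j in sequentially. y < ereal (info j w / depth j)"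
      using eventually_gt_at_top[of "0::nat"]
    proof eventually_elim
      case (elim j)
      have d: "0 < depth j" using elim depth_pos by simp
      have "(b * depth j - B) / depth j \<le> info j w / depth j" using B d by (intro divide_right_mono) auto
      then have "c < info j w / depth j" using elim d by (simp add: diff_divide_distrib)
      then have "ereal c < ereal (info j w / depth j)" by simp
      with c(1) show ?case by (rule order.strict_trans)
    qed
  next
    fix y assume "\<alpha> < y"
    then obtain b where b: "\<alpha> < ereal b" "ereal b < y" using ereal_dense2 by blast
    obtain c where c: "ereal c < y" "b < c" using ereal_dense2[OF b(2)] by auto
    have "\<forall>\<^sub>F k in sequentially. ereal (- ln (pmf (p k) (w k)) / len k) < ereal b"
      by (rule order_tendstoD(2)[OF lim b(1)])
    then have "\<forall>\<^sub>F k in sequentially. - ln (pmf (p k) (w k)) \<le> b * len k"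
    proof eventually_elim
      case (elim k)
      then have "- ln (pmf (p k) (w k)) / len k < b" by simp
      then show ?case unfolding pos_divide_less_eq[OF len] by simp
    qed
    from sum_le_depth[OF this] obtain B where B: "\<And>j. info j w \<le> b * depth j + B"
      unfolding info_sum[OF w] by blast
    have "\<forall>\<^sub>F j in sequentially. B / depth j < c - b"
      by (rule order_tendstoD(2)[OF Bd]) (use c in simp)
    then show "\<forall>\<^sub>F j in sequentially. ereal (info j w / depth j) < y"
      using eventually_gt_at_top[of "0::nat"]
    proof eventually_elim
      case (elim j)
      have d: "0 < depth j" using elim depth_pos by simp
      have "info j w / depth j \<le> (b * depth j + B) / depth j" using B d by (intro divide_right_mono) auto
      then have "info j w / depth j < c" using elim d by (simp add: add_divide_distrib)
      then have "ereal (info j w / depth j) < ereal c" by simp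
      then show ?case using c(1) by (rule order.strict_trans)
    qed
  qed
qed

definition regular :: "ereal \<Rightarrow> (nat \<Rightarrow> 'a \<Rightarrow> nat) set" where
  "regular \<alpha> = {w \<in> seqs digits. (\<lambda>j. ereal (info j w / depth j)) \<longlonglongrightarrow> \<alpha>}"

text \<open>Prescribing the first \<open>j\<close> digits by \<open>w0\<close> affects neither the
  eventual cardinalities nor the limits, so a Cantor set of the same dimension bound fits into an
  arbitrary cell. This is the source of homogeneity from below.\<close>

lemma hdim_regular_ge:
  fixes A :: "nat \<Rightarrow> ('a \<Rightarrow> nat) set"
  assumes w0: "w0 \<in> seqs digits"
    and A: "\<And>k. A k \<subseteq> digits k" "\<And>k. A k \<noteq> {}"
    and c: "\<And>t. 0 < t \<Longrightarrow> ereal t < c \<Longrightarrow> \<forall>\<^sub>F k in sequentially. t * len k \<le> ln (card (A k))"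
    and lim: "\<And>a. (\<And>k. a k \<in> A k) \<Longrightarrow> (\<lambda>k. ereal (- ln (pmf (p k) (a k)) / len k)) \<longlonglongrightarrow> \<alpha>"
  shows "c \<le> hdim (point ` {w \<in> regular \<alpha>. agree j w0 w})"
proof -
  define A' where "A' k = (if k < j then {w0 k} else A k)" for k
  have A': "A' k \<subseteq> digits k" "A' k \<noteq> {}" for k using A w0 by (auto simp: A'_def seqs_def)
  have "c \<le> hdim (point ` seqs A')"
  proof (rule hdim_point_seqs_ge[OF A'])
    fix t assume "0 < t" "ereal t < c"
    from c[OF this] eventually_ge_at_top[of j] show "\<forall>\<^sub>F k in sequentially. t * len k \<le> ln (card (A' k))"
      by eventually_elim (simp add: A'_def)
  qed
  also have "\<dots> \<le> hdim (point ` {w \<in> regular \<alpha>. agree j w0 w})"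
  proof (intro hdim_mono image_mono subsetI)
    fix w assume w: "w \<in> seqs A'"
    have ws: "w \<in> seqs digits" using w seqs_mono[of A' digits] A' by blast
    have "agree j w0 w"
      unfolding agree_def
    proof (intro allI impI)
      fix k assume "k < j"
      moreover have "w k \<in> A' k" using w by (simp add: seqs_def)
      ultimately show "w0 k = w k" by (simp add: A'_def)
    qed
    moreover have "(\<lambda>k. ereal (- ln (pmf (p k) (w k)) / len k)) \<longlonglongrightarrow> \<alpha>"
    proof -
      \<comment> \<open>The hypothesis \<open>lim\<close> speaks of sequences lying in
        \<open>A\<close> throughout, so the prescribed initial digits are replaced by arbitrary
        members of \<open>A k\<close>.\<close>
      define a where "a k = (if k < j then (SOME a. a \<in> A k) else w k)" for k
      have "a k \<in> A k" for k
      proof (cases "k < j")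
        case True
        then show ?thesis using A(2)[of k] by (simp add: a_def some_in_eq)
      next
        case False
        moreover have "w k \<in> A' k" using w by (simp add: seqs_def)
        ultimately show ?thesis by (simp add: a_def A'_def)
      qed
      then have "(\<lambda>k. ereal (- ln (pmf (p k) (a k)) / len k)) \<longlonglongrightarrow> \<alpha>" by (rule lim)
      moreover have "\<forall>\<^sub>F k in sequentially. ereal (- ln (pmf (p k) (a k)) / len k) = ereal (- ln (pmf (p k) (w k)) / len k)"
        using eventually_ge_at_top[of j] by eventually_elim (simp add: a_def)
      ultimately show ?thesis by (rule Lim_transform_eventually)
    qed
    ultimately show "w \<in> {w \<in> regular \<alpha>. agree j w0 w}" using ws info_tendsto by (simp add: regular_def)
  qed
  finally show ?thesis .
qed

lemma regular_levelE: "point ` regular \<alpha> \<subseteq> levelE mu \<alpha>"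
  using point_in_levelE by (auto simp: regular_def)

text \<open>At a point of the open ball the restriction agrees with \<open>mu\<close> on all
  sufficiently small balls.\<close>

lemma regular_lowerE_cut:
  assumes x: "x \<in> point ` regular \<alpha>" "x \<in> ball c R"
  shows "x \<in> lowerE (cut (cball c R)) \<alpha>"
proof -
  define d where "d = R - dist c x"
  have d: "0 < d" using x by (simp add: d_def)
  have sub: "cball x r \<subseteq> cball c R" if "r \<le> d" for r
  proof
    fix z assume "z \<in> cball x r"
    then show "z \<in> cball c R" using dist_triangle[of c z x] that by (simp add: d_def)
  qed
  have lev: "x \<in> levelE mu \<alpha>" using regular_levelE x by blast
  have "0 < emeasure (cut (cball c R)) (ball x e)" if e: "0 < e" for e
  proof -
    have "0 < emeasure mu (ball x (min e d))" using lev e d by (simp add: levelE_def supp_meas_def)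
    also have "\<dots> \<le> emeasure mu (cball c R \<inter> ball x e)"
      using sub[of d] ball_subset_cball[of x d] by (intro emeasure_mono) (auto simp: subset_iff)
    also have "\<dots> = emeasure (cut (cball c R)) (ball x e)" by (simp add: emeasure_restricted)
    finally show ?thesis .
  qed
  moreover have "lower_ldim (cut (cball c R)) x = lower_ldim mu x"
    unfolding lower_ldim_def
  proof (rule Liminf_eq)
    have "\<forall>\<^sub>F r in at_right 0. r \<le> d"
      unfolding eventually_at_right_field using d by (intro exI[of _ d]) auto
    then show "\<forall>\<^sub>F r in at_right 0. ereal (ln (measure (cut (cball c R)) (cball x r)) / ln r) = ereal (ln (measure mu (cball x r)) / ln r)"
    proof eventually_elim
      case (elim r)
      then have "cball c R \<inter> cball x r = cball x r" using sub by blast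
      then show ?case by (simp add: measure_cut)
    qed
  qed
  ultimately show ?thesis using lev by (simp add: lowerE_def levelE_def supp_meas_def)
qed

lemma cell_in_ball:
  assumes "ball c R \<inter> supp_meas mu \<noteq> {}"
  obtains w j where "w \<in> seqs digits" "\<And>v. v \<in> seqs digits \<Longrightarrow> agree j w v \<Longrightarrow> point v \<in> ball c R"
proof -
  obtain w where w: "w \<in> seqs digits" "point w \<in> ball c R" using assms by (auto simp: supp_mu)
  have "0 < (R - dist c (point w)) / DIM('a)" using w by simp
  then have "\<forall>\<^sub>F j in sequentially. scale j < (R - dist c (point w)) / DIM('a)"
    by (rule order_tendstoD(2)[OF scale_tendsto_0])
  then obtain j where j: "scale j < (R - dist c (point w)) / DIM('a)" by (auto simp: eventually_sequentially)
  show ?thesis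
  proof (rule that[OF w(1)])
    fix v assume v: "v \<in> seqs digits" "agree j w v"
    have "dist c (point v) \<le> dist c (point w) + dist (point w) (point v)" by (rule dist_triangle)
    moreover have "dist (point w) (point v) \<le> DIM('a) * scale j" by (rule dist_point_agree[OF w(1) v])
    moreover have "DIM('a) * scale j < R - dist c (point w)" using j by (simp add: field_simps)
    ultimately show "point v \<in> ball c R" by simp
  qed
qed

text \<open>Applying \<open>hdim_le_spectrum\<close> with \<open>\<sigma> = - \<tau> q\<close> and
  threshold \<open>\<alpha> * q\<close> gives one term of the infimum for each \<open>q\<close>. The
  formulation for restrictions serves \<open>mu\<close> itself, as \<open>cut UNIV\<close>, and
  every closed ball.\<close>

lemma hdim_lowerE_cut_le:
  assumes B: "B \<in> sets borel" and accessible: "\<And>x. x \<in> supp_meas (cut B) \<Longrightarrow> accessible B x"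
    and \<tau>: "\<And>q. \<tau> q \<noteq> \<infinity>"
    and psum: "\<And>q c. - \<tau> q < ereal c \<Longrightarrow> \<forall>\<^sub>F k in sequentially. ln (psum q k) \<le> c * len k"
    and \<alpha>: "\<alpha> \<noteq> -\<infinity>"
  shows "hdim (lowerE (cut B) \<alpha>) \<le> legendre \<tau> \<alpha>"
  unfolding legendre_def
proof (rule INF_greatest)
  let ?Y = "lowerE (cut B) \<alpha>"
  fix q assume q: "q \<in> (if \<alpha> = \<infinity> then tdom \<tau> \<inter> {..0} else tdom \<tau>)"
  then have "- \<infinity> < \<tau> q" by (auto simp: tdom_def split: if_splits)
  then obtain t where t: "\<tau> q = ereal t" using \<tau>[of q] by (cases "\<tau> q") auto
  show "hdim ?Y \<le> \<alpha> * ereal q - \<tau> q"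
  proof (cases "?Y = {}")
    case True
    then show ?thesis by (simp add: hdim_def)
  next
    case ne: False
    have bound: "hdim ?Y \<le> ereal (\<gamma>0 + - t)" if \<gamma>0: "\<alpha> * ereal q \<le> ereal \<gamma>0" for \<gamma>0
    proof (rule hdim_le_spectrum[OF _ _ ne])
      show "\<forall>\<^sub>F k in sequentially. ln (psum q k) \<le> c * len k" if "- t < c" for c
        using psum[of q c] that t by simp
      fix x \<gamma> \<theta> assume x: "x \<in> ?Y" and \<gamma>: "\<gamma>0 < \<gamma>" and \<theta>: "\<theta> < (1::real)"
      have \<gamma>': "\<alpha> * ereal q < ereal \<gamma>" by (rule le_less_trans[OF \<gamma>0]) (simp add: \<gamma>)
      show "\<exists>\<^sub>F j in sequentially. near_cell q \<gamma> \<theta> x j"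
        using x accessible[of x] unfolding accessible_def lowerE_def
        by (intro near_cell_cut[OF B _ _ \<alpha> \<gamma>' \<theta>]) auto
    qed
    show ?thesis
    proof (cases \<alpha>)
      case (real a)
      then show ?thesis using bound[of "a * q"] t by simp
    next
      case PInf
      then have "q \<le> 0" using q by simp
      show ?thesis
      proof (cases "q = 0")
        case True
        then show ?thesis using bound[of 0] t PInf by (simp add: zero_ereal_def[symmetric])
      next
        case False
        then have inf: "\<alpha> * ereal q = -\<infinity>" using PInf \<open>q \<le> 0\<close> by simp
        \<comment> \<open>Every real number is an upper bound for
          \<open>\<alpha> * q = -\<infinity>\<close>; the choice \<open>t - 1\<close> turns the
          estimate into \<open>hdim ?Y\<close> \<le> -1, which is impossible for a nonempty
          set.\<close>
        have "hdim ?Y \<le> ereal ((t - 1) + - t)" by (rule bound) (unfold inf, simp)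
        with hdim_nonneg[OF ne] have "0 \<le> ereal ((t - 1) + - t)" by (rule order.trans)
        then have False by simp
        then show ?thesis ..
      qed
    qed (use \<alpha> in simp)
  qed
qed

text \<open>Borel-Cantelli in the space of digit sequences. The set \<open>G\<close> of points whose
  digits eventually lie in \<open>A\<close> is a countable union of closed sets, which lets the
  almost sure statement pass to \<open>mu\<close>.\<close>

lemma exact_dimensional_mu:
  fixes A :: "nat \<Rightarrow> ('a \<Rightarrow> nat) set"
  assumes A: "\<And>k. A k \<subseteq> digits k" "\<And>k. A k \<noteq> {}"
    and summ: "summable (\<lambda>k. 1 - measure (measure_pmf (p k)) (A k))"
    and lim: "\<And>a. (\<And>k. a k \<in> A k) \<Longrightarrow> (\<lambda>k. ereal (- ln (pmf (p k) (a k)) / len k)) \<longlonglongrightarrow> ereal D"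
  shows "exact_dimensional mu D"
proof -
  interpret S: prob_space "seq_measure p" by (rule prob_space_seq_measure)
  define B where "B N k = (if k < N then digits k else A k)" for N k
  have B: "B N k \<subseteq> digits k" for N k using A by (auto simp: B_def)
  define G where "G = (\<Union>N. point ` seqs (B N))"
  have G: "G \<in> sets borel" unfolding G_def using closed_point_seqs[of "B _", OF B]
    by (intro sets.countable_UN) (auto intro!: borel_closed)
  have "AE w in seq_measure p. eventually (\<lambda>k. w \<in> space (seq_measure p) - {w. w k \<in> - A k}) sequentially"
  proof (rule borel_cantelli_AE1)
    have "measure (seq_measure p) {w. w k \<in> - A k} = 1 - measure (measure_pmf (p k)) (A k)" for k
      unfolding measure_coordinate using measure_pmf.prob_compl[of "A k" "p k"] by (simp add: Compl_eq_Diff_UNIV)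
    then show "summable (\<lambda>k. measure (seq_measure p) {w. w k \<in> - A k})" using summ by simp
    show "{w. w k \<in> - A k} \<in> sets (seq_measure p)" for k by (rule sets_coordinate)
    show "emeasure (seq_measure p) {w. w k \<in> - A k} < \<infinity>" for k
      unfolding S.emeasure_eq_measure by simp
  qed
  then have "AE w in seq_measure p. w \<in> point -` G"
    using AE_seqs[of p]
  proof eventually_elim
    case (elim w)
    then obtain N where N: "\<And>k. k \<ge> N \<Longrightarrow> w k \<in> A k" by (auto simp: eventually_sequentially)
    have "w \<in> seqs (B N)" using N elim by (auto simp: seqs_def B_def set_p)
    then show ?case by (auto simp: G_def)
  qed
  moreover have "point -` G \<in> sets (seq_measure p)" using measurable_sets[OF measurable_point G, of p] by simp
  ultimately have "measure mu G = 1" using S.prob_eq_1 G by (simp add: measure_code)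
  then have "AE x in mu. x \<in> G" using M.prob_eq_1[of G] G by simp
  then show ?thesis
    unfolding exact_dimensional_def
  proof eventually_elim
    case (elim x)
    then obtain N w where w: "w \<in> seqs (B N)" "x = point w" by (auto simp: G_def)
    have ws: "w \<in> seqs digits" using w seqs_mono[of "B N" digits] B by blast
    define a where "a k = (if k < N then (SOME a. a \<in> A k) else w k)" for k
    have "a k \<in> A k" for k
    proof (cases "k < N")
      case True
      then show ?thesis using A(2)[of k] by (simp add: a_def some_in_eq)
    next
      case False
      moreover have "w k \<in> B N k" using w by (simp add: seqs_def)
      ultimately show ?thesis by (simp add: a_def B_def)
    qed
    then have "(\<lambda>k. ereal (- ln (pmf (p k) (a k)) / len k)) \<longlonglongrightarrow> ereal D" by (rule lim)
    moreover have "\<forall>\<^sub>F k in sequentially. ereal (- ln (pmf (p k) (a k)) / len k) = ereal (- ln (pmf (p k) (w k)) / len k)"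
      using eventually_ge_at_top[of N] by eventually_elim (simp add: a_def)
    ultimately have "(\<lambda>k. ereal (- ln (pmf (p k) (w k)) / len k)) \<longlonglongrightarrow> ereal D" by (rule Lim_transform_eventually)
    from local_dim_tendsto[OF ws info_tendsto[OF ws this]] show ?case by (simp add: w(2))
  qed
qed

lemma levelE_subset_lowerE: "levelE M \<alpha> \<subseteq> lowerE M \<alpha>"
  by (auto simp: levelE_def lowerE_def)

lemma cut_UNIV: "cut UNIV = mu"
  by (simp add: density_1)

text \<open>Isolates what the choice of digits has to deliver: the asymptotics of the moment sums of
  single generations, a digit family for every exponent with nonnegative transform, and one family
  carrying all the mass up to a summable error.\<close>

theorem realization:
  fixes \<tau> :: "real \<Rightarrow> ereal"
  assumes \<tau>: "\<And>q. \<tau> q \<noteq> \<infinity>"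
    and legpos: "\<And>\<alpha>. \<alpha> \<noteq> -\<infinity> \<Longrightarrow> legendre \<tau> \<alpha> > -\<infinity> \<Longrightarrow> legendre \<tau> \<alpha> \<ge> 0"
    and psum_up: "\<And>q c. - \<tau> q < ereal c \<Longrightarrow> \<forall>\<^sub>F k in sequentially. ln (psum q k) \<le> c * len k"
    and psum_low: "\<And>q c. ereal c < - \<tau> q \<Longrightarrow> \<forall>\<^sub>F k in sequentially. c * len k \<le> ln (psum q k)"
    and types: "\<And>\<alpha>. \<alpha> \<noteq> -\<infinity> \<Longrightarrow> 0 \<le> legendre \<tau> \<alpha> \<Longrightarrow> \<exists>A. (\<forall>k. A k \<subseteq> digits k \<and> A k \<noteq> {}) \<and>
        (\<forall>t>0. ereal t < legendre \<tau> \<alpha> \<longrightarrow> (\<forall>\<^sub>F k in sequentially. t * len k \<le> ln (card (A k)))) \<and>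
        (\<forall>a. (\<forall>k. a k \<in> A k) \<longrightarrow> (\<lambda>k. ereal (- ln (pmf (p k) (a k)) / len k)) \<longlonglongrightarrow> \<alpha>)"
    and exact: "\<exists>A. (\<forall>k. A k \<subseteq> digits k \<and> A k \<noteq> {}) \<and> summable (\<lambda>k. 1 - measure (measure_pmf (p k)) (A k)) \<and>
        (\<forall>a. (\<forall>k. a k \<in> A k) \<longrightarrow> (\<lambda>k. ereal (- ln (pmf (p k) (a k)) / len k)) \<longlonglongrightarrow> ereal D)"
  shows "Mc mu \<and> homog_multifractal mu \<and> exact_dimensional mu D \<and> Lq_spectrum mu = \<tau> \<and>
    (\<forall>\<alpha>. \<alpha> \<noteq> -\<infinity> \<longrightarrow> fH mu \<alpha> = legendre (Lq_spectrum mu) \<alpha>)"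
proof -
  have Lq: "Lq_spectrum mu = \<tau>"
  proof
    fix q
    have "Lq_spectrum mu q = - (- \<tau> q)"
      using psum_up psum_low by (rule Lq_spectrum_mu)
    then show "Lq_spectrum mu q = \<tau> q" by simp
  qed
  have ge: "legendre \<tau> \<alpha> \<le> hdim (point ` {w \<in> regular \<alpha>. agree j w0 w})"
    if "\<alpha> \<noteq> -\<infinity>" "w0 \<in> seqs digits" for \<alpha> j w0
  proof (cases "legendre \<tau> \<alpha> = -\<infinity>")
    case False
    then have "0 \<le> legendre \<tau> \<alpha>" using legpos that by auto
    from types[OF that(1) this] obtain A where
      A: "\<forall>k. A k \<subseteq> digits k \<and> A k \<noteq> {}"
      "\<forall>t>0. ereal t < legendre \<tau> \<alpha> \<longrightarrow> (\<forall>\<^sub>F k in sequentially. t * len k \<le> ln (card (A k)))"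
      "\<forall>a. (\<forall>k. a k \<in> A k) \<longrightarrow> (\<lambda>k. ereal (- ln (pmf (p k) (a k)) / len k)) \<longlonglongrightarrow> \<alpha>" by blast
    show ?thesis by (rule hdim_regular_ge[OF that(2), of A]) (use A in auto)
  qed simp
  have le_mu: "hdim (lowerE mu \<alpha>) \<le> legendre \<tau> \<alpha>" if "\<alpha> \<noteq> -\<infinity>" for \<alpha>
  proof -
    have "accessible UNIV x" if "x \<in> supp_meas (cut UNIV)" for x
    proof -
      have "x \<in> point ` seqs digits" by (rule subsetD[OF supp_cut that]) simp
      then obtain w where "w \<in> seqs digits" "x = point w" by blast
      then show ?thesis using accessible_interior[of w 1 UNIV] by simp
    qed
    from hdim_lowerE_cut_le[of UNIV \<tau> \<alpha>, OF _ this \<tau> psum_up that] show ?thesis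
      unfolding cut_UNIV by simp
  qed
  obtain w0 :: "nat \<Rightarrow> 'a \<Rightarrow> nat" where w0: "w0 \<in> seqs digits"
    using extend_seqs[of "\<lambda>_. undefined" 0] by auto
  have ge_level: "legendre \<tau> \<alpha> \<le> hdim (levelE mu \<alpha>)" if "\<alpha> \<noteq> -\<infinity>" for \<alpha>
    using ge[OF that w0, of 0] hdim_mono[of "point ` {w \<in> regular \<alpha>. agree 0 w0 w}" "levelE mu \<alpha>"] regular_levelE[of \<alpha>]
    by (auto intro: order.trans)
  have level: "hdim (levelE mu \<alpha>) = legendre \<tau> \<alpha>" "hdim (lowerE mu \<alpha>) = legendre \<tau> \<alpha>" if "\<alpha> \<noteq> -\<infinity>" for \<alpha>
    using ge_level[OF that] le_mu[OF that] hdim_mono[OF levelE_subset_lowerE, of mu \<alpha>] by auto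
  have "homog_multifractal mu"
    unfolding homog_multifractal_def lower_fH_def
  proof (intro allI impI)
    fix c and R and \<alpha> :: ereal
    assume cR: "0 < R \<and> ball c R \<inter> supp_meas mu \<noteq> {}" and \<alpha>: "\<alpha> \<noteq> -\<infinity>"
    have "hdim (lowerE (cut (cball c R)) \<alpha>) \<le> legendre \<tau> \<alpha>"
      using cR by (intro hdim_lowerE_cut_le accessible_ball \<tau> psum_up \<alpha>) auto
    moreover have "legendre \<tau> \<alpha> \<le> hdim (lowerE (cut (cball c R)) \<alpha>)"
    proof -
      obtain w j where w: "w \<in> seqs digits" "\<And>v. v \<in> seqs digits \<Longrightarrow> agree j w v \<Longrightarrow> point v \<in> ball c R"
        using cell_in_ball[of c R] cR by blast
      have "point ` {v \<in> regular \<alpha>. agree j w v} \<subseteq> lowerE (cut (cball c R)) \<alpha>"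
      proof
        fix x assume "x \<in> point ` {v \<in> regular \<alpha>. agree j w v}"
        then obtain v where v: "v \<in> regular \<alpha>" "agree j w v" "x = point v" by blast
        then have "point v \<in> ball c R" using w by (simp add: regular_def)
        then show "x \<in> lowerE (cut (cball c R)) \<alpha>" using v regular_lowerE_cut by blast
      qed
      then show ?thesis using ge[OF \<alpha> w(1), of j] hdim_mono by (meson order.trans)
    qed
    ultimately show "hdim (lowerE (cut (cball c R)) \<alpha>) = hdim (lowerE mu \<alpha>)" using level \<alpha> by simp
  qed
  moreover have "exact_dimensional mu D"
    using exact exact_dimensional_mu by blast
  ultimately show ?thesis using Lq level(1) Mc_mu by (simp add: fH_def)
qed

end

subsection \<open>Construction of one generation\<close>

lemma disjoint_subsets_of_card:
  assumes "finite I" "finite S" "(\<Sum>i\<in>I. N i) \<le> card S"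
  shows "\<exists>F. (\<forall>i\<in>I. F i \<subseteq> S \<and> card (F i) = N i) \<and> disjoint_family_on F I"
  using assms
proof (induction I arbitrary: S rule: finite_induct)
  case empty
  then show ?case by (auto simp: disjoint_family_on_def)
next
  case (insert i I)
  then have "N i \<le> card S" by simp
  then obtain U where U: "U \<subseteq> S" "card U = N i" "finite U" by (rule obtain_subset_with_card_n)
  have "(\<Sum>i\<in>I. N i) \<le> card (S - U)"
    using insert U by (simp add: card_Diff_subset)
  then obtain F where F: "\<forall>i\<in>I. F i \<subseteq> S - U \<and> card (F i) = N i" "disjoint_family_on F I"
    using insert.IH[of "S - U"] insert.prems by auto
  have "disjoint_family_on (F(i := U)) (insert i I)"
    unfolding disjoint_family_on_def
  proof (intro ballI impI)
    fix a b assume ab: "a \<in> insert i I" "b \<in> insert i I" "a \<noteq> b"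
    show "(F(i := U)) a \<inter> (F(i := U)) b = {}"
      using ab F insert.hyps(2) unfolding disjoint_family_on_def by (cases "a = i"; cases "b = i") auto
  qed
  moreover have "\<forall>k\<in>insert i I. (F(i := U)) k \<subseteq> S \<and> card ((F(i := U)) k) = N k"
    using F U insert.hyps(2) by auto
  ultimately show ?case by blast
qed

lemma pmf_of_disjoint_family:
  fixes F :: "nat \<Rightarrow> 'b set" and g :: "nat \<Rightarrow> real"
  assumes fin: "finite S" and F: "(\<Union>i<M. F i) = S" "disjoint_family_on F {..<M}"
    and g: "\<And>i. i < M \<Longrightarrow> 0 < g i" and sum: "(\<Sum>i<M. card (F i) * g i) = 1"
  obtains p where "set_pmf p = S" "\<And>i a. i < M \<Longrightarrow> a \<in> F i \<Longrightarrow> pmf p a = g i"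
proof -
  define h where "h a = (\<Sum>i<M. indicator (F i) a * g i)" for a
  have h0: "0 \<le> h a" for a unfolding h_def using g by (intro sum_nonneg mult_nonneg_nonneg) (auto intro: less_imp_le)
  have hF: "h a = g i" if "i < M" "a \<in> F i" for a i
  proof -
    have "h a = (\<Sum>k<M. if k = i then g i else 0)"
      unfolding h_def
    proof (rule sum.cong)
      fix k assume "k \<in> {..<M}"
      then show "indicator (F k) a * g k = (if k = i then g i else 0)"
        using that F(2) unfolding disjoint_family_on_def by (cases "k = i") (auto simp: indicator_def)
    qed simp
    then show ?thesis using that by simp
  qed
  have hS: "h a = 0" if "a \<notin> S" for a
    unfolding h_def using that F(1) by (intro sum.neutral) (auto simp: indicator_def)
  have finF: "finite (F i)" if "i < M" for i using fin F(1) that by (metis UN_upper finite_subset lessThan_iff)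
  have "(\<Sum>a\<in>S. h a) = (\<Sum>i<M. \<Sum>a\<in>S. indicator (F i) a * g i)"
    unfolding h_def by (rule sum.swap)
  also have "\<dots> = (\<Sum>i<M. card (F i) * g i)"
  proof (rule sum.cong)
    fix i assume "i \<in> {..<M}"
    then have "F i \<subseteq> S" using F(1) by blast
    then have "S \<inter> F i = F i" by blast
    then show "(\<Sum>a\<in>S. indicator (F i) a * g i) = card (F i) * g i"
      using fin by (simp add: sum_distrib_right[symmetric] indicator_def sum.If_cases Int_def[symmetric])
  qed simp
  finally have sumh: "(\<Sum>a\<in>S. h a) = 1" using sum by simp
  have int: "(\<integral>\<^sup>+ a. ennreal (h a) \<partial>count_space UNIV) = 1"
  proof -
    have "(\<integral>\<^sup>+ a. ennreal (h a) \<partial>count_space UNIV) = (\<Sum>a\<in>S. ennreal (h a))"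
      using fin hS by (intro nn_integral_count_space') (auto simp: ennreal_eq_0_iff)
    also have "\<dots> = ennreal (\<Sum>a\<in>S. h a)" using h0 by (simp add: sum_ennreal)
    finally show ?thesis using sumh by simp
  qed
  show ?thesis
  proof (rule that[of "embed_pmf h"])
    show "pmf (embed_pmf h) a = g i" if "i < M" "a \<in> F i" for i a
      using pmf_embed_pmf[OF h0 int] hF[OF that] by simp
    have "h a \<noteq> 0 \<longleftrightarrow> a \<in> S" for a
    proof
      assume "a \<in> S"
      then obtain i where "i < M" "a \<in> F i" using F(1) by blast
      then show "h a \<noteq> 0" using hF g by fastforce
    qed (use hS in blast)
    then show "set_pmf (embed_pmf h) = S" using set_embed_pmf[OF h0 int] by simp
  qed
qed

text \<open>A block splits a cell into \<open>n ^ d\<close> digits of \<open>M\<close> types: up to an error governed by \<open>u\<close>,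
  type \<open>i\<close> has \<open>exp (l * f i)\<close> digits of probability \<open>exp (- l * \<alpha> i)\<close>, and type 0 is typical.\<close>

definition block ::
  "real \<Rightarrow> real \<Rightarrow> real \<Rightarrow> nat \<Rightarrow> (nat \<Rightarrow> real) \<Rightarrow> (nat \<Rightarrow> real) \<Rightarrow>
    nat \<Rightarrow> ('a::euclidean_space \<Rightarrow> nat) pmf \<Rightarrow> (nat \<Rightarrow> ('a \<Rightarrow> nat) set) \<Rightarrow> bool" where
  "block d l u M f \<alpha> n p F \<longleftrightarrow>
    0 < n \<and> 4 * real n \<le> exp (l + u + 3) \<and> set_pmf p = (Basis \<rightarrow>\<^sub>E {..<n}) \<and>
    (\<Union>i<M. F i) = set_pmf p \<and>
    (\<forall>i<M. exp (l * f i) \<le> real (card (F i)) \<and> real (card (F i)) \<le> exp (l * f i + (2 * u + d)) \<and>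
       (\<forall>a\<in>F i. exp (- (l * \<alpha> i) - (2 * u + d)) \<le> pmf p a \<and> pmf p a \<le> exp (- (l * \<alpha> i) + (2 * u + d)))) \<and>
    1 - 2 * real M * exp (- u) \<le> measure (measure_pmf p) (F 0)"

text \<open>The digits number exactly \<open>n ^ d\<close> and all need positive probability. Each
  type other than 1 receives \<open>\<lceil>exp (l * f i)\<rceil>\<close> digits and type 1, of the
  maximal dimension \<open>T\<close>, takes all the others. As \<open>f i\<close> \<le>
  \<open>\<alpha> i\<close>, damping by \<open>exp (- u)\<close> makes these types nearly massless;
  type 0, with \<open>f 0 = \<alpha> 0\<close>, can hold the remaining mass.\<close>

lemma exists_block:
  fixes l u T :: real and f \<alpha> :: "nat \<Rightarrow> real" and M :: nat
  defines "d \<equiv> DIM('a::euclidean_space)"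
  assumes l: "0 \<le> l" and u: "4 * real M \<le> exp u" and M: "2 \<le> M" and T: "T \<le> d"
    and f: "\<And>i. i < M \<Longrightarrow> 0 \<le> f i" "\<And>i. i < M \<Longrightarrow> f i \<le> T" "\<And>i. i < M \<Longrightarrow> f i \<le> \<alpha> i"
    and f0: "f 0 = \<alpha> 0" and f1: "f 1 = T"
  shows "\<exists>n (p :: ('a \<Rightarrow> nat) pmf) F. block d l u M f \<alpha> n p F"
proof -
  have d1: "1 \<le> real d" using DIM_positive[where 'a = 'a] unfolding d_def by linarith
  have eu: "8 \<le> exp u" using u M by simp
  have u0: "0 < u"
  proof (rule ccontr)
    assume "\<not> 0 < u"
    then have "exp u \<le> 1" by simp
    with eu show False by linarith
  qed
  have T0: "0 \<le> T" using f(1,2)[of 1] f1 M by simp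
  \<comment> \<open>The factor \<open>exp u\<close> in the number of digits makes room: the types
    other than 1 use at most half of \<open>exp (l * T + u)\<close>, because \<open>4 * M\<close>
    \<le> \<open>exp u\<close>.\<close>
  define x where "x = exp ((l * T + u) / d)"
  have x1: "1 \<le> x" using l T0 u0 d1 by (simp add: x_def)
  have xd: "x ^ d = exp (l * T + u)" using d1 by (simp add: x_def exp_of_nat_mult[symmetric])
  define n where "n = nat \<lceil>x\<rceil>"
  have n: "x \<le> n" "real n \<le> 2 * x" using x1 unfolding n_def by linarith+
  have n0: "0 < n" using n x1 by linarith
  have "x \<le> exp (l + u)"
  proof -
    have "l * T \<le> l * d" using T l by (intro mult_left_mono) auto
    moreover have "u \<le> u * d" using u0 d1 by simp
    ultimately have "(l * T + u) / d \<le> l + u" using d1 by (simp add: field_simps)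
    then show ?thesis by (simp add: x_def)
  qed
  moreover have "exp (3::real) \<ge> 8"
  proof -
    have "(2::real) ^ 3 \<le> exp 1 ^ 3" using exp_ge_add_one_self[of "1::real"] by (intro power_mono) auto
    then show ?thesis by (simp add: exp_of_nat_mult[symmetric])
  qed
  ultimately have "8 * x \<le> exp 3 * exp (l + u)" using x1 by (intro mult_mono) auto
  also have "\<dots> = exp (l + u + 3)" by (simp add: exp_add[symmetric])
  finally have n4: "4 * real n \<le> exp (l + u + 3)" using n by linarith
  define S where "S = (Basis \<rightarrow>\<^sub>E {..<n} :: ('a \<Rightarrow> nat) set)"
  have finS: "finite S" unfolding S_def by (intro finite_PiE) auto
  have cardS: "card S = n ^ d" by (simp add: S_def d_def card_PiE)
  have N_lo: "exp (l * T + u) \<le> real (card S)"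
    unfolding cardS using power_mono[OF n(1), of d] x1 xd by simp
  have N_up: "real (card S) \<le> 2 ^ d * exp (l * T + u)"
    unfolding cardS using power_mono[OF n(2), of d] xd by (simp add: power_mult_distrib)
  have ed: "(2::real) ^ d \<le> exp d"
  proof -
    have "(2::real) ^ d \<le> exp 1 ^ d" using exp_ge_add_one_self[of "1::real"] by (intro power_mono) auto
    then show ?thesis by (simp add: exp_of_nat_mult[symmetric])
  qed
  define N where "N i = nat \<lceil>exp (l * f i)\<rceil>" for i
  have N1: "1 \<le> exp (l * f i)" if "i < M" for i using f(1)[OF that] l by simp
  have N: "exp (l * f i) \<le> N i" "real (N i) \<le> 2 * exp (l * f i)" if "i < M" for i
    using N1[OF that] unfolding N_def by linarith+
  define I where "I = {..<M} - {1}"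
  have sumN: "(\<Sum>i\<in>I. real (N i)) \<le> exp (l * T + u) / 2"
  proof -
    have "real (N i) \<le> 2 * exp (l * T)" if "i \<in> I" for i
    proof -
      have i: "i < M" using that by (simp add: I_def)
      have "exp (l * f i) \<le> exp (l * T)" using f(2)[OF i] l by (simp add: mult_left_mono)
      then show ?thesis using N(2)[OF i] by linarith
    qed
    then have "(\<Sum>i\<in>I. real (N i)) \<le> (\<Sum>i\<in>I. 2 * exp (l * T))" by (rule sum_mono)
    also have "\<dots> = real (card I) * (2 * exp (l * T))" by simp
    also have "\<dots> \<le> real M * (2 * exp (l * T))"
      using card_mono[of "{..<M}" I] by (intro mult_right_mono) (auto simp: I_def)
    also have "\<dots> = 4 * real M * exp (l * T) / 2" by simp
    also have "\<dots> \<le> exp u * exp (l * T) / 2" using u by (intro divide_right_mono mult_right_mono) auto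
    finally show ?thesis by (simp add: exp_add mult.commute)
  qed
  have "real (\<Sum>i\<in>I. N i) \<le> real (card S)" 
    unfolding of_nat_sum using sumN N_lo exp_gt_zero[of "l * T + u"] by linarith
  then have "(\<Sum>i\<in>I. N i) \<le> card S" by linarith
  from disjoint_subsets_of_card[OF _ finS this] obtain F0 where
    F0: "\<forall>i\<in>I. F0 i \<subseteq> S \<and> card (F0 i) = N i" "disjoint_family_on F0 I" by (auto simp: I_def)
  define F where "F = F0(1 := S - (\<Union>i\<in>I. F0 i))"
  have F_I: "F i = F0 i" if "i \<in> I" for i using that by (auto simp: F_def I_def)
  have MI: "{..<M} = insert 1 I" "1 \<notin> I" using M by (auto simp: I_def)
  have F_union: "(\<Union>i<M. F i) = S"
    unfolding MI using F0(1) by (auto simp: F_I) (auto simp: F_def)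
  have F_disj: "disjoint_family_on F {..<M}"
    unfolding disjoint_family_on_def MI
  proof (intro ballI impI)
    fix a b assume ab: "a \<in> insert 1 I" "b \<in> insert 1 I" "a \<noteq> b"
    show "F a \<inter> F b = {}"
      using ab F0(2) MI(2) unfolding disjoint_family_on_def F_def by (cases "a = 1"; cases "b = 1") auto
  qed
  have finF: "finite (F0 i)" if "i \<in> I" for i using F0(1) finS that finite_subset by blast
  have card_union: "card (\<Union>i\<in>I. F0 i) = (\<Sum>i\<in>I. N i)"
  proof -
    have "card (\<Union>i\<in>I. F0 i) = (\<Sum>i\<in>I. card (F0 i))"
      using F0(2) finF by (intro card_UN_disjoint) (auto simp: I_def disjoint_family_on_def)
    then show ?thesis using F0(1) by simp
  qed
  have card1: "real (card (F 1)) = real (card S) - (\<Sum>i\<in>I. real (N i))"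
  proof -
    have "(\<Union>i\<in>I. F0 i) \<subseteq> S" using F0(1) by blast
    then have "card (F 1) = card S - (\<Sum>i\<in>I. N i)"
      unfolding F_def using card_union finS by (simp add: card_Diff_subset finite_subset)
    then show ?thesis using \<open>(\<Sum>i\<in>I. N i) \<le> card S\<close> by simp
  qed
  have card_lo: "exp (l * f i) \<le> real (card (F i))" if i: "i < M" for i
  proof (cases "i = 1")
    case True
    have "2 * exp (l * T) \<le> exp u * exp (l * T)" using eu by (intro mult_right_mono) auto
    then have "exp (l * T) \<le> exp (l * T + u) / 2" by (simp add: exp_add mult.commute)
    then show ?thesis using card1 sumN N_lo True f1 by simp
  next
    case False
    then have "i \<in> I" using i by (simp add: I_def)
    then show ?thesis using F0(1) N(1)[OF i] F_I by simp
  qed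
  define v where "v = 2 * u + real d"
  have v: "2 * u \<le> v" "8 \<le> exp v" "0 < v"
  proof -
    show "2 * u \<le> v" "0 < v" using d1 u0 by (auto simp: v_def)
    have "exp u \<le> exp v" using d1 u0 by (simp add: v_def)
    then show "8 \<le> exp v" using eu by linarith
  qed
  have card_up: "real (card (F i)) \<le> 2 * exp (l * f i)" if i: "i \<in> I" for i
    using i F0(1) N(2)[of i] F_I by (simp add: I_def)
  have card_up': "real (card (F i)) \<le> exp (l * f i + v)" if i: "i < M" for i
  proof (cases "i = 1")
    case True
    have "real (card (F i)) \<le> 2 ^ d * exp (l * T + u)"
      using card1 N_up True by (smt (verit) of_nat_0_le_iff sum_nonneg)
    also have "\<dots> \<le> exp d * exp (l * T + u)" using ed by (intro mult_right_mono) auto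
    also have "\<dots> = exp (l * T + u + d)" by (simp add: exp_add)
    also have "\<dots> \<le> exp (l * T + v)" using u0 by (simp add: v_def)
    finally show ?thesis using True f1 by simp
  next
    case False
    then have "real (card (F i)) \<le> 2 * exp (l * f i)" using card_up i by (simp add: I_def)
    also have "\<dots> \<le> exp v * exp (l * f i)" using v by (intro mult_right_mono) auto
    finally show ?thesis by (simp add: exp_add mult.commute)
  qed
  \<comment> \<open>Type 1 may have up to \<open>2 ^ d * exp (l * T + u)\<close> digits; its divisor
    \<open>2 ^ d\<close> and one of its two factors \<open>exp (- u)\<close> compensate this excess.
    The other factor makes its mass small, as for the remaining types.\<close>
  define g1 where "g1 i = (if i = 1 then exp (- (l * \<alpha> 1) - 2 * u) / 2 ^ d else exp (- (l * \<alpha> i) - u))" for i :: nat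
  have mass: "card (F i) * g1 i \<le> 2 * exp (- u)" if i: "i < M" for i
  proof (cases "i = 1")
    case True
    have "real (card (F 1)) \<le> 2 ^ d * exp (l * T + u)"
      using card1 N_up by (smt (verit) of_nat_0_le_iff sum_nonneg)
    then have "card (F 1) * (exp (- (l * \<alpha> 1) - 2 * u) / 2 ^ d) \<le> (2 ^ d * exp (l * T + u)) * (exp (- (l * \<alpha> 1) - 2 * u) / 2 ^ d)"
      by (rule mult_right_mono) simp
    moreover have "g1 i = exp (- (l * \<alpha> 1) - 2 * u) / 2 ^ d" "F i = F 1" using True by (simp_all add: g1_def)
    ultimately have "card (F i) * g1 i \<le> (2 ^ d * exp (l * T + u)) * (exp (- (l * \<alpha> 1) - 2 * u) / 2 ^ d)"
      by presburger
    also have "\<dots> = exp (l * T - l * \<alpha> 1 - u)" by (simp add: exp_add[symmetric])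
    also have "\<dots> \<le> exp (- u)"
      using mult_left_mono[OF f(3)[OF i] l] True f1 by simp
    finally show ?thesis by (smt (verit) exp_gt_zero)
  next
    case False
    then have "card (F i) * g1 i \<le> (2 * exp (l * f i)) * exp (- (l * \<alpha> i) - u)"
      unfolding g1_def using card_up[of i] i by (auto simp: I_def intro!: mult_right_mono)
    also have "\<dots> = 2 * exp (l * f i - l * \<alpha> i - u)" by (simp add: exp_add[symmetric])
    also have "\<dots> \<le> 2 * exp (- u)" using mult_left_mono[OF f(3)[OF i] l] by simp
    finally show ?thesis .
  qed
  define rest where "rest = (\<Sum>i\<in>{..<M} - {0}. card (F i) * g1 i)"
  have rest: "0 \<le> rest" "rest \<le> 2 * real M * exp (- u)"
  proof -
    show "0 \<le> rest" unfolding rest_def by (intro sum_nonneg) (auto simp: g1_def)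
    have "rest \<le> (\<Sum>i\<in>{..<M} - {0}. 2 * exp (- u))" unfolding rest_def using mass by (intro sum_mono) auto
    also have "\<dots> = real (card ({..<M} - {0})) * (2 * exp (- u))" by simp
    also have "\<dots> \<le> real M * (2 * exp (- u))"
      using card_mono[of "{..<M}" "{..<M} - {0}"] by (intro mult_right_mono) auto
    finally show "rest \<le> 2 * real M * exp (- u)" by simp
  qed
  have half: "2 * real M * exp (- u) \<le> 1/2" using u by (simp add: exp_minus field_simps)
  have I0: "0 \<in> I" using M by (simp add: I_def)
  have c0: "1 \<le> real (card (F 0))" 
  proof -
    have "0 < M" using M by simp
    then show ?thesis using card_lo[of 0] N1[of 0] by linarith
  qed
  \<comment> \<open>Type 0 gets the exact remainder instead of its nominal mass, which normalizes
    the total to 1; since \<open>rest\<close> is at most 1/2, this costs only a bounded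
    factor.\<close>
  define g where "g i = (if i = 0 then (1 - rest) / card (F 0) else g1 i)" for i
  have g_pos: "0 < g i" for i using c0 rest half by (auto simp: g_def g1_def)
  have g_sum: "(\<Sum>i<M. card (F i) * g i) = 1"
  proof -
    have "(\<Sum>i<M. card (F i) * g i) = card (F 0) * g 0 + (\<Sum>i\<in>{..<M} - {0}. card (F i) * g i)"
      using M by (intro sum.remove) auto
    also have "(\<Sum>i\<in>{..<M} - {0}. card (F i) * g i) = rest"
      unfolding rest_def by (intro sum.cong) (auto simp: g_def)
    also have "card (F 0) * g 0 = 1 - rest" using c0 by (simp add: g_def)
    finally show ?thesis by simp
  qed
  obtain p where p: "set_pmf p = S" "\<And>i a. i < M \<Longrightarrow> a \<in> F i \<Longrightarrow> pmf p a = g i"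
    using pmf_of_disjoint_family[OF finS F_union F_disj g_pos g_sum] by blast
  have g_bounds: "exp (- (l * \<alpha> i) - v) \<le> g i \<and> g i \<le> exp (- (l * \<alpha> i) + v)" if i: "i < M" for i
  proof -
    consider "i = 0" | "i = 1" | "i \<noteq> 0" "i \<noteq> 1" by blast
    then show ?thesis
    proof cases
      case 1
      have up: "g 0 \<le> 1 / exp (l * \<alpha> 0)"
        unfolding g_def using rest card_lo[of 0] M f0 by (auto intro!: frac_le)
      have cu: "real (card (F 0)) \<le> 2 * exp (l * \<alpha> 0)" using card_up[OF I0] f0 by simp
      have "(1/2) / (2 * exp (l * \<alpha> 0)) \<le> (1 - rest) / card (F 0)"
      proof (rule frac_le)
        show "0 \<le> 1 - rest" "1/2 \<le> 1 - rest" "0 < real (card (F 0))" using rest half c0 by linarith+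
      qed (rule cu)
      then have "(1/2) / (2 * exp (l * \<alpha> 0)) \<le> g 0" by (simp add: g_def)
      moreover have "exp (- (l * \<alpha> 0) - v) \<le> (1/2) / (2 * exp (l * \<alpha> 0))"
        using v(2) by (simp add: exp_diff exp_minus field_simps)
      moreover have "1 / exp (l * \<alpha> 0) \<le> exp (- (l * \<alpha> 0) + v)"
        using v(3) by (simp add: exp_minus[symmetric] inverse_eq_divide[symmetric])
      ultimately have "exp (- (l * \<alpha> 0) - v) \<le> g 0" "g 0 \<le> exp (- (l * \<alpha> 0) + v)" using up by linarith+
      then show ?thesis unfolding 1 ..
    next
      case 2
      have "exp (- (l * \<alpha> 1) - v) = exp (- (l * \<alpha> 1) - 2 * u) / exp d"
        by (simp add: v_def exp_diff[symmetric])
      also have "\<dots> \<le> exp (- (l * \<alpha> 1) - 2 * u) / 2 ^ d" using ed by (intro divide_left_mono) auto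
      finally have "exp (- (l * \<alpha> 1) - v) \<le> g 1" by (simp add: g_def g1_def)
      moreover have "exp (- (l * \<alpha> 1) - 2 * u) / 2 ^ d \<le> exp (- (l * \<alpha> 1) - 2 * u) / 1"
        by (rule divide_left_mono) (simp_all del: div_by_1)
      then have "g 1 \<le> exp (- (l * \<alpha> 1) - 2 * u) / 1" by (simp add: g_def g1_def)
      moreover have "exp (- (l * \<alpha> 1) - 2 * u) \<le> exp (- (l * \<alpha> 1) + v)" using u0 v by simp
      ultimately have "exp (- (l * \<alpha> 1) - v) \<le> g 1" "g 1 \<le> exp (- (l * \<alpha> 1) + v)" by linarith+
      then show ?thesis unfolding 2 ..
    next
      case 3
      then show ?thesis using u0 v by (simp add: g_def g1_def)
    qed
  qed
  have "measure (measure_pmf p) (F 0) = (\<Sum>a\<in>F 0. pmf p a)"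
    using finF[OF I0] F_I[OF I0] by (intro measure_measure_pmf_finite) simp
  also have "\<dots> = card (F 0) * g 0" using p(2)[of 0] M by simp
  also have "\<dots> = 1 - rest" using c0 by (simp add: g_def)
  finally have "1 - 2 * real M * exp (- u) \<le> measure (measure_pmf p) (F 0)" using rest by simp
  then show ?thesis
    using n0 n4 p F_union card_lo card_up' g_bounds
    by (intro exI[of _ n] exI[of _ p] exI[of _ F]) (auto simp: block_def S_def v_def)
qed

subsection \<open>Legendre transforms\<close>

text \<open>Monotone bounded quotients converge to their supremum. The one-sided derivatives are
  defined through \<open>Lim\<close>, so convergence has to be established before they can be
  compared with \<open>D\<close>.\<close>

lemma tendsto_slope_right:
  fixes g :: "real \<Rightarrow> real"
  assumes mono: "\<And>h h'. 0 < h \<Longrightarrow> h \<le> h' \<Longrightarrow> h' \<le> 1 \<Longrightarrow> g h' \<le> g h"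
    and bdd: "\<And>h. 0 < h \<Longrightarrow> h \<le> 1 \<Longrightarrow> g h \<le> B"
  obtains s where "(g \<longlongrightarrow> s) (at_right 0)" "\<And>h. 0 < h \<Longrightarrow> h \<le> 1 \<Longrightarrow> g h \<le> s"
proof -
  define s where "s = Sup (g ` {0<..1})"
  have bdd': "bdd_above (g ` {0<..1})" using bdd by (auto intro!: bdd_aboveI[of _ B])
  have ub: "g h \<le> s" if "0 < h" "h \<le> 1" for h
    unfolding s_def using that by (intro cSup_upper bdd') auto
  have "(g \<longlongrightarrow> s) (at_right 0)"
  proof (rule order_tendstoI)
    fix a assume "a < s"
    then obtain h0 where h0: "0 < h0" "h0 \<le> 1" "a < g h0"
      unfolding s_def using less_cSup_iff[of "g ` {0<..1}" a] bdd' by auto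
    then show "\<forall>\<^sub>F h in at_right 0. a < g h"
      unfolding eventually_at_right_field using mono[of _ h0] by (intro exI[of _ h0]) (auto intro: less_le_trans)
  next
    fix a assume "s < a"
    then show "\<forall>\<^sub>F h in at_right 0. g h < a"
      unfolding eventually_at_right_field
    proof (intro exI[of _ 1] conjI allI impI)
      fix h :: real assume "0 < h" "h < 1"
      then have "g h \<le> s" by (intro ub) auto
      also note \<open>s < a\<close>
      finally show "g h < a" .
    qed simp
  qed
  then show ?thesis using ub that by blast
qed

locale spectrum =
  fixes \<tau> :: "real \<Rightarrow> ereal" and D :: real and d :: nat
  assumes no_pinf: "\<tau> q \<noteq> \<infinity>"
    and conc: "concave_ext \<tau>"
    and one: "\<tau> 1 = 0"
    and zero: "- ereal (real d) \<le> \<tau> 0" "\<tau> 0 \<le> 0"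
    and dom: "tdom \<tau> = UNIV \<or> tdom \<tau> = {0..}"
    and legpos: "\<alpha> \<noteq> -\<infinity> \<Longrightarrow> legendre \<tau> \<alpha> > -\<infinity> \<Longrightarrow> legendre \<tau> \<alpha> \<ge> 0"
    and D: "right_deriv \<tau> 1 \<le> D" "D \<le> left_deriv \<tau> 1"
begin

definition t :: "real \<Rightarrow> real" where "t q = real_of_ereal (\<tau> q)"

text \<open>The box dimension of the support to be built, and an upper bound for all values of the
  transform.\<close>

definition T :: real where "T = - t 0"

lemma nonneg_dom: "0 \<le> q \<Longrightarrow> q \<in> tdom \<tau>" using dom by (elim disjE) simp_all

lemma \<tau>_eq: "q \<in> tdom \<tau> \<Longrightarrow> \<tau> q = ereal (t q)"
  using no_pinf[of q] by (cases "\<tau> q") (auto simp: tdom_def t_def)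

lemma \<tau>_out: "q \<notin> tdom \<tau> \<Longrightarrow> \<tau> q = -\<infinity>" by (simp add: tdom_def)

lemma t_1: "t 1 = 0" by (simp add: t_def one)

lemma T_bounds: "0 \<le> T" "T \<le> d"
  using zero \<tau>_eq[of 0] nonneg_dom[of 0] by (auto simp: T_def)

lemma convex_dom: "convex (tdom \<tau>)"
  using dom by (elim disjE) (simp_all add: convex_real_interval)

lemma convex_neg_t: "convex_on (tdom \<tau>) (\<lambda>q. - t q)"
proof (rule convex_onI)
  fix s x y :: real
  assume s: "0 < s" "s < 1" and xy: "x \<in> tdom \<tau>" "y \<in> tdom \<tau>"
  have in_dom: "(1 - s) * x + s * y \<in> tdom \<tau>"
    using convexD[OF convex_dom xy, of "1 - s" s] s by simp
  have "0 < 1 - s \<and> 1 - s < 1" using s by simp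
  then have "ereal (1 - s) * \<tau> x + ereal (1 - (1 - s)) * \<tau> y \<le> \<tau> ((1 - s) * x + (1 - (1 - s)) * y)"
    using conc unfolding concave_ext_def by blast
  then show "- t ((1 - s) *\<^sub>R x + s *\<^sub>R y) \<le> (1 - s) * - t x + s * - t y"
    using \<tau>_eq[OF xy(1)] \<tau>_eq[OF xy(2)] \<tau>_eq[OF in_dom] by simp
qed (rule convex_dom)

lemma supporting_slope:
  assumes "q \<in> interior (tdom \<tau>)"
  obtains a where "\<And>q'. q' \<in> tdom \<tau> \<Longrightarrow> t q' \<le> t q + a * (q' - q)"
proof -
  \<comment> \<open>The infimum of the difference quotients to the right of \<open>q\<close>: for
    the convex function \<open>- t\<close> this is its right derivative.\<close>
  define s where "s = Inf ((\<lambda>y. (- t q - - t y) / (q - y)) ` ({q<..} \<inter> tdom \<tau>))"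
  show ?thesis
  proof (rule that[of "- s"])
    fix q' assume "q' \<in> tdom \<tau>"
    from convex_le_Inf_differential[OF convex_neg_t assms this]
    have "- t q' \<ge> - t q + s * (q' - q)" by (simp add: s_def)
    then show "t q' \<le> t q + - s * (q' - q)" by simp
  qed
qed

lemma legendre_le: "q \<in> tdom \<tau> \<Longrightarrow> legendre \<tau> (ereal a) \<le> ereal (a * q - t q)"
  unfolding legendre_def by (rule INF_lower2[of q]) (auto simp: \<tau>_eq)

lemma legendre_le_T: "legendre \<tau> \<alpha> \<le> ereal T"
  unfolding legendre_def using nonneg_dom[of 0] \<tau>_eq[of 0]
  by (intro INF_lower2[of 0]) (auto simp: T_def zero_ereal_def[symmetric])

text \<open>Equality case of the Fenchel-Young inequality: an affine function of slope
  \<open>a\<close> supporting \<tau> at \<open>q\<close> makes \<open>q\<close> a minimizer.\<close>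

lemma legendre_slope:
  assumes q: "q \<in> tdom \<tau>" and a: "\<And>q'. q' \<in> tdom \<tau> \<Longrightarrow> t q' \<le> t q + a * (q' - q)"
  shows "legendre \<tau> (ereal a) = ereal (a * q - t q)"
proof (rule antisym[OF legendre_le[OF q]])
  show "ereal (a * q - t q) \<le> legendre \<tau> (ereal a)"
    unfolding legendre_def
  proof (rule INF_greatest)
    fix q' assume "q' \<in> (if ereal a = \<infinity> then tdom \<tau> \<inter> {..0} else tdom \<tau>)"
    then have q': "q' \<in> tdom \<tau>" by simp
    show "ereal (a * q - t q) \<le> ereal a * ereal q' - \<tau> q'"
      using a[OF q'] \<tau>_eq[OF q'] by (simp add: algebra_simps)
  qed
qed

text \<open>Testing the infimum at \<open>q = 0\<close> gives \<open>r\<close> \<le>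
  \<open>T\<close>; testing it at \<open>q = 1\<close>, where \<tau> vanishes, gives
  \<open>r\<close> \<le> \<open>a\<close>.\<close>

lemma legendre_real_bounds:
  assumes "0 \<le> legendre \<tau> (ereal a)"
  obtains r where "legendre \<tau> (ereal a) = ereal r" "0 \<le> r" "r \<le> T" "r \<le> a"
proof -
  have "legendre \<tau> (ereal a) \<le> ereal (a * 1 - t 1)" by (rule legendre_le) (simp add: nonneg_dom)
  then show ?thesis
    using assms legendre_le_T[of "ereal a"] that
    by (cases "legendre \<tau> (ereal a)") (auto simp: t_1)
qed

lemma legendre_infinity: "tdom \<tau> = {0..} \<Longrightarrow> legendre \<tau> \<infinity> = ereal T"
proof -
  assume dm: "tdom \<tau> = {0..}"
  then have "tdom \<tau> \<inter> {..0} = {0}" by auto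
  then show ?thesis using \<tau>_eq[of 0] dm by (simp add: legendre_def T_def zero_ereal_def[symmetric])
qed

lemma legendre_infinity_UNIV:
  assumes "tdom \<tau> = UNIV"
  shows "legendre \<tau> \<infinity> = -\<infinity>"
proof -
  have "legendre \<tau> \<infinity> \<le> \<infinity> * ereal (- 1) - \<tau> (- 1)"
    unfolding legendre_def using assms by (intro INF_lower) auto
  also have "\<dots> = -\<infinity>" using \<tau>_eq[of "-1"] assms by simp
  finally show ?thesis by simp
qed

text \<open>Concavity makes the difference quotients from 1 monotone, so they converge to the
  one-sided derivatives and the bounds on \<open>D\<close> extend from small steps to the whole
  domain.\<close>

lemma slope_1: "q \<in> tdom \<tau> \<Longrightarrow> t q \<le> D * (q - 1)"
proof -
  have int1: "1 \<in> interior (tdom \<tau>)"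
  proof (rule interiorI[of "{0<..}"])
    show "{0<..} \<subseteq> tdom \<tau>" using nonneg_dom by (auto intro: less_imp_le)
  qed auto
  \<comment> \<open>Some supporting slope at 1 is needed beforehand, as the bound on the quotients
    required by \<open>tendsto_slope_right\<close>.\<close>
  obtain a where a: "\<And>q'. q' \<in> tdom \<tau> \<Longrightarrow> t q' \<le> a * (q' - 1)"
    using supporting_slope[OF int1] t_1 by auto
  \<comment> \<open>Concavity with denominators cleared, including the cases where \<open>z\<close>
    is an endpoint.\<close>
  have mid: "(y - x) * t z \<ge> (y - z) * t x + (z - x) * t y"
    if "x \<in> tdom \<tau>" "y \<in> tdom \<tau>" "x \<le> z" "z \<le> y" "x < y" for x y z
  proof -
    define s where "s = (z - x) / (y - x)"
    have s: "0 \<le> s" "s \<le> 1" using that by (auto simp: s_def)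
    have "s * (y - x) = z - x" using that by (simp add: s_def)
    then have z: "(1 - s) *\<^sub>R x + s *\<^sub>R y = z" by (simp add: algebra_simps)
    have "- t z \<le> (1 - s) * - t x + s * - t y"
      using convex_onD[OF convex_neg_t s that(1,2)] unfolding z by simp
    then have "(y - x) * ((1 - s) * t x + s * t y) \<le> (y - x) * t z"
      using that by (intro mult_left_mono) auto
    moreover have "(y - x) * ((1 - s) * t x + s * t y) = (y - z) * t x + (z - x) * t y"
    proof -
      have "(y - x) * s = z - x" using that by (simp add: s_def)
      then have "(y - x) * (1 - s) = y - z" by (simp add: algebra_simps)
      then show ?thesis using \<open>(y - x) * s = z - x\<close> by (simp add: distrib_left mult.assoc[symmetric])
    qed
    ultimately show ?thesis by simp
  qed
  show "t q \<le> D * (q - 1)" if q: "q \<in> tdom \<tau>"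
  proof -
    consider "q = 1" | "1 < q" | "q < 1" by linarith
    then show ?thesis
    proof cases
      case 1
      then show ?thesis by (simp add: t_1)
    next
      case 2
      define g where "g h = t (1 + h) / h" for h
      have dm: "1 + h \<in> tdom \<tau>" if "0 < h" for h using that by (intro nonneg_dom) simp
      have anti: "g h' \<le> g h" if "0 < h" "h \<le> h'" for h h'
        using mid[of 1 "1 + h'" "1 + h"] that dm[of h'] nonneg_dom[of 1]
        by (simp add: g_def t_1 field_simps)
      have "g h \<le> a" if "0 < h" for h using a[OF dm[OF that]] that by (simp add: g_def field_simps)
      then obtain s where s: "(g \<longlongrightarrow> s) (at_right 0)" "\<And>h. 0 < h \<Longrightarrow> h \<le> 1 \<Longrightarrow> g h \<le> s"
        using tendsto_slope_right[of g a] anti by blast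
      have "right_deriv \<tau> 1 = s"
        unfolding right_deriv_def using s(1)
        by (intro tendsto_Lim) (simp_all add: g_def[abs_def] t_def one)
      then have sD: "s \<le> D" using D by simp
      define h where "h = min 1 (q - 1)"
      have h: "0 < h" "h \<le> 1" "h \<le> q - 1" using 2 by (auto simp: h_def)
      have "g (q - 1) \<le> g h" using h by (intro anti) auto
      also have "\<dots> \<le> D" using s(2)[OF h(1,2)] sD by simp
      finally show ?thesis using 2 by (simp add: g_def field_simps)
    next
      case 3
      \<comment> \<open>The quotient is reflected, so that the limit from the right applies again;
        the left derivative is minus its limit.\<close>
      define g where "g h = t (1 - h) / h" for h
      have dm: "1 - h \<in> tdom \<tau>" if "h \<le> 1" for h using that by (intro nonneg_dom) simp
      have anti: "g h' \<le> g h" if "0 < h" "h \<le> h'" "1 - h' \<in> tdom \<tau>" for h h'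
        using mid[of "1 - h'" 1 "1 - h"] that nonneg_dom[of 1]
        by (simp add: g_def t_1 field_simps)
      have "g h \<le> - a" if "0 < h" "h \<le> 1" for h using a[OF dm[OF that(2)]] that by (simp add: g_def field_simps)
      then obtain s where s: "(g \<longlongrightarrow> s) (at_right 0)" "\<And>h. 0 < h \<Longrightarrow> h \<le> 1 \<Longrightarrow> g h \<le> s"
        using tendsto_slope_right[of g "- a"] anti dm by blast
      have "((\<lambda>h. - g (- h)) \<longlongrightarrow> - s) (at_left 0)"
        using s(1) by (intro tendsto_minus) (simp add: filterlim_at_left_to_right)
      then have "((\<lambda>h. (real_of_ereal (\<tau> (1 + h)) - real_of_ereal (\<tau> 1)) / h) \<longlongrightarrow> - s) (at_left 0)"
        by (simp add: g_def t_def one)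
      then have "left_deriv \<tau> 1 = - s"
        unfolding left_deriv_def by (intro tendsto_Lim) simp_all
      then have sD: "s \<le> - D" using D by simp
      define h where "h = min 1 (1 - q)"
      have h: "0 < h" "h \<le> 1" "h \<le> 1 - q" using 3 by (auto simp: h_def)
      have "g (1 - q) \<le> g h" using h q by (intro anti) auto
      also have "\<dots> \<le> - D" using s(2)[OF h(1,2)] sD by simp
      finally show ?thesis using 3 by (simp add: g_def field_simps)
    qed
  qed
qed

text \<open>The tangent of slope \<open>D\<close> touches \<tau> at 1, where \<tau> vanishes. A type
  whose dimension equals its exponent has as many digits as the inverse of their probability, so it
  can carry the whole mass.\<close>

lemma legendre_D: "legendre \<tau> (ereal D) = ereal D"
  using legendre_slope[of 1 D] slope_1 nonneg_dom[of 1] by (simp add: t_1)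

lemma legendre_slope_nonneg:
  assumes "q \<in> tdom \<tau>" and "\<And>q'. q' \<in> tdom \<tau> \<Longrightarrow> t q' \<le> t q + a * (q' - q)"
  shows "0 \<le> legendre \<tau> (ereal a)"
  by (rule legpos) (simp_all add: legendre_slope[OF assms])

lemma D_bounds: "0 \<le> D" "D \<le> T"
proof -
  have "0 \<le> legendre \<tau> (ereal D)" by (rule legpos) (simp_all add: legendre_D)
  then show "0 \<le> D" by (simp add: legendre_D)
  show "D \<le> T" using legendre_le_T[of "ereal D"] by (simp add: legendre_D)
qed

definition admissible :: "real set" where
  "admissible = {a. 0 \<le> legendre \<tau> (ereal a)}"

definition dim_at :: "real \<Rightarrow> real" where
  "dim_at a = real_of_ereal (legendre \<tau> (ereal a))"

lemma dim_at:
  assumes "a \<in> admissible"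
  shows "legendre \<tau> (ereal a) = ereal (dim_at a)" "0 \<le> dim_at a" "dim_at a \<le> T" "dim_at a \<le> a"
proof -
  have "0 \<le> legendre \<tau> (ereal a)" using assms by (simp add: admissible_def)
  then obtain r where r: "legendre \<tau> (ereal a) = ereal r" "0 \<le> r" "r \<le> T" "r \<le> a"
    by (rule legendre_real_bounds)
  then have "dim_at a = r" by (simp add: dim_at_def)
  then show "legendre \<tau> (ereal a) = ereal (dim_at a)" "0 \<le> dim_at a" "dim_at a \<le> T" "dim_at a \<le> a"
    using r by simp_all
qed

lemma dim_at_le: "a \<in> admissible \<Longrightarrow> q \<in> tdom \<tau> \<Longrightarrow> dim_at a - q * a \<le> - t q"
  using legendre_le[of q a] dim_at(1)[of a] by (simp add: mult.commute)

lemma D_admissible: "D \<in> admissible" "dim_at D = D"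
  using D_bounds by (auto simp: admissible_def legendre_D dim_at_def)

text \<open>A near-maximizer of \<open>dim_at\<close> in an interval of length \<open>1 / K\<close>
  represents all admissible exponents there. The one-sided comparison of dimensions is enough, since
  any admissible exponent obeys \<open>dim_at_le\<close>. An interval without admissible exponents
  gets the default \<open>D\<close>.\<close>

lemma exists_rep:
  fixes K :: real
  assumes "0 < K"
  shows "\<exists>b\<in>admissible. \<forall>a\<in>admissible. i \<le> a * K \<and> a * K < i + 1 \<longrightarrow> \<bar>b - a\<bar> \<le> 1 / K \<and> dim_at a - 1 / K \<le> dim_at b"
proof (cases "\<exists>a\<in>admissible. i \<le> a * K \<and> a * K < i + 1")
  case True
  define B where "B = {a \<in> admissible. i \<le> a * K \<and> a * K < i + 1}"
  have ne: "dim_at ` B \<noteq> {}" using True by (auto simp: B_def)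
  have bdd: "bdd_above (dim_at ` B)" using dim_at(3) by (auto simp: B_def intro!: bdd_aboveI[of _ T])
  have "Sup (dim_at ` B) - 1 / K < Sup (dim_at ` B)" using assms by simp
  then obtain b where b: "b \<in> B" "Sup (dim_at ` B) - 1 / K < dim_at b"
    using less_cSup_iff[OF ne bdd] by blast
  show ?thesis
  proof (intro bexI[of _ b] ballI impI conjI)
    fix a assume a: "a \<in> admissible" "i \<le> a * K \<and> a * K < i + 1"
    then have "a \<in> B" by (simp add: B_def)
    then have "dim_at a \<le> Sup (dim_at ` B)" using bdd by (intro cSup_upper) auto
    then show "dim_at a - 1 / K \<le> dim_at b" using b by simp
    have "\<bar>b - a\<bar> * K = \<bar>b * K - a * K\<bar>" using assms by (simp add: abs_mult left_diff_distrib[symmetric])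
    also have "\<dots> \<le> 1" using a b by (auto simp: B_def)
    finally show "\<bar>b - a\<bar> \<le> 1 / K" using assms by (simp add: field_simps)
  qed (use b in \<open>simp add: B_def\<close>)
next
  case False
  then show ?thesis using D_admissible by blast
qed

text \<open>The exponent carrying the full box dimension \<open>T\<close>: a slope of \<open>\<tau>\<close> at 0, or one tending to
  infinity with the generation if no such slope exists.\<close>

lemma exists_full:
  obtains z where "\<And>k. T \<le> z k"
    and "tdom \<tau> = UNIV \<Longrightarrow> (\<forall>k q. T - q * z k \<le> - t q)"
    and "tdom \<tau> = {0..} \<Longrightarrow> \<forall>k. z k = real k + d"
proof (cases "tdom \<tau> = UNIV")
  case True
  then have "0 \<in> interior (tdom \<tau>)" by simp
  then obtain a where a: "\<And>q'. q' \<in> tdom \<tau> \<Longrightarrow> t q' \<le> t 0 + a * (q' - 0)" by (rule supporting_slope) blast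
  then have "T - q * a \<le> - t q" for q using a[of q] True by (simp add: T_def mult.commute)
  moreover from this[of 1] have "T \<le> a" by (simp add: t_1)
  moreover have "tdom \<tau> \<noteq> {0..}" using True by (metis UNIV_I atLeast_iff neg_0_le_iff_le not_one_le_zero)
  ultimately show ?thesis by (intro that[of "\<lambda>_. a"]) auto
next
  case False
  then show ?thesis using T_bounds by (intro that[of "\<lambda>k. real k + d"]) auto
qed

end

lemma sum_UN_le:
  fixes f :: "'b \<Rightarrow> real"
  assumes "finite I" "\<And>i. i \<in> I \<Longrightarrow> finite (A i)" "\<And>x. 0 \<le> f x"
  shows "sum f (\<Union>i\<in>I. A i) \<le> (\<Sum>i\<in>I. sum f (A i))"
  using assms(1,2)
proof (induction I rule: finite_induct)
  case (insert i I)
  have "sum f (A i \<union> (\<Union>i\<in>I. A i)) + sum f (A i \<inter> (\<Union>i\<in>I. A i)) = sum f (A i) + sum f (\<Union>i\<in>I. A i)"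
    using insert by (intro sum.union_inter) auto
  moreover have "0 \<le> sum f (A i \<inter> (\<Union>i\<in>I. A i))" using assms(3) by (rule sum_nonneg)
  moreover have "sum f (\<Union>i\<in>I. A i) \<le> (\<Sum>i\<in>I. sum f (A i))" using insert by simp
  ultimately show ?case using insert.hyps by simp
qed simp

subsection \<open>Realization of a prescribed spectrum\<close>

text \<open>The lengths grow polynomially, so that a generation is negligible against all previous ones, and
  the slack is negligible against the length but exponentially dominates the number of types.\<close>

definition block_nominal :: "nat \<Rightarrow> real" where
  "block_nominal k = (real k + 1)\<^sup>2"

text \<open>Given at most \<open>exp (k + 5) / 4\<close> types, this value dominates their number as
  \<open>exists_block\<close> requires, and \<open>2 * block_types k * exp (- block_slack k)\<close>
  is at most \<open>exp (- k)\<close>, hence summable.\<close>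

definition block_slack :: "nat \<Rightarrow> real" where
  "block_slack k = 2 * real k + 5"

definition block_len :: "nat \<Rightarrow> real" where
  "block_len k = block_nominal k + block_slack k + 3"

text \<open>Two special types, and one for each of the \<open>(k + 1)\<^sup>2\<close> intervals of
  length \<open>1 / (k + 1)\<close> that fill \<open>[0, k + 1)\<close>.\<close>

definition block_types :: "nat \<Rightarrow> nat" where
  "block_types k = (k + 1)\<^sup>2 + 2"

lemma block_types_le: "4 * real (block_types k) \<le> exp (real k + 5)"
proof -
  have "4 * real (block_types k) = 4 * (real k)\<^sup>2 + 8 * real k + 12"
    by (simp add: block_types_def power2_eq_square algebra_simps)
  also have "\<dots> \<le> 18 * (1 + real k + (real k)\<^sup>2 / 2)" by simp
  \<comment> \<open>The quadratic Taylor bound gives \<open>exp 5\<close> \<ge> 1 + 5 + 25/2, which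
    exceeds 18.\<close>
  also have "\<dots> \<le> exp 5 * exp (real k)"
    using exp_lower_Taylor_quadratic[of "5::real"] exp_lower_Taylor_quadratic[of "real k"]
    by (intro mult_mono) auto
  finally show ?thesis by (simp add: exp_add mult.commute)
qed

lemma block_len_pos: "0 < block_len k"
  using zero_le_power2[of "real k + 1"] of_nat_0_le_iff[of k]
  unfolding block_len_def block_nominal_def block_slack_def by linarith

lemma error_ratio:
  assumes "0 \<le> c"
  shows "(\<lambda>k. (2 * block_slack k + c) / block_len k) \<longlonglongrightarrow> 0"
proof (rule tendsto_sandwich[OF _ _ tendsto_const])
  have "(\<lambda>k. (10 + c) * inverse (real (Suc k))) \<longlonglongrightarrow> (10 + c) * 0"
    by (intro tendsto_mult tendsto_const LIMSEQ_inverse_real_of_nat)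
  then show "(\<lambda>k. (10 + c) * inverse (real (Suc k))) \<longlonglongrightarrow> 0" by simp
  show "\<forall>\<^sub>F k in sequentially. 0 \<le> (2 * block_slack k + c) / block_len k"
    using assms block_len_pos by (intro always_eventually allI divide_nonneg_pos) (auto simp: block_slack_def)
  show "\<forall>\<^sub>F k in sequentially. (2 * block_slack k + c) / block_len k \<le> (10 + c) * inverse (real (Suc k))"
  proof (intro always_eventually allI)
    fix k
    have "(2 * block_slack k + c) * real (Suc k) \<le> (10 + c) * (real k + 1) * (real k + 1)"
      using assms by (simp add: block_slack_def algebra_simps)
    also have "\<dots> \<le> (10 + c) * block_len k"
      using assms by (simp add: block_len_def block_nominal_def block_slack_def power2_eq_square mult.assoc)
    finally show "(2 * block_slack k + c) / block_len k \<le> (10 + c) * inverse (real (Suc k))"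
      using block_len_pos[of k] by (simp add: field_simps)
  qed
qed

lemma nominal_ratio: "(\<lambda>k. block_nominal k / block_len k) \<longlonglongrightarrow> 1"
proof -
  \<comment> \<open>With \<open>c = 6\<close>, half of the numerator is
    \<open>block_slack k + 3\<close>, the difference of \<open>block_len k\<close> and
    \<open>block_nominal k\<close>.\<close>
  have "(\<lambda>k. 1 - (2 * block_slack k + 6) / block_len k * (1/2)) \<longlonglongrightarrow> 1 - 0 * (1/2)"
    by (intro tendsto_intros error_ratio) simp
  moreover have "1 - (2 * block_slack k + 6) / block_len k * (1/2) = block_nominal k / block_len k" for k
  proof -
    have "block_nominal k = block_len k - (2 * block_slack k + 6) * (1/2)" by (simp add: block_len_def field_simps)
    then show ?thesis using block_len_pos[of k] by (simp add: diff_divide_distrib)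
  qed
  ultimately show ?thesis by simp
qed

lemma sum_block_len_ge: "real j ^ 3 / 3 \<le> (\<Sum>k<j. block_len k)"
proof (induction j)
  case (Suc j)
  have "real (Suc j) ^ 3 / 3 = real j ^ 3 / 3 + (real j)\<^sup>2 + real j + 1/3"
    by (simp add: power3_eq_cube power2_eq_square algebra_simps)
  also have "\<dots> \<le> (\<Sum>k<j. block_len k) + block_len j"
    using Suc.IH by (simp add: block_len_def block_nominal_def block_slack_def power2_eq_square algebra_simps)
  finally show ?case by simp
qed simp

text \<open>A length is at most \<open>14 * j\<^sup>2\<close> (14 = 1 + 4 + 9) while the preceding
  lengths sum to at least \<open>j ^ 3 / 3\<close>; this gives the constant 42.\<close>

lemma block_len_small: "(\<lambda>j. block_len j / (\<Sum>k<j. block_len k)) \<longlonglongrightarrow> 0"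
proof (rule tendsto_sandwich[OF _ _ tendsto_const])
  show "(\<lambda>j. 42 / real j) \<longlonglongrightarrow> 0" by (rule lim_const_over_n)
  show "\<forall>\<^sub>F j in sequentially. 0 \<le> block_len j / (\<Sum>k<j. block_len k)"
    using block_len_pos by (intro always_eventually allI divide_nonneg_nonneg sum_nonneg) (auto intro: less_imp_le)
  show "\<forall>\<^sub>F j in sequentially. block_len j / (\<Sum>k<j. block_len k) \<le> 42 / real j"
    using eventually_gt_at_top[of "0::nat"]
  proof eventually_elim
    case (elim j)
    have j1: "1 \<le> real j" using elim by simp
    have "real j * 1 \<le> real j * real j" using j1 by (intro mult_left_mono) auto
    moreover have "block_len j = real j * real j + 4 * real j + 9"
      by (simp add: block_len_def block_nominal_def block_slack_def power2_eq_square algebra_simps)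
    ultimately have "block_len j \<le> 14 * (real j * real j)" using j1 by linarith
    then have "block_len j \<le> 14 * (real j)\<^sup>2" by (simp add: power2_eq_square)
    moreover have "0 < real j ^ 3 / 3" using elim by simp
    ultimately have "block_len j / (\<Sum>k<j. block_len k) \<le> 14 * (real j)\<^sup>2 / (real j ^ 3 / 3)"
      using sum_block_len_ge[of j] by (intro frac_le) auto
    also have "\<dots> = 42 / real j" using elim by (simp add: power2_eq_square power3_eq_cube)
    finally show ?case .
  qed
qed

section \<open>Finitely many types approximating the graph of the transform\<close>

context spectrum
begin

definition rep :: "nat \<Rightarrow> nat \<Rightarrow> real" where
  "rep k i = (SOME b. b \<in> admissible \<and> (\<forall>a\<in>admissible. real i \<le> a * (real k + 1) \<and> a * (real k + 1) < real i + 1 \<longrightarrow>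
     \<bar>b - a\<bar> \<le> 1 / (real k + 1) \<and> dim_at a - 1 / (real k + 1) \<le> dim_at b))"

lemma rep: "rep k i \<in> admissible"
  "a \<in> admissible \<Longrightarrow> real i \<le> a * (real k + 1) \<Longrightarrow> a * (real k + 1) < real i + 1 \<Longrightarrow>
     \<bar>rep k i - a\<bar> \<le> 1 / (real k + 1) \<and> dim_at a - 1 / (real k + 1) \<le> dim_at (rep k i)"
proof -
  have "\<exists>b. b \<in> admissible \<and> (\<forall>a\<in>admissible. real i \<le> a * (real k + 1) \<and> a * (real k + 1) < real i + 1 \<longrightarrow>
     \<bar>b - a\<bar> \<le> 1 / (real k + 1) \<and> dim_at a - 1 / (real k + 1) \<le> dim_at b)"
    using exists_rep[of "real k + 1" "real i"] by auto
  from someI_ex[OF this] show "rep k i \<in> admissible"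
    "a \<in> admissible \<Longrightarrow> real i \<le> a * (real k + 1) \<Longrightarrow> a * (real k + 1) < real i + 1 \<Longrightarrow>
     \<bar>rep k i - a\<bar> \<le> 1 / (real k + 1) \<and> dim_at a - 1 / (real k + 1) \<le> dim_at (rep k i)"
    unfolding rep_def by auto
qed

text \<open>Type 0 carries most of the mass, type 1 contains most of the digits, and type \<open>i + 2\<close> represents
  the admissible exponents in \<open>[i / (k + 1), (i + 1) / (k + 1))\<close>.\<close>

definition type_exponent :: "(nat \<Rightarrow> real) \<Rightarrow> nat \<Rightarrow> nat \<Rightarrow> real" where
  "type_exponent z k i = (if i = 0 then D else if i = 1 then z k else rep k (i - 2))"

definition type_dim :: "nat \<Rightarrow> nat \<Rightarrow> real" where
  "type_dim k i = (if i = 0 then D else if i = 1 then T else dim_at (rep k (i - 2)))"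

end

section \<open>Moment sums and digit families of the blocks\<close>

locale spectrum_blocks = spectrum \<tau> D d for \<tau> :: "real \<Rightarrow> ereal" and D :: real and d :: nat +
  fixes z :: "nat \<Rightarrow> real" and n :: "nat \<Rightarrow> nat" and p :: "nat \<Rightarrow> ('a::euclidean_space \<Rightarrow> nat) pmf"
    and F :: "nat \<Rightarrow> nat \<Rightarrow> ('a \<Rightarrow> nat) set"
  assumes z_UNIV: "tdom \<tau> = UNIV \<Longrightarrow> T - q * z k \<le> - t q"
    and z_half: "tdom \<tau> = {0..} \<Longrightarrow> z k = real k + d"
    and block: "block d (block_nominal k) (block_slack k) (block_types k) (type_dim k) (type_exponent z k) (n k) (p k) (F k)"
begin

lemma n_pos: "0 < n k"
  and n_le: "4 * real (n k) \<le> exp (block_len k)"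
  and set_pmf_p: "set_pmf (p k) = (Basis \<rightarrow>\<^sub>E {..<n k})"
  and F_union: "(\<Union>i<block_types k. F k i) = set_pmf (p k)"
  and mass_0: "1 - 2 * real (block_types k) * exp (- block_slack k) \<le> measure (measure_pmf (p k)) (F k 0)"
  using block[of k] by (simp_all add: block_def block_len_def)

abbreviation err :: "nat \<Rightarrow> real" where "err k \<equiv> 2 * block_slack k + d"

lemma
  assumes "i < block_types k"
  shows card_ge: "exp (block_nominal k * type_dim k i) \<le> real (card (F k i))"
    and card_le: "real (card (F k i)) \<le> exp (block_nominal k * type_dim k i + err k)"
    and pmf_ge: "a \<in> F k i \<Longrightarrow> exp (- (block_nominal k * type_exponent z k i) - err k) \<le> pmf (p k) a"
    and pmf_le: "a \<in> F k i \<Longrightarrow> pmf (p k) a \<le> exp (- (block_nominal k * type_exponent z k i) + err k)"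
  using block[of k] assms by (simp_all add: block_def)

lemma grid_code_n: "grid_code n block_len"
  by unfold_locales (use n_pos n_le block_len_small in auto)

sublocale grid_measure n block_len p
proof -
  interpret grid_code n block_len by (rule grid_code_n)
  show "grid_measure n block_len p"
    by unfold_locales (simp add: digits_def set_pmf_p)
qed

lemma err_ratio: "(\<lambda>k. err k / block_len k) \<longlonglongrightarrow> 0"
  by (rule error_ratio) simp

lemma nominal_nonneg: "0 \<le> block_nominal k" by (simp add: block_nominal_def)

lemma F_digits: "i < block_types k \<Longrightarrow> F k i \<subseteq> digits k"
  using F_union[of k] set_p[of k] by blast

lemma F_nonempty:
  assumes "i < block_types k"
  shows "F k i \<noteq> {}"
proof
  assume "F k i = {}"
  then have "exp (block_nominal k * type_dim k i) \<le> 0" using card_ge[OF assms] by simp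
  then show False by simp
qed

lemma finite_F: "i < block_types k \<Longrightarrow> finite (F k i)"
  by (rule finite_subset[OF F_digits]) simp_all

lemma ln_pmf_bounds:
  assumes "i < block_types k" "a \<in> F k i"
  shows "\<bar>- ln (pmf (p k) a) - block_nominal k * type_exponent z k i\<bar> \<le> err k"
proof -
  have pos: "0 < pmf (p k) a" using F_digits assms by (intro pmf_digit_pos) auto
  have "- (block_nominal k * type_exponent z k i) - err k \<le> ln (pmf (p k) a)"
    using pmf_ge[OF assms] by (simp add: ln_ge_iff[OF pos])
  moreover have "ln (pmf (p k) a) \<le> ln (exp (- (block_nominal k * type_exponent z k i) + err k))"
    using pmf_le[OF assms] pos by (subst ln_le_cancel_iff) auto
  ultimately show ?thesis unfolding ln_exp by linarith
qed

lemma ln_card_ge: "i < block_types k \<Longrightarrow> block_nominal k * type_dim k i \<le> ln (card (F k i))"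
  proof -
  assume i: "i < block_types k"
  have "0 < real (card (F k i))" by (rule less_le_trans[OF exp_gt_zero card_ge[OF i]])
  then show ?thesis using card_ge[OF i] by (simp add: ln_ge_iff)
qed

text \<open>A strict gap between two rates absorbs the passage between nominal and full length
  together with any fixed multiple of the error.\<close>

lemma eventually_nominal:
  assumes "c < c'"
  shows "\<forall>\<^sub>F k in sequentially. c * block_len k \<le> c' * block_nominal k - m * err k"
    and "\<forall>\<^sub>F k in sequentially. c * block_nominal k + m * err k \<le> c' * block_len k"
proof -
  have "(\<lambda>k. c' * (block_nominal k / block_len k) - m * (err k / block_len k)) \<longlonglongrightarrow> c' * 1 - m * 0"
    by (intro tendsto_intros nominal_ratio err_ratio)
  then have "\<forall>\<^sub>F k in sequentially. c < c' * (block_nominal k / block_len k) - m * (err k / block_len k)"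
    using assms by (intro order_tendstoD(1)) auto
  then show "\<forall>\<^sub>F k in sequentially. c * block_len k \<le> c' * block_nominal k - m * err k"
  proof eventually_elim
    case (elim k)
    then have "c * block_len k \<le> (c' * (block_nominal k / block_len k) - m * (err k / block_len k)) * block_len k"
      using block_len_pos[of k] by (intro mult_right_mono) auto
    then show ?case using block_len_pos[of k] by (simp add: left_diff_distrib)
  qed
  have "(\<lambda>k. c * (block_nominal k / block_len k) + m * (err k / block_len k)) \<longlonglongrightarrow> c * 1 + m * 0"
    by (intro tendsto_intros nominal_ratio err_ratio)
  then have "\<forall>\<^sub>F k in sequentially. c * (block_nominal k / block_len k) + m * (err k / block_len k) < c'"
    using assms by (intro order_tendstoD(2)) auto
  then show "\<forall>\<^sub>F k in sequentially. c * block_nominal k + m * err k \<le> c' * block_len k"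
  proof eventually_elim
    case (elim k)
    then have "(c * (block_nominal k / block_len k) + m * (err k / block_len k)) * block_len k \<le> c' * block_len k"
      using block_len_pos[of k] by (intro mult_right_mono) auto
    then show ?case using block_len_pos[of k] by (simp add: distrib_right)
  qed
qed

text \<open>The exponent of a digit differs from that of its type by a factor
  \<open>block_nominal k / block_len k\<close>, which tends to 1, and by at most
  \<open>err k / block_len k\<close>, which tends to 0.\<close>

lemma type_limit:
  assumes i: "\<And>k. i k < block_types k" and a: "\<And>k. a k \<in> F k (i k)"
    and lim: "(\<lambda>k. ereal (type_exponent z k (i k))) \<longlonglongrightarrow> \<alpha>"
  shows "(\<lambda>k. ereal (- ln (pmf (p k) (a k)) / block_len k)) \<longlonglongrightarrow> \<alpha>"
proof -
  have conv: "(\<lambda>k. ereal (type_exponent z k (i k)) * ereal (block_nominal k / block_len k) + ereal (s * (err k / block_len k)))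
     \<longlonglongrightarrow> \<alpha> * ereal 1 + ereal (s * 0)" for s
  proof (rule tendsto_add_ereal_general1)
    show "(\<lambda>k. ereal (type_exponent z k (i k)) * ereal (block_nominal k / block_len k)) \<longlonglongrightarrow> \<alpha> * ereal 1"
    proof (rule tendsto_mult_ereal[OF lim])
      show "(\<lambda>k. ereal (block_nominal k / block_len k)) \<longlonglongrightarrow> ereal 1"
        using nominal_ratio by (simp only: lim_ereal)
    qed auto
    have "(\<lambda>k. s * (err k / block_len k)) \<longlonglongrightarrow> s * 0" by (intro tendsto_intros err_ratio)
    then show "(\<lambda>k. ereal (s * (err k / block_len k))) \<longlonglongrightarrow> ereal (s * 0)" by (simp only: lim_ereal)
  qed simp
  have b: "- ln (pmf (p k) (a k)) / block_len k \<le> type_exponent z k (i k) * (block_nominal k / block_len k) + 1 * (err k / block_len k)"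
    "type_exponent z k (i k) * (block_nominal k / block_len k) + (- 1) * (err k / block_len k) \<le> - ln (pmf (p k) (a k)) / block_len k" for k
  proof -
    have eq: "x * (block_nominal k / block_len k) + s * (err k / block_len k) = (block_nominal k * x + s * err k) / block_len k" for x s
      by (simp only: add_divide_distrib[of "block_nominal k * x"] times_divide_eq_right mult.commute[of x])
    show "- ln (pmf (p k) (a k)) / block_len k \<le> type_exponent z k (i k) * (block_nominal k / block_len k) + 1 * (err k / block_len k)"
      unfolding eq using abs_le_D1[OF ln_pmf_bounds[OF i a, of k]] abs_le_D2[OF ln_pmf_bounds[OF i a, of k]] block_len_pos[of k]
      by (intro divide_right_mono) simp_all
    show "type_exponent z k (i k) * (block_nominal k / block_len k) + (- 1) * (err k / block_len k) \<le> - ln (pmf (p k) (a k)) / block_len k"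
      unfolding eq using abs_le_D1[OF ln_pmf_bounds[OF i a, of k]] abs_le_D2[OF ln_pmf_bounds[OF i a, of k]] block_len_pos[of k]
      by (intro divide_right_mono) simp_all
  qed
  show ?thesis
  proof (rule tendsto_sandwich)
    show "(\<lambda>k. ereal (type_exponent z k (i k)) * ereal (block_nominal k / block_len k) + ereal ((- 1) * (err k / block_len k))) \<longlonglongrightarrow> \<alpha>"
      using conv[of "-1"] by simp
    show "(\<lambda>k. ereal (type_exponent z k (i k)) * ereal (block_nominal k / block_len k) + ereal (1 * (err k / block_len k))) \<longlonglongrightarrow> \<alpha>"
      using conv[of 1] by simp
  qed (use b in \<open>auto intro!: always_eventually\<close>)
qed

text \<open>A real \<alpha> is followed through the types of the shrinking intervals containing it.
  For \<alpha> = \<infinity> nonnegativity of the transform forces the half-line domain, where the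
  exponents of type 1 tend to infinity.\<close>

lemma exists_types:
  assumes \<alpha>: "\<alpha> \<noteq> -\<infinity>" "0 \<le> legendre \<tau> \<alpha>"
  obtains i where "\<And>k. i k < block_types k"
    "(\<lambda>k. ereal (type_exponent z k (i k))) \<longlonglongrightarrow> \<alpha>"
    "\<And>s. ereal s < legendre \<tau> \<alpha> \<Longrightarrow> \<forall>\<^sub>F k in sequentially. s < type_dim k (i k)"
proof (cases \<alpha>)
  case (real a)
  then have a: "a \<in> admissible" using \<alpha> by (simp add: admissible_def)
  have a0: "0 \<le> a" using dim_at(2,4)[OF a] by linarith
  \<comment> \<open>The shift by 2 skips the special types. In early generations the intervals do
    not reach \<open>a\<close> yet, and type 0 is a placeholder.\<close>
  define i where "i k = (if a < real k + 1 then nat \<lfloor>a * (real k + 1)\<rfloor> + 2 else 0)" for k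
  have i: "i k < block_types k" for k
  proof (cases "a < real k + 1")
    case True
    then have "a * (real k + 1) < (real k + 1) * (real k + 1)" by (intro mult_strict_right_mono) auto
    then have "\<lfloor>a * (real k + 1)\<rfloor> < int ((k + 1)\<^sup>2)"
      by (simp add: floor_less_iff power2_eq_square algebra_simps)
    then have "nat \<lfloor>a * (real k + 1)\<rfloor> < (k + 1)\<^sup>2" using a0 by (simp add: nat_less_iff)
    then show ?thesis using True by (simp add: i_def block_types_def)
  qed (simp add: i_def block_types_def)
  have ev: "\<forall>\<^sub>F k in sequentially. \<bar>type_exponent z k (i k) - a\<bar> \<le> 1 / (real k + 1) \<and> dim_at a - 1 / (real k + 1) \<le> type_dim k (i k)"
    using eventually_ge_at_top[of "nat \<lceil>a\<rceil>"]
  proof eventually_elim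
    case (elim k)
    then have "a < real k + 1" by linarith
    moreover have "0 \<le> a * (real k + 1)" using a0 by simp
    ultimately show ?case
      using rep(2)[OF a, of "nat \<lfloor>a * (real k + 1)\<rfloor>" k]
      by (simp add: i_def type_exponent_def type_dim_def)
  qed
  have inv: "(\<lambda>k. 1 / (real k + 1)) \<longlonglongrightarrow> 0"
    using LIMSEQ_inverse_real_of_nat by (simp add: inverse_eq_divide add.commute)
  show ?thesis
  proof (rule that[of i])
    have "(\<lambda>k. type_exponent z k (i k) - a) \<longlonglongrightarrow> 0"
      by (rule Lim_null_comparison[OF _ inv]) (use ev in \<open>auto elim: eventually_mono\<close>)
    then have "(\<lambda>k. type_exponent z k (i k)) \<longlonglongrightarrow> a" by (simp add: LIM_zero_iff)
    then show "(\<lambda>k. ereal (type_exponent z k (i k))) \<longlonglongrightarrow> \<alpha>" using real by simp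
    fix s assume "ereal s < legendre \<tau> \<alpha>"
    then have "s < dim_at a" using dim_at(1)[OF a] real by simp
    then have "\<forall>\<^sub>F k in sequentially. 1 / (real k + 1) < dim_at a - s"
      by (intro order_tendstoD(2)[OF inv]) simp
    with ev show "\<forall>\<^sub>F k in sequentially. s < type_dim k (i k)"
      by eventually_elim linarith
  qed (rule i)
next
  case PInf
  then have "tdom \<tau> = {0..}" using dom legendre_infinity_UNIV \<alpha> by auto
  note half = this
  show ?thesis
  proof (rule that[of "\<lambda>_. 1"])
    have "filterlim (\<lambda>k. real k + d) at_top sequentially"
      by (rule filterlim_at_top_mono[OF filterlim_real_sequentially]) simp
    then have "(\<lambda>k. ereal (real k + d)) \<longlonglongrightarrow> \<infinity>" by (rule tendsto_PInfty_eq_at_top[THEN iffD2])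
    then show "(\<lambda>k. ereal (type_exponent z k 1)) \<longlonglongrightarrow> \<alpha>" using PInf z_half[OF half] by (simp add: type_exponent_def)
    show "\<forall>\<^sub>F k in sequentially. s < type_dim k 1" if "ereal s < legendre \<tau> \<alpha>" for s
      using that legendre_infinity[OF half] PInf by (simp add: type_dim_def)
  qed (simp add: block_types_def)
qed (use \<alpha> in simp)

text \<open>One type alone gives the bound: its cardinality has no error from below, and the error
  in its probabilities is multiplied by \<open>\<bar>q\<bar>\<close> whatever the sign of
  \<open>q\<close>.\<close>

lemma psum_ge_type:
  assumes "i < block_types k"
  shows "block_nominal k * (type_dim k i - q * type_exponent z k i) - \<bar>q\<bar> * err k \<le> ln (psum q k)"
proof -
  have "exp (block_nominal k * type_dim k i) * exp (- q * (block_nominal k * type_exponent z k i) - \<bar>q\<bar> * err k)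
      \<le> real (card (F k i)) * exp (- q * (block_nominal k * type_exponent z k i) - \<bar>q\<bar> * err k)"
    using card_ge[OF assms] by (intro mult_right_mono) auto
  also have "\<dots> = (\<Sum>a\<in>F k i. exp (- q * (block_nominal k * type_exponent z k i) - \<bar>q\<bar> * err k))" by simp
  also have "\<dots> \<le> (\<Sum>a\<in>F k i. pmf (p k) a powr q)"
  proof (rule sum_mono)
    fix a assume a: "a \<in> F k i"
    have pos: "0 < pmf (p k) a" using F_digits assms a by (intro pmf_digit_pos) auto
    let ?x = "- ln (pmf (p k) a) - block_nominal k * type_exponent z k i"
    have "q * ?x \<le> \<bar>q\<bar> * \<bar>?x\<bar>" by (metis abs_ge_self abs_mult)
    also have "\<dots> \<le> \<bar>q\<bar> * err k" using ln_pmf_bounds[OF assms a] by (intro mult_left_mono) auto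
    finally have "- q * (block_nominal k * type_exponent z k i) - \<bar>q\<bar> * err k \<le> q * ln (pmf (p k) a)"
      by (simp add: algebra_simps)
    then show "exp (- q * (block_nominal k * type_exponent z k i) - \<bar>q\<bar> * err k) \<le> pmf (p k) a powr q"
      using pos by (simp add: powr_def)
  qed
  also have "\<dots> \<le> psum q k"
    unfolding psum_def using F_digits[OF assms] by (intro sum_mono2) auto
  finally have "exp (block_nominal k * (type_dim k i - q * type_exponent z k i) - \<bar>q\<bar> * err k) \<le> psum q k"
    unfolding exp_add[symmetric] by (simp add: algebra_simps)
  then show ?thesis by (simp add: ln_ge_iff psum_pos)
qed

text \<open>Laplace's method: the sum is at most the number of types times the largest contribution.
  The error counts once for cardinalities, \<open>\<bar>q\<bar>\<close> times for probabilities and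
  once for the number of types.\<close>

lemma psum_le_types:
  assumes "\<And>i. i < block_types k \<Longrightarrow> type_dim k i - q * type_exponent z k i \<le> m"
  shows "ln (psum q k) \<le> m * block_nominal k + (2 + \<bar>q\<bar>) * err k"
proof -
  have "psum q k \<le> (\<Sum>i<block_types k. \<Sum>a\<in>F k i. pmf (p k) a powr q)"
  proof -
    have "digits k = (\<Union>i<block_types k. F k i)" using F_union set_p by simp
    then show ?thesis unfolding psum_def by (simp only:) (rule sum_UN_le, simp_all add: finite_F)
  qed
  also have "\<dots> \<le> (\<Sum>i<block_types k. exp (m * block_nominal k + (1 + \<bar>q\<bar>) * err k))"
  proof (rule sum_mono)
    fix i assume "i \<in> {..<block_types k}"
    then have i: "i < block_types k" by simp
    have "(\<Sum>a\<in>F k i. pmf (p k) a powr q) \<le> (\<Sum>a\<in>F k i. exp (- q * (block_nominal k * type_exponent z k i) + \<bar>q\<bar> * err k))"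
    proof (rule sum_mono)
      fix a assume a: "a \<in> F k i"
      have pos: "0 < pmf (p k) a" using F_digits i a by (intro pmf_digit_pos) auto
      let ?x = "- ln (pmf (p k) a) - block_nominal k * type_exponent z k i"
      have "- (q * ?x) \<le> \<bar>q\<bar> * \<bar>?x\<bar>" by (metis abs_ge_minus_self abs_mult)
      also have "\<dots> \<le> \<bar>q\<bar> * err k" using ln_pmf_bounds[OF i a] by (intro mult_left_mono) auto
      finally have "q * ln (pmf (p k) a) \<le> - q * (block_nominal k * type_exponent z k i) + \<bar>q\<bar> * err k"
        by (simp add: algebra_simps)
      then show "pmf (p k) a powr q \<le> exp (- q * (block_nominal k * type_exponent z k i) + \<bar>q\<bar> * err k)"
        using pos by (simp add: powr_def)
    qed
    also have "\<dots> = card (F k i) * exp (- q * (block_nominal k * type_exponent z k i) + \<bar>q\<bar> * err k)" by simp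
    also have "\<dots> \<le> exp (block_nominal k * type_dim k i + err k) * exp (- q * (block_nominal k * type_exponent z k i) + \<bar>q\<bar> * err k)"
      using card_le[OF i] by (intro mult_right_mono) auto
    also have "\<dots> = exp (block_nominal k * (type_dim k i - q * type_exponent z k i) + (1 + \<bar>q\<bar>) * err k)"
      unfolding exp_add[symmetric] by (simp add: algebra_simps)
    also have "\<dots> \<le> exp (m * block_nominal k + (1 + \<bar>q\<bar>) * err k)"
      using mult_left_mono[OF assms[OF i] nominal_nonneg[of k]] by (simp add: mult.commute)
    finally show "(\<Sum>a\<in>F k i. pmf (p k) a powr q) \<le> exp (m * block_nominal k + (1 + \<bar>q\<bar>) * err k)" .
  qed
  also have "\<dots> = real (block_types k) * exp (m * block_nominal k + (1 + \<bar>q\<bar>) * err k)" by simp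
  also have "\<dots> \<le> exp (err k) * exp (m * block_nominal k + (1 + \<bar>q\<bar>) * err k)"
  proof (rule mult_right_mono)
    have "exp (real k + 5) \<le> exp (err k)" by (simp add: block_slack_def)
    then show "real (block_types k) \<le> exp (err k)" using block_types_le[of k] by linarith
  qed simp
  also have "\<dots> = exp (m * block_nominal k + (2 + \<bar>q\<bar>) * err k)"
    unfolding exp_add[symmetric] by (simp add: algebra_simps)
  finally have "ln (psum q k) \<le> ln (exp (m * block_nominal k + (2 + \<bar>q\<bar>) * err k))"
    using psum_pos[of q k] by (subst ln_le_cancel_iff) auto
  then show ?thesis by simp
qed

text \<open>Admissible types contribute at most \<open>- t q\<close> by the definition of the
  transform as an infimum. So does type 1, for all \<open>k\<close> if its exponent is a slope at 0,
  and on the half-line domain once its exponent exceeds \<open>(T + t q) / q\<close>.\<close>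

lemma psum_upper:
  assumes "- \<tau> q < ereal c"
  shows "\<forall>\<^sub>F k in sequentially. ln (psum q k) \<le> c * block_len k"
proof -
  have q: "q \<in> tdom \<tau>"
  proof (rule ccontr)
    assume "q \<notin> tdom \<tau>"
    then show False using assms \<tau>_out[of q] by simp
  qed
  have c: "- t q < c" using assms \<tau>_eq[OF q] by simp
  have full: "\<forall>\<^sub>F k in sequentially. T - q * z k \<le> - t q"
  proof (cases "tdom \<tau> = UNIV")
    case True
    then show ?thesis using z_UNIV by simp
  next
    case False
    then have half: "tdom \<tau> = {0..}" using dom by simp
    then have q0: "0 \<le> q" using q by simp
    show ?thesis
    proof (cases "q = 0")
      case True
      then show ?thesis by (simp add: T_def)
    next
      case False
      then have qpos: "0 < q" using q0 by simp
      show ?thesis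
        using eventually_ge_at_top[of "nat \<lceil>(T + t q) / q\<rceil>"]
      proof eventually_elim
        case (elim k)
        then have "(T + t q) / q \<le> real k + d" by linarith
        then have "T + t q \<le> (real k + d) * q" by (simp only: pos_divide_le_eq[OF qpos])
        then show ?case using z_half[OF half, of k] by (simp add: mult.commute)
      qed
    qed
  qed
  show ?thesis
    using full eventually_nominal(2)[OF c, of "2 + \<bar>q\<bar>"]
  proof eventually_elim
    case (elim k)
    have "type_dim k i - q * type_exponent z k i \<le> - t q" for i
    proof -
      have "dim_at D - q * D \<le> - t q" by (rule dim_at_le[OF D_admissible(1) q])
      moreover have "dim_at (rep k (i - 2)) - q * rep k (i - 2) \<le> - t q" by (rule dim_at_le[OF rep(1) q])
      ultimately show ?thesis using elim by (simp add: type_dim_def type_exponent_def D_admissible)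
    qed
    then have "ln (psum q k) \<le> - t q * block_nominal k + (2 + \<bar>q\<bar>) * err k" by (rule psum_le_types)
    then show ?case using elim by linarith
  qed
qed

lemma psum_lower_slope:
  assumes a: "a \<in> admissible" and c: "c < dim_at a - q * a"
  shows "\<forall>\<^sub>F k in sequentially. c * block_len k \<le> ln (psum q k)"
proof -
  obtain c' where c': "c < c'" "c' < dim_at a - q * a" using dense[OF c] by blast
  \<comment> \<open>Half of the gap is for the dimension of the type, half for \<open>q\<close>
    times its exponent.\<close>
  define e where "e = (dim_at a - q * a - c') / 2"
  have e: "0 < e" using c' by (simp add: e_def)
  have "ereal a \<noteq> -\<infinity>" "0 \<le> legendre \<tau> (ereal a)" using a by (auto simp: admissible_def)
  then obtain i where i: "\<And>k. i k < block_types k"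
    "(\<lambda>k. ereal (type_exponent z k (i k))) \<longlonglongrightarrow> ereal a"
    "\<And>s. ereal s < legendre \<tau> (ereal a) \<Longrightarrow> \<forall>\<^sub>F k in sequentially. s < type_dim k (i k)"
    by (rule exists_types) blast
  have 1: "\<forall>\<^sub>F k in sequentially. dim_at a - e < type_dim k (i k)"
    by (rule i(3)) (use e dim_at(1)[OF a] in simp)
  have "(\<lambda>k. q * type_exponent z k (i k)) \<longlonglongrightarrow> q * a"
    using i(2) by (intro tendsto_intros) simp
  then have 2: "\<forall>\<^sub>F k in sequentially. q * type_exponent z k (i k) < q * a + e"
    by (rule order_tendstoD(2)) (use e in simp)
  show ?thesis
    using 1 2 eventually_nominal(1)[OF c'(1), of "\<bar>q\<bar>"]
  proof eventually_elim
    case (elim k)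
    have "dim_at a - q * a - 2 * e = c'" by (simp add: e_def field_simps)
    then have "c' \<le> type_dim k (i k) - q * type_exponent z k (i k)" using elim by linarith
    from mult_left_mono[OF this nominal_nonneg[of k]]
    have "c' * block_nominal k \<le> block_nominal k * (type_dim k (i k) - q * type_exponent z k (i k))"
      by (simp add: mult.commute)
    then show ?case using psum_ge_type[OF i(1), of k q] elim by linarith
  qed
qed

text \<open>At an interior \<open>q\<close> a supporting slope is an admissible exponent attaining
  \<open>- \<tau> q\<close>. Otherwise the domain is the half-line and type 1 takes over:
  \<open>T - q * z k\<close> equals \<open>T\<close> for \<open>q = 0\<close> and tends to infinity
  for negative \<open>q\<close>, where \<tau> is \<open>-\<infinity>\<close>.\<close>

lemma psum_lower:
  assumes "ereal c < - \<tau> q"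
  shows "\<forall>\<^sub>F k in sequentially. c * block_len k \<le> ln (psum q k)"
proof (cases "q \<in> interior (tdom \<tau>)")
  case True
  then have q: "q \<in> tdom \<tau>" using interior_subset by blast
  obtain a where a: "\<And>q'. q' \<in> tdom \<tau> \<Longrightarrow> t q' \<le> t q + a * (q' - q)"
    using supporting_slope[OF True] by blast
  have adm: "a \<in> admissible" unfolding admissible_def using legendre_slope_nonneg[OF q a] by simp
  have "dim_at a = a * q - t q" unfolding dim_at_def by (simp add: legendre_slope[OF q a])
  then show ?thesis using assms \<tau>_eq[OF q] by (intro psum_lower_slope[OF adm]) (simp add: mult.commute)
next
  case False
  then have half: "tdom \<tau> = {0..}" using dom by auto
  have q: "q \<le> 0"
  proof (rule ccontr)
    assume "\<not> q \<le> 0"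
    then have "q \<in> interior {0..}" by (intro interiorI[of "{0<..}"]) auto
    then show False using False half by simp
  qed
  \<comment> \<open>At \<open>q = 0\<close> there is room below \<open>T\<close> because
    \<open>c < - \<tau> 0\<close>; for negative \<open>q\<close> any real value is eventually
    exceeded, so \<open>c + 1\<close> will do.\<close>
  obtain c' where c': "c < c'" "q = 0 \<Longrightarrow> c' < T"
  proof (cases "q = 0")
    case True
    then have "c < T" using assms \<tau>_eq[of 0] half by (simp add: T_def)
    then show ?thesis using that dense by blast
  qed (use that[of "c + 1"] in simp)
  have "\<forall>\<^sub>F k in sequentially. c' \<le> T - q * z k"
  proof (cases "q = 0")
    case False
    then have q0: "0 < - q" using q by simp
    show ?thesis
      using eventually_ge_at_top[of "nat \<lceil>(c' - T) / (- q)\<rceil>"]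
    proof eventually_elim
      case (elim k)
      then have "(c' - T) / (- q) \<le> real k + d" by linarith
      then have "c' - T \<le> (real k + d) * (- q)" by (simp only: pos_divide_le_eq[OF q0])
      then show ?case using z_half[OF half, of k] by (simp add: mult.commute)
    qed
  qed (use c' in simp)
  then show ?thesis
    using eventually_nominal(1)[OF c'(1), of "\<bar>q\<bar>"]
  proof eventually_elim
    case (elim k)
    have one: "1 < block_types k" by (simp add: block_types_def)
    have "c' * block_nominal k \<le> block_nominal k * (type_dim k 1 - q * type_exponent z k 1)"
      using mult_left_mono[OF elim(1) nominal_nonneg[of k]] by (simp add: mult.commute type_dim_def type_exponent_def)
    then show ?case using psum_ge_type[OF one, of q] elim by linarith
  qed
qed

lemma types_realized:
  assumes \<alpha>: "\<alpha> \<noteq> -\<infinity>" "0 \<le> legendre \<tau> \<alpha>"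
  shows "\<exists>A. (\<forall>k. A k \<subseteq> digits k \<and> A k \<noteq> {}) \<and>
        (\<forall>s>0. ereal s < legendre \<tau> \<alpha> \<longrightarrow> (\<forall>\<^sub>F k in sequentially. s * block_len k \<le> ln (card (A k)))) \<and>
        (\<forall>a. (\<forall>k. a k \<in> A k) \<longrightarrow> (\<lambda>k. ereal (- ln (pmf (p k) (a k)) / block_len k)) \<longlonglongrightarrow> \<alpha>)"
proof -
  obtain i where i: "\<And>k. i k < block_types k"
    "(\<lambda>k. ereal (type_exponent z k (i k))) \<longlonglongrightarrow> \<alpha>"
    "\<And>s. ereal s < legendre \<tau> \<alpha> \<Longrightarrow> \<forall>\<^sub>F k in sequentially. s < type_dim k (i k)"
    by (rule exists_types[OF \<alpha>]) blast
  show ?thesis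
  proof (intro exI[of _ "\<lambda>k. F k (i k)"] conjI allI impI)
    show "F k (i k) \<subseteq> digits k" "F k (i k) \<noteq> {}" for k using F_digits F_nonempty i(1) by auto
    show "(\<lambda>k. ereal (- ln (pmf (p k) (a k)) / block_len k)) \<longlonglongrightarrow> \<alpha>" if "\<forall>k. a k \<in> F k (i k)" for a
      by (rule type_limit[OF i(1) _ i(2)]) (use that in blast)
    fix s assume "ereal s < legendre \<tau> \<alpha>"
    then obtain b where "ereal s < b" "b < legendre \<tau> \<alpha>" using dense by blast
    then obtain s' where s': "s < s'" "ereal s' < legendre \<tau> \<alpha>" by (cases b) auto
    show "\<forall>\<^sub>F k in sequentially. s * block_len k \<le> ln (card (F k (i k)))"
      using i(3)[OF s'(2)] eventually_nominal(1)[OF s'(1), of 0]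
    proof eventually_elim
      case (elim k)
      have "s' * block_nominal k \<le> block_nominal k * type_dim k (i k)"
        using mult_left_mono[OF less_imp_le[OF elim(1)] nominal_nonneg[of k]] by (simp add: mult.commute)
      then show ?case using ln_card_ge[OF i(1), of k] elim(2) by linarith
    qed
  qed
qed

lemma exact_realized:
  "\<exists>A. (\<forall>k. A k \<subseteq> digits k \<and> A k \<noteq> {}) \<and> summable (\<lambda>k. 1 - measure (measure_pmf (p k)) (A k)) \<and>
        (\<forall>a. (\<forall>k. a k \<in> A k) \<longrightarrow> (\<lambda>k. ereal (- ln (pmf (p k) (a k)) / block_len k)) \<longlonglongrightarrow> ereal D)"
proof (intro exI[of _ "\<lambda>k. F k 0"] conjI allI impI)
  have i: "0 < block_types k" for k by (simp add: block_types_def)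
  show "F k 0 \<subseteq> digits k" "F k 0 \<noteq> {}" for k using F_digits F_nonempty i by auto
  show "(\<lambda>k. ereal (- ln (pmf (p k) (a k)) / block_len k)) \<longlonglongrightarrow> ereal D" if "\<forall>k. a k \<in> F k 0" for a
    by (rule type_limit[OF i, where a = a]) (use that in \<open>auto simp: type_exponent_def\<close>)
  show "summable (\<lambda>k. 1 - measure (measure_pmf (p k)) (F k 0))"
  proof (rule summable_comparison_test)
    show "summable (\<lambda>k. exp (-1 :: real) ^ k)" by (rule summable_geometric) simp
    have "1 - measure (measure_pmf (p k)) (F k 0) \<le> exp (-1) ^ k" for k
    proof -
      have "1 - measure (measure_pmf (p k)) (F k 0) \<le> 2 * real (block_types k) * exp (- block_slack k)"
        using mass_0[of k] by linarith
      also have "\<dots> \<le> exp (real k + 5) * exp (- block_slack k)"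
        using block_types_le[of k] by (intro mult_right_mono) auto
      also have "\<dots> = exp (- real k)" unfolding exp_add[symmetric] by (simp add: block_slack_def)
      also have "\<dots> = exp (-1) ^ k" by (simp add: exp_of_nat_mult[symmetric])
      finally show ?thesis .
    qed
    then show "\<exists>N. \<forall>k\<ge>N. norm (1 - measure (measure_pmf (p k)) (F k 0)) \<le> exp (-1) ^ k"
      by (auto simp: abs_of_nonneg)
  qed
qed

theorem realized:
  "Mc mu \<and> homog_multifractal mu \<and> exact_dimensional mu D \<and> Lq_spectrum mu = \<tau> \<and>
    (\<forall>\<alpha>. \<alpha> \<noteq> -\<infinity> \<longrightarrow> fH mu \<alpha> = legendre (Lq_spectrum mu) \<alpha>)"
  by (rule realization[OF no_pinf legpos psum_upper psum_lower types_realized exact_realized])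

end

theorem theorem1p1:
  fixes \<tau> :: "real \<Rightarrow> ereal" and D :: real
  assumes no_pinf: "\<forall>q. \<tau> q \<noteq> \<infinity>"
    and conc: "concave_ext \<tau>"
    and mono: "mono \<tau>"
    and one: "\<tau> 1 = 0"
    and zero: "- ereal (real DIM('a::euclidean_space)) \<le> \<tau> 0" "\<tau> 0 \<le> 0"
    and dom: "tdom \<tau> = UNIV \<or> tdom \<tau> = {0..}"
    and legpos: "\<forall>\<alpha>. \<alpha> \<noteq> -\<infinity> \<and> legendre \<tau> \<alpha> > -\<infinity> \<longrightarrow> legendre \<tau> \<alpha> \<ge> 0"
    and D: "right_deriv \<tau> 1 \<le> D" "D \<le> left_deriv \<tau> 1"
  shows "\<exists>\<mu> :: 'a measure. Mc \<mu> \<and> homog_multifractal \<mu> \<and> exact_dimensional \<mu> D \<and>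
           Lq_spectrum \<mu> = \<tau> \<and>
           (\<forall>\<alpha>. \<alpha> \<noteq> -\<infinity> \<longrightarrow> fH \<mu> \<alpha> = legendre (Lq_spectrum \<mu>) \<alpha>)"
proof -
  interpret spectrum \<tau> D "DIM('a)"
    by unfold_locales (use assms in auto)
  obtain z where z: "\<And>k. T \<le> z k" "tdom \<tau> = UNIV \<Longrightarrow> (\<forall>k q. T - q * z k \<le> - t q)"
    "tdom \<tau> = {0..} \<Longrightarrow> \<forall>k. z k = real k + DIM('a)" by (rule exists_full) blast
  have "\<exists>n (p :: ('a \<Rightarrow> nat) pmf) F. block DIM('a) (block_nominal k) (block_slack k) (block_types k)
      (type_dim k) (type_exponent z k) n p F" for k
  proof (rule exists_block[where T = T])
    have "exp (real k + 5) \<le> exp (block_slack k)" by (simp add: block_slack_def)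
    then show "4 * real (block_types k) \<le> exp (block_slack k)" using block_types_le[of k] by linarith
    show "0 \<le> type_dim k i" "type_dim k i \<le> T" "type_dim k i \<le> type_exponent z k i" for i
      using dim_at[OF rep(1), of k "i - 2"] T_bounds D_bounds z(1)[of k]
      by (auto simp: type_dim_def type_exponent_def)
  qed (use T_bounds in \<open>auto simp: block_nominal_def block_types_def type_dim_def type_exponent_def\<close>)
  then obtain n and p :: "nat \<Rightarrow> ('a \<Rightarrow> nat) pmf" and F where
    "\<And>k. block DIM('a) (block_nominal k) (block_slack k) (block_types k) (type_dim k) (type_exponent z k) (n k) (p k) (F k)"
    by metis
  interpret spectrum_blocks \<tau> D "DIM('a)" z n p F
    by unfold_locales (use \<open>\<And>k. block _ _ _ _ _ _ (n k) (p k) (F k)\<close> z(2,3) in simp_all)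
  show ?thesis using realized by blast
qed

end
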